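(* Let $q,z,a,b,c,h$ be non-zero complex numbers with $|q|<1$, $|z|<1$, and assume there are no vanishing denominator factors (e.g. $qa/b,qa/c\notin\{q^{-k}:k\in\mathbb N_0\}$ and $h,\,ha/(bcz)\notin\{q^k:k\in\mathbb Z\}$). Then $${}_3\phi_2\!\left(a,b,c;\tfrac{qa}b,\tfrac{qa}c;q,z\right)=\frac{\vartheta(hz^{-1},h\frac{qa}{bc};q)\,(a,b,c,\frac{b^2c^2z^2}{q^2a};q)_\infty}{\vartheta(h,h\frac{qa}{bcz};q)\,(\frac{qa}b,\frac{qa}c,\frac{b^2c^2}{q^2a},z;q)_\infty}\;{}_5\phi_4\!\left(\tfrac qb,\tfrac qc,\tfrac{qa}{bc},z,\tfrac{q^3a}{b^2c^2z};\pm\tfrac{\sqrt{q^3a}}{bc},\pm\tfrac{q^2\sqrt a}{bc};q,q\right)$$ $$+\frac{(a,\frac{qa}{bc};q)_\infty}{2\,\vartheta(h,h\frac{qa}{bcz};q)\,(\frac{qa}b,\frac{qa}c;q)_\infty}\,\Big(T(\sqrt a)+T(-\sqrt a)\Big),$$ where, for $s\in\{\sqrt a,-\sqrt a\}$, $$T(s)=\frac{\vartheta(hs,h\frac{qs}{bcz};q)\,(\frac{qs}b,\frac{qs}c,\frac{bcz}{qs};q)_\infty}{(s,\frac{qs}{bc},\frac{bcz}{qs};q)_\infty}\;{}_5\phi_4\!\left(s,\tfrac bs,\tfrac cs,\tfrac{bcz}{qs},\tfrac{q^2s}{bcz};-q,\pm\sqrt q,\tfrac{bc}s;q,q\right)$$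 $$-\frac{\vartheta(h\sqrt q\,s,h\frac{\sqrt q\,s}{bcz};q)\,(\frac{\sqrt q\,s}b,\frac{\sqrt q\,s}c,\frac{bcz}{q^{3/2}s};q)_\infty}{(\sqrt q\,s,\frac{\sqrt q\,s}{bc},\frac{bcz}{\sqrt q\,s};q)_\infty}\;{}_5\phi_4\!\left(\sqrt q\,s,\tfrac{\sqrt q\,b}s,\tfrac{\sqrt q\,c}s,\tfrac{bcz}{\sqrt q\,s},\tfrac{q^{5/2}s}{bcz};-q,\pm q^{3/2},\tfrac{\sqrt q\,bc}s;q,q\right).$$
   Context: Notation. $(a;q)_k=\prod_{j=0}^{k-1}(1-aq^j)$, $(a;q)_\infty=\prod_{j\ge0}(1-aq^j)$, $(a_1,\dots,a_r;q)_k=\prod_j(a_j;q)_k$ for $k\in\mathbb N_0\cup\{\infty\}$. In a parameter list, $\pm x$ stands for the two entries $x,-x$. ${}_{r+1}\phi_r(a_1,\dots,a_{r+1};b_1,\dots,b_r;q,z)=\sum_{k\ge0}\frac{(a_1,\dots,a_{r+1};q)_k}{(q,b_1,\dots,b_r;q)_k}z^k$ for $|z|<1$. $\vartheta(x;q)=(x,q/x;q)_\infty$ for $x\neq0$, and $\vartheta(x_1,\dots,x_k;q)=\prod_j\vartheta(x_j;q)$. Fixed square roots $\sqrt q,\sqrt a$ are chosen, with $\sqrt{q^3a}=q\sqrt q\sqrt a$ and $q^{j/2}=(\sqrt q)^j$. Convention "no vanishing denominator factors": every infinite $q$-shifted factorial and every theta function appearing in a denominator is non-zero, and no denominator parameter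 of any series lies in $\{q^{-k}:k\in\mathbb N_0\}$.
   Formalization: The printed identity is false (e.g. as a→1/q). Two corrections: in the first term's numerator (b²c²z²/(q²a);q)_∞ is replaced by (b²c²z/(q²a);q)_∞, and the second, subtracted product in T(s) is multiplied by q/(1−q). *)

theory Defs
  imports "HOL-Analysis.Analysis"
begin

definition qpoch :: "complex \<Rightarrow> complex \<Rightarrow> nat \<Rightarrow> complex" where
  "qpoch a q k = (\<Prod>j<k. 1 - a * q ^ j)"

definition qpoch_inf :: "complex \<Rightarrow> complex \<Rightarrow> complex" where
  "qpoch_inf a q = (\<Prod>j. 1 - a * q ^ j)"

definition qpochs :: "complex list \<Rightarrow> complex \<Rightarrow> nat \<Rightarrow> complex" where
  "qpochs as q k = (\<Prod>a\<leftarrow>as. qpoch a q k)"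

definition qpochs_inf :: "complex list \<Rightarrow> complex \<Rightarrow> complex" where
  "qpochs_inf as q = (\<Prod>a\<leftarrow>as. qpoch_inf a q)"

text \<open>Basic hypergeometric series with \<open>r + 1\<close> upper parameters \<open>as\<close> and \<open>r\<close> lower
  parameters \<open>bs\<close>; used only with \<open>length as = length bs + 1\<close> and \<open>norm z < 1\<close>.\<close>

definition qphi :: "complex list \<Rightarrow> complex list \<Rightarrow> complex \<Rightarrow> complex \<Rightarrow> complex" where
  "qphi as bs q z = (\<Sum>k. qpochs as q k / qpochs (q # bs) q k * z ^ k)"

definition qtheta :: "complex \<Rightarrow> complex \<Rightarrow> complex" where
  "qtheta x q = qpochs_inf [x, q / x] q"

definition qthetas :: "complex list \<Rightarrow> complex \<Rightarrow> complex" where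
  "qthetas xs q = (\<Prod>x\<leftarrow>xs. qtheta x q)"

definition admissible_lower :: "complex list \<Rightarrow> complex \<Rightarrow> bool" where
  "admissible_lower bs q \<longleftrightarrow> (\<forall>b\<in>set bs. \<forall>k::nat. b \<noteq> q powi (- int k))"

text \<open>In \<open>T_term\<close>, \<open>r\<close> is the chosen square root of \<open>q\<close>, so the half-integer power \<open>q\<^bsup>j/2\<^esup>\<close>
  is \<open>r ^ j\<close>; the argument \<open>s\<close> is one of the two square roots of \<open>a\<close>.

  The factor \<open>q / (1 - q)\<close> in front of the second product is absent from the printed source,
  whose identity fails without it: when \<open>a\<close> tends to \<open>1 / q\<close>, the left-hand side of the
  transformation tends to \<open>1 - b * c * z / q\<close>, while the printed right-hand side tends to
  \<open>(1 - q) / q\<close> times that value.\<close>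

definition T_term ::
  "complex \<Rightarrow> complex \<Rightarrow> complex \<Rightarrow> complex \<Rightarrow> complex \<Rightarrow> complex \<Rightarrow> complex \<Rightarrow> complex" where
  "T_term q r z b c h s =
     qthetas [h * s, h * (q * s / (b * c * z))] q
       * qpochs_inf [q * s / b, q * s / c, b * c * z / (q * s)] q
       / qpochs_inf [s, q * s / (b * c), b * c * z / (q * s)] q
       * qphi [s, b / s, c / s, b * c * z / (q * s), q ^ 2 * s / (b * c * z)]
              [- q, r, - r, b * c / s] q q
     - q / (1 - q)
       * (qthetas [h * r * s, h * (r * s / (b * c * z))] q
       * qpochs_inf [r * s / b, r * s / c, b * c * z / (r ^ 3 * s)] q
       / qpochs_inf [r * s, r * s / (b * c), b * c * z / (r * s)] q
       * qphi [r * s, r * b / s, r * c / s, b * c * z / (r * s), r ^ 5 * s / (b * c * z)]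
              [- q, r ^ 3, - (r ^ 3), r * b * c / s] q q)"

text \<open>In \<open>X_term\<close>, \<open>t\<close> is the chosen square root of \<open>a\<close>, and \<open>q * r * t\<close> is the square root
  of \<open>q\<^sup>3 a\<close>.

  The last numerator factor is \<open>(b\<^sup>2 c\<^sup>2 z / (q\<^sup>2 a); q)\<close>, with \<open>z\<close> to the first
  power; the printed source has \<open>z\<^sup>2\<close> there, for which the identity fails numerically.\<close>

definition X_term ::
  "complex \<Rightarrow> complex \<Rightarrow> complex \<Rightarrow> complex \<Rightarrow> complex \<Rightarrow> complex \<Rightarrow> complex \<Rightarrow> complex \<Rightarrow> complex"
where
  "X_term q r z a t b c h =
     qthetas [h / z, h * (q * a / (b * c))] q
       * qpochs_inf [a, b, c, b ^ 2 * c ^ 2 * z / (q ^ 2 * a)] q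
       / (qthetas [h, h * (q * a / (b * c * z))] q
          * qpochs_inf [q * a / b, q * a / c, b ^ 2 * c ^ 2 / (q ^ 2 * a), z] q)
       * qphi [q / b, q / c, q * a / (b * c), z, q ^ 3 * a / (b ^ 2 * c ^ 2 * z)]
              [q * r * t / (b * c), - (q * r * t / (b * c)),
               q ^ 2 * t / (b * c), - (q ^ 2 * t / (b * c))] q q"

end

theory Submission
  imports Defs "HOL-Complex_Analysis.Complex_Analysis"
begin

text \<open>Put \<open>d = b c z / q\<close>. Both sides of the identity are evaluations of the integral of
  \<open>\<theta>(h y / d, h a / y) / (a / y, d / y; q)\<^sub>\<infinity> \<cdot> (q y / b, q y / c, d y / a; q)\<^sub>\<infinity> / (q y / (b c), y\<^sup>2 / a; q)\<^sub>\<infinity>\<close>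
  with respect to \<open>dy / y\<close> over a circle that separates the poles at \<open>a q\<^sup>k\<close>, \<open>d q\<^sup>k\<close> from those at
  \<open>b c / q\<^bsup>k + 1\<^esup>\<close> and \<open>y\<^sup>2 = a / q\<^sup>k\<close>.

  The first factor has moments proportional to the Rogers-Szego polynomials in \<open>a\<close> and \<open>d\<close>, with all
  dependence on \<open>h\<close> in the constant \<open>\<theta>(h, h a / d) / (q; q)\<^sub>\<infinity>\<close>. Expanding the second factor in powers
  of \<open>y\<close> and summing with the q-binomial and q-Saalschuetz theorems gives the \<open>\<^sub>3\<phi>\<^sub>2\<close>. The residues outside
  the circle give the five series on the right: \<open>b c / q\<^bsup>k + 1\<^esup>\<close> yields the first term, and \<open>s / q\<^sup>k\<close>,
  \<open>s / (\<surd>q q\<^sup>k)\<close> the two parts of \<open>T(s)\<close>.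

  A separating circle exists only for restricted parameters. Replacing \<open>\<surd>a, z\<close> by \<open>u \<surd>a, u\<^sup>3 z\<close> puts
  the parameters into this range for small \<open>u\<close>, and analytic continuation in \<open>u\<close> reaches \<open>u = 1\<close>.\<close>

section \<open>Shifted factorials and basic hypergeometric series\<close>

text \<open>The kernel obeys two first-order q-difference equations. Up to constants, the step from
  \<open>d\<close> to \<open>d * q\<close> multiplies it by \<open>y - d\<close>, and the step from
  \<open>y\<close> to \<open>y / q\<close> by \<open>(y - a) * (y - d)\<close>, the latter without
  \<open>h\<close>. Together they fix every moment up to the zeroth, where alone \<open>h\<close>
  survives.

  The inner evaluation uses values at \<open>a * q ^ j\<close> only. There \<open>y ^ 2 / a\<close>
  becomes \<open>a * q ^ (2 * j)\<close>, and the q-binomial theorem completes the resulting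
  factorial so that \<open>qpoch (a * q ^ k) q j\<close> appears, the entry that the q-Saalschuetz
  sum requires.

  Outside the circle, the value of the integrand at \<open>y / q\<close> is a rational multiple of
  that at \<open>y\<close>. This one relation yields the term ratio of each residue series and the
  decay on growing circles. The constant \<open>q / (1 - q)\<close> in \<open>T_term\<close> is
  minus the reciprocal of \<open>1 - 1 / q\<close>, the first factor of
  \<open>qpoch_inf (y ^ 2 / a) q\<close> at \<open>y = s / r\<close>.

  In the continuation, \<open>d\<close>, \<open>a\<close> and \<open>t\<close> scale with exponents
  3, 2 and 1, which orders their norms for small \<open>u\<close>; scaling the root \<open>t\<close>
  instead of \<open>a\<close> avoids any choice of branch.\<close>

lemma qpoch_0 [simp]: "qpoch a q 0 = 1"
  by (simp add: qpoch_def)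

lemma qpoch_Suc: "qpoch a q (Suc k) = qpoch a q k * (1 - a * q ^ k)"
  by (simp add: qpoch_def mult.commute)

lemma qpoch_Suc_left: "qpoch a q (Suc k) = (1 - a) * qpoch (a * q) q k"
  unfolding qpoch_def prod.lessThan_Suc_shift by (simp add: mult_ac)

lemma qpoch_add: "qpoch a q (m + n) = qpoch a q m * qpoch (a * q ^ m) q n"
  by (induction n) (simp_all add: qpoch_Suc power_add mult.assoc)

lemma qpochs_Nil [simp]: "qpochs [] q k = 1" and qpochs_Cons [simp]: "qpochs (x # xs) q k = qpoch x q k * qpochs xs q k"
  by (simp_all add: qpochs_def)

lemma qpochs_inf_Nil [simp]: "qpochs_inf [] q = 1"
  and qpochs_inf_Cons [simp]: "qpochs_inf (x # xs) q = qpoch_inf x q * qpochs_inf xs q"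
  by (simp_all add: qpochs_inf_def)

lemma qthetas_Nil [simp]: "qthetas [] q = 1"
  and qthetas_Cons [simp]: "qthetas (x # xs) q = qtheta x q * qthetas xs q"
  by (simp_all add: qthetas_def)

lemma summable_norm_qpoch:
  fixes q :: complex
  assumes "norm q < 1"
  shows "summable (\<lambda>k. norm (x * q ^ k))"
  using assms by (auto simp: norm_mult norm_power intro!: summable_mult summable_geometric)

text \<open>The bound is uniform in \<open>k\<close>, so it passes to \<open>qpoch_inf\<close> and
  enters the majorants of the series.\<close>

lemma norm_qpoch_le:
  assumes "norm q < 1"
  shows "norm (qpoch x q k) \<le> exp (norm x / (1 - norm q))"
proof -
  have "norm (qpoch x q k) \<le> (\<Prod>j<k. 1 + norm (x * q ^ j))"
    unfolding qpoch_def prod_norm[symmetric] by (intro prod_mono) (auto intro: order_trans[OF norm_triangle_ineq4])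
  also have "\<dots> \<le> exp (\<Sum>j<k. norm (x * q ^ j))"
    by (rule prod_le_exp_sum) auto
  also have "(\<Sum>j<k. norm (x * q ^ j)) \<le> (\<Sum>j. norm (x * q ^ j))"
    by (intro sum_le_suminf summable_norm_qpoch assms) auto
  also have "\<dots> = norm x / (1 - norm q)"
    using assms by (simp add: norm_mult norm_power suminf_mult suminf_geometric summable_geometric)
  finally show ?thesis by simp
qed

lemma convergent_prod_qpoch:
  fixes q :: complex
  assumes "norm q < 1"
  shows "convergent_prod (\<lambda>k. 1 - x * q ^ k)"
proof -
  have "summable (\<lambda>k. norm ((1 - x * q ^ k) - 1))"
    using summable_norm_qpoch[OF assms, of x] by simp
  thus ?thesis
    by (intro abs_convergent_prod_imp_convergent_prod summable_imp_abs_convergent_prod)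
qed

lemma qpoch_LIMSEQ:
  assumes "norm q < 1"
  shows "qpoch x q \<longlonglongrightarrow> qpoch_inf x q"
proof -
  have "(\<lambda>n. \<Prod>i\<le>n. 1 - x * q ^ i) \<longlonglongrightarrow> qpoch_inf x q"
    unfolding qpoch_inf_def by (rule convergent_prod_LIMSEQ[OF convergent_prod_qpoch[OF assms]])
  thus ?thesis unfolding qpoch_def using LIMSEQ_lessThan_iff_atMost by blast
qed

lemma norm_qpoch_inf_le:
  assumes "norm q < 1"
  shows "norm (qpoch_inf x q) \<le> exp (norm x / (1 - norm q))"
  by (rule LIMSEQ_le_const2[OF tendsto_norm[OF qpoch_LIMSEQ[OF assms]]]) (use norm_qpoch_le[OF assms] in auto)

lemma qpoch_uniform_limit:
  assumes "norm q < 1"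
  shows "uniform_limit (cball 0 M) (\<lambda>n x. qpoch x q n) (\<lambda>x. qpoch_inf x q) sequentially"
proof -
  have "uniformly_convergent_on (cball 0 M) (\<lambda>N x. \<Sum>n<N. norm (- (x * q ^ n)))"
  proof (rule Weierstrass_m_test')
    show "summable (\<lambda>n. M * norm q ^ n)"
      using assms by (intro summable_mult summable_geometric) auto
  qed (auto simp: norm_mult norm_power intro!: mult_right_mono)
  hence "uniformly_convergent_on (cball 0 M) (\<lambda>N x. \<Prod>n<N. 1 + - (x * q ^ n))"
    by (intro uniformly_convergent_on_prod continuous_intros) auto
  hence "uniformly_convergent_on (cball 0 M) (\<lambda>N x. qpoch x q N)"
    by (simp add: qpoch_def)
  then obtain l where l: "uniform_limit (cball 0 M) (\<lambda>n x. qpoch x q n) l sequentially"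
    by (auto simp: uniformly_convergent_on_def)
  have "l x = qpoch_inf x q" if "x \<in> cball 0 M" for x
    using tendsto_uniform_limitI[OF l that] qpoch_LIMSEQ[OF assms] LIMSEQ_unique by blast
  with l show ?thesis by (metis (no_types, lifting) uniform_limit_cong')
qed

lemma qpoch_inf_holomorphic:
  assumes "norm q < 1"
  shows "(\<lambda>x. qpoch_inf x q) holomorphic_on UNIV"
proof (rule holomorphic_uniform_sequence)
  show "(\<lambda>x. qpoch x q n) holomorphic_on UNIV" for n
    unfolding qpoch_def by (intro holomorphic_intros)
  fix x :: complex
  have "uniform_limit (cball x 1) (\<lambda>n x. qpoch x q n) (\<lambda>x. qpoch_inf x q) sequentially"
  proof (rule uniform_limit_on_subset[OF qpoch_uniform_limit[OF assms]])
    show "cball x 1 \<subseteq> cball 0 (norm x + 1)"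
      by (simp add: cball_subset_cball_iff dist_norm)
  qed
  thus "\<exists>d>0. cball x d \<subseteq> UNIV \<and> uniform_limit (cball x d) (\<lambda>n x. qpoch x q n) (\<lambda>x. qpoch_inf x q) sequentially"
    by (intro exI[of _ 1]) auto
qed auto

lemma holomorphic_on_qpoch_inf [holomorphic_intros]:
  assumes "norm q < 1" "f holomorphic_on A"
  shows "(\<lambda>x. qpoch_inf (f x) q) holomorphic_on A"
  using holomorphic_on_compose_gen[OF assms(2) qpoch_inf_holomorphic[OF assms(1)]] by (simp add: o_def)

lemma isCont_qpoch_inf:
  assumes "norm q < 1"
  shows "isCont (\<lambda>x. qpoch_inf x q) x"
  using holomorphic_on_imp_continuous_on[OF qpoch_inf_holomorphic[OF assms]] continuous_on_eq_continuous_at by blast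

lemma tendsto_qpoch_inf [tendsto_intros]:
  assumes "norm q < 1" "(f \<longlongrightarrow> l) F"
  shows "((\<lambda>x. qpoch_inf (f x) q) \<longlongrightarrow> qpoch_inf l q) F"
  by (rule isCont_tendsto_compose[OF isCont_qpoch_inf[OF assms(1)] assms(2)])

lemma qpoch_inf_split:
  assumes "norm q < 1"
  shows "qpoch_inf x q = qpoch x q k * qpoch_inf (x * q ^ k) q"
proof (rule LIMSEQ_unique)
  show "(\<lambda>n. qpoch x q (n + k)) \<longlonglongrightarrow> qpoch_inf x q"
    by (rule LIMSEQ_ignore_initial_segment[OF qpoch_LIMSEQ[OF assms]])
  have "(\<lambda>n. qpoch x q k * qpoch (x * q ^ k) q n) \<longlonglongrightarrow> qpoch x q k * qpoch_inf (x * q ^ k) q"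
    by (intro tendsto_intros qpoch_LIMSEQ assms)
  thus "(\<lambda>n. qpoch x q (n + k)) \<longlonglongrightarrow> qpoch x q k * qpoch_inf (x * q ^ k) q"
    by (subst add.commute, subst qpoch_add)
qed

lemma qpoch_inf_rec:
  assumes "norm q < 1"
  shows "qpoch_inf x q = (1 - x) * qpoch_inf (x * q) q"
  using qpoch_inf_split[OF assms, of x 1] by (simp add: qpoch_Suc)

text \<open>A convergent product may have finitely many zero factors, but without them its limit is
  nonzero, so it vanishes only if a factor does. Pole positions are later read off from the equation
  \<open>x * q ^ k = 1\<close>.\<close>

lemma qpoch_inf_eq_0_iff:
  assumes "norm q < 1"
  shows "qpoch_inf x q = 0 \<longleftrightarrow> (\<exists>k. x * q ^ k = 1)"
proof
  assume "qpoch_inf x q = 0"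
  thus "\<exists>k. x * q ^ k = 1"
    using prodinf_nonzero[OF convergent_prod_qpoch[OF assms, of x]] unfolding qpoch_inf_def by force
next
  assume "\<exists>k. x * q ^ k = 1"
  then obtain k where "x * q ^ k = 1" ..
  thus "qpoch_inf x q = 0"
    using qpoch_inf_split[OF assms, of x "Suc k"] by (simp add: qpoch_Suc)
qed

lemma qpoch_inf_nonzero:
  assumes "norm q < 1" "norm x < 1"
  shows "qpoch_inf x q \<noteq> 0"
proof
  assume "qpoch_inf x q = 0"
  then obtain k where "x * q ^ k = 1" using qpoch_inf_eq_0_iff[OF assms(1)] by blast
  hence "norm x * norm q ^ k = 1" by (metis norm_mult norm_power norm_one)
  moreover have "norm x * norm q ^ k \<le> norm x * 1"
    using assms by (intro mult_left_mono power_le_one) auto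
  ultimately show False using assms by simp
qed

lemma qpoch_inf_divide_nonzero: "norm q < 1 \<Longrightarrow> norm e < norm y \<Longrightarrow> qpoch_inf (e / y) q \<noteq> 0"
  by (intro qpoch_inf_nonzero) (auto simp: norm_divide divide_simps)

lemma norm_mult_q_power_le:
  fixes x q :: complex
  assumes "norm q < 1"
  shows "norm (x * q ^ k) \<le> norm x"
  using mult_left_mono[of "norm (q ^ k)" 1 "norm x"] power_le_one[of "norm q" k] assms by (simp add: norm_mult norm_power)

lemma qpoch_inf_0 [simp]: "qpoch_inf 0 q = 1"
  by (simp add: qpoch_inf_def)

lemma qpoch_q_nonzero: "norm q < 1 \<Longrightarrow> qpoch q q k \<noteq> 0"
  using qpoch_inf_nonzero[of q q] qpoch_inf_split[of q q k] by auto

lemma qpoch_nonzero_if_inf: "norm q < 1 \<Longrightarrow> qpoch_inf x q \<noteq> 0 \<Longrightarrow> qpoch x q k \<noteq> 0"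
  using qpoch_inf_split[of q x k] by auto

text \<open>Replaces the condition on lower parameters by non-vanishing of a holomorphic function,
  the form suited to continuation.\<close>

lemma admissible_lower_Cons:
  assumes "q \<noteq> 0" "norm q < 1"
  shows "admissible_lower (b # bs) q \<longleftrightarrow> qpoch_inf b q \<noteq> 0 \<and> admissible_lower bs q"
proof -
  have "b = q powi (- int k) \<longleftrightarrow> b * q ^ k = 1" for k
    using assms by (simp add: power_int_minus field_simps)
  thus ?thesis
    by (auto simp: admissible_lower_def qpoch_inf_eq_0_iff[OF assms(2)])
qed

lemma admissible_lower_Nil [simp]: "admissible_lower [] q"
  by (simp add: admissible_lower_def)

lemma qtheta_eq: "qtheta x q = qpoch_inf x q * qpoch_inf (q / x) q"
  by (simp add: qtheta_def)

text \<open>The shift removes \<open>1 - x\<close> from the first product and adds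
  \<open>1 - 1 / x\<close> to the second; the quotient of these factors is \<open>- 1 / x\<close>.
  The difference equations of \<open>kern\<close> come from this.\<close>

lemma qtheta_mult_q:
  assumes "norm q < 1" "q \<noteq> 0" "x \<noteq> 0"
  shows "qtheta (x * q) q = - qtheta x q / x"
proof -
  have 1: "qpoch_inf (1 / x) q = (1 - 1 / x) * qpoch_inf (q / x) q"
    using qpoch_inf_rec[OF assms(1), of "1 / x"] by simp
  have 2: "qpoch_inf x q = (1 - x) * qpoch_inf (x * q) q"
    by (rule qpoch_inf_rec[OF assms(1)])
  have "q / (x * q) = 1 / x" using assms by simp
  thus ?thesis using assms by (simp add: qtheta_eq 1 2 divide_simps) algebra
qed

lemma qtheta_divide_q:
  assumes "norm q < 1" "q \<noteq> 0" "x \<noteq> 0"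
  shows "qtheta (x / q) q = - x / q * qtheta x q"
  using qtheta_mult_q[OF assms(1,2), of "x / q"] assms by (simp add: field_simps)

lemma holomorphic_on_qtheta [holomorphic_intros]:
  assumes "norm q < 1" "f holomorphic_on A" "\<And>x. x \<in> A \<Longrightarrow> f x \<noteq> 0"
  shows "(\<lambda>x. qtheta (f x) q) holomorphic_on A"
  unfolding qtheta_eq using assms by (intro holomorphic_intros) auto

text \<open>The identity is continued analytically in the parameters, so the series is needed as a
  holomorphic function of all of them.\<close>

lemma qpochs_bound:
  assumes q: "norm q < 1" and "\<And>x. x \<in> set xs \<Longrightarrow> norm x \<le> M"
  shows "norm (qpochs xs q k) \<le> exp (M / (1 - norm q)) ^ length xs"
  using assms(2)
proof (induction xs)
  case (Cons x xs)
  have "norm (qpoch x q k) \<le> exp (M / (1 - norm q))"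
    using Cons.prems[of x] q by (intro order_trans[OF norm_qpoch_le[OF q]]) (auto simp: divide_right_mono)
  thus ?case using Cons by (auto simp: norm_mult intro!: mult_mono)
qed auto

lemma qpochs_eq_0_iff: "qpochs xs q k = 0 \<longleftrightarrow> (\<exists>x\<in>set xs. qpoch x q k = 0)"
  by (induction xs) auto

text \<open>Since \<open>1 / qpoch x q k\<close> equals
  \<open>qpoch_inf (x * q ^ k) q / qpoch_inf x q\<close>, a lower bound on the infinite product
  alone controls all finite ones, uniformly in \<open>k\<close>.\<close>

lemma inverse_qpochs_bound:
  assumes q: "norm q < 1" and "\<And>x. x \<in> set xs \<Longrightarrow> norm x \<le> M"
    and "\<And>x. x \<in> set xs \<Longrightarrow> norm (qpoch_inf x q) \<ge> \<delta>" "\<delta> > 0" "M \<ge> 0"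
  shows "norm (inverse (qpochs xs q k)) \<le> (exp (M / (1 - norm q)) / \<delta>) ^ length xs"
  using assms(2,3)
proof (induction xs)
  case (Cons x xs)
  have nz: "qpoch_inf x q \<noteq> 0" using Cons.prems(2)[of x] assms by auto
  have "qpoch x q k \<noteq> 0" using nz qpoch_nonzero_if_inf[OF q] by blast
  hence "inverse (qpoch x q k) = qpoch_inf (x * q ^ k) q / qpoch_inf x q"
    using qpoch_inf_split[OF q, of x k] nz by (simp add: field_simps)
  also have "norm \<dots> \<le> exp (M / (1 - norm q)) / \<delta>"
  proof -
    have "norm (x * q ^ k) \<le> M * 1"
      unfolding norm_mult norm_power using Cons.prems(1)[of x] q assms
      by (intro mult_mono power_le_one) auto
    hence "norm (qpoch_inf (x * q ^ k) q) \<le> exp (M / (1 - norm q))"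
      using q by (intro order_trans[OF norm_qpoch_inf_le[OF q]]) (auto simp: divide_right_mono)
    thus ?thesis unfolding norm_divide using Cons.prems(2)[of x] assms by (intro frac_le) auto
  qed
  finally have "norm (inverse (qpoch x q k)) \<le> exp (M / (1 - norm q)) / \<delta>" .
  moreover have "norm (inverse (qpochs xs q k)) \<le> (exp (M / (1 - norm q)) / \<delta>) ^ length xs"
    using Cons by auto
  ultimately show ?case
    using assms by (simp only: qpochs_Cons inverse_mult_distrib norm_mult list.size add_Suc_right add_0_right power_Suc) (intro mult_mono, auto)
qed auto

lemma norm_qphi_term_le:
  assumes q: "norm q < 1" and "\<And>x. x \<in> set as \<Longrightarrow> norm x \<le> M"
    and "\<And>x. x \<in> set (q # bs) \<Longrightarrow> norm x \<le> M"
    and "\<And>x. x \<in> set (q # bs) \<Longrightarrow> norm (qpoch_inf x q) \<ge> \<delta>" "\<delta> > 0" "M \<ge> 0" "norm z \<le> \<kappa>"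
  shows "norm (qpochs as q k / qpochs (q # bs) q k * z ^ k)
    \<le> exp (M / (1 - norm q)) ^ length as * (exp (M / (1 - norm q)) / \<delta>) ^ Suc (length bs) * \<kappa> ^ k"
proof -
  have "norm (qpochs as q k) \<le> exp (M / (1 - norm q)) ^ length as"
    by (rule qpochs_bound) (use assms in auto)
  moreover have "norm (inverse (qpochs (q # bs) q k)) \<le> (exp (M / (1 - norm q)) / \<delta>) ^ length (q # bs)"
    by (rule inverse_qpochs_bound) (use assms in auto)
  moreover have "norm (z ^ k) \<le> \<kappa> ^ k"
    unfolding norm_power using assms by (intro power_mono) auto
  ultimately show ?thesis
    unfolding divide_inverse[of "qpochs as q k"] norm_mult using assms
    by (intro mult_mono) (auto intro!: mult_nonneg_nonneg)
qed

lemma summable_qphi: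
  assumes q: "norm q < 1" and bs: "\<And>x. x \<in> set bs \<Longrightarrow> qpoch_inf x q \<noteq> 0" and z: "norm z < 1"
  shows "summable (\<lambda>k. norm (qpochs as q k / qpochs (q # bs) q k * z ^ k))"
proof -
  define M where "M = Max (insert 0 (norm ` (set as \<union> set (q # bs))))"
  define \<delta> where "\<delta> = Min (norm ` (\<lambda>x. qpoch_inf x q) ` set (q # bs))"
  have M: "norm x \<le> M" if "x \<in> set as \<union> set (q # bs)" for x
    unfolding M_def using that by (intro Max_ge) auto
  have "M \<ge> 0" unfolding M_def by (intro Max_ge) auto
  have \<delta>: "norm (qpoch_inf x q) \<ge> \<delta>" if "x \<in> set (q # bs)" for x
    unfolding \<delta>_def using that by (intro Min_le) auto
  have "\<delta> > 0" unfolding \<delta>_def using bs qpoch_inf_nonzero[OF q q] by (subst Min_gr_iff) auto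
  show ?thesis
  proof (rule summable_comparison_test)
    show "\<exists>N. \<forall>k\<ge>N. norm (norm (qpochs as q k / qpochs (q # bs) q k * z ^ k))
      \<le> exp (M / (1 - norm q)) ^ length as * (exp (M / (1 - norm q)) / \<delta>) ^ Suc (length bs) * norm z ^ k"
      unfolding real_norm_def abs_norm_cancel using M \<delta> \<open>\<delta> > 0\<close> \<open>M \<ge> 0\<close> by (intro exI[of _ 0] allI impI norm_qphi_term_le[OF q]) auto
    show "summable (\<lambda>k. exp (M / (1 - norm q)) ^ length as * (exp (M / (1 - norm q)) / \<delta>) ^ Suc (length bs) * norm z ^ k)"
      using z by (intro summable_mult summable_geometric) auto
  qed
qed

text \<open>The parameters are lists of functions, so one M-test on closed discs serves every series
  of the identity.\<close>

lemma holomorphic_on_qphi: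
  assumes q: "norm q < 1" and S: "open S"
    and as: "\<And>f. f \<in> set fs \<Longrightarrow> f holomorphic_on S"
    and bs: "\<And>g. g \<in> set gs \<Longrightarrow> g holomorphic_on S"
    and nz: "\<And>g u. g \<in> set gs \<Longrightarrow> u \<in> S \<Longrightarrow> qpoch_inf (g u) q \<noteq> 0"
    and z: "z holomorphic_on S" "\<And>u. u \<in> S \<Longrightarrow> norm (z u) < 1"
  shows "(\<lambda>u. qphi (map (\<lambda>f. f u) fs) (map (\<lambda>g. g u) gs) q (z u)) holomorphic_on S"
proof -
  define t where "t = (\<lambda>k u. qpochs (map (\<lambda>f. f u) fs) q k / qpochs (q # map (\<lambda>g. g u) gs) q k * z u ^ k)"
  have nzk: "qpochs (q # map (\<lambda>g. g u) gs) q k \<noteq> 0" if "u \<in> S" for u k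
    unfolding qpochs_eq_0_iff using nz[OF _ that] qpoch_nonzero_if_inf[OF q] qpoch_q_nonzero[OF q] by auto
  have hol_qpochs: "(\<lambda>u. qpochs (map (\<lambda>f. f u) fs) q k) holomorphic_on S"
    if "\<And>f. f \<in> set fs \<Longrightarrow> f holomorphic_on S" for fs :: "(complex \<Rightarrow> complex) list" and k
    using that by (induction fs) (auto simp: qpoch_def intro!: holomorphic_intros)
  have hol_t: "(\<lambda>u. \<Sum>k<n. t k u) holomorphic_on S" for n
    unfolding t_def using hol_qpochs[OF as] hol_qpochs[OF bs] z nzk
    by (intro holomorphic_intros) (auto intro!: holomorphic_intros)
  have "(\<lambda>u. \<Sum>k. t k u) holomorphic_on S"
  proof (rule holomorphic_uniform_sequence[OF S hol_t])
    fix u assume "u \<in> S"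
    then obtain d where d: "d > 0" "cball u d \<subseteq> S" using S open_contains_cball by blast
    define K where "K = cball u d"
    have K: "compact K" "K \<subseteq> S" "K \<noteq> {}" using d by (auto simp: K_def)
    have ex_bound: "\<exists>M\<ge>0. \<forall>f\<in>set fs. \<forall>u\<in>K. norm (f u) \<le> M"
      if "\<And>f. f \<in> set fs \<Longrightarrow> f holomorphic_on S" for fs :: "(complex \<Rightarrow> complex) list"
      using that
    proof (induction fs)
      case (Cons f fs)
      then obtain M where M: "M \<ge> 0" "\<forall>f\<in>set fs. \<forall>u\<in>K. norm (f u) \<le> M" by auto
      have "continuous_on K f"
        using Cons.prems[of f] K(2) by (intro continuous_on_subset[OF holomorphic_on_imp_continuous_on[of f S]]) auto
      hence "bounded (f ` K)" using K compact_continuous_image compact_imp_bounded by blast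
      then obtain B where B: "\<forall>u\<in>K. norm (f u) \<le> B" by (auto simp: bounded_iff)
      have "\<forall>g\<in>set (f # fs). \<forall>u\<in>K. norm (g u) \<le> max M B"
      proof (intro ballI)
        fix g u assume "g \<in> set (f # fs)" "u \<in> K"
        thus "norm (g u) \<le> max M B" using M(2) B by (cases "g = f") (auto simp: le_max_iff_disj)
      qed
      moreover have "max M B \<ge> 0" using M by auto
      ultimately show ?case by blast
    qed auto
    obtain M1 where M1: "M1 \<ge> 0" "\<forall>f\<in>set fs. \<forall>u\<in>K. norm (f u) \<le> M1" using ex_bound[OF as] by blast
    have "\<And>f. f \<in> set ((\<lambda>_. q) # gs) \<Longrightarrow> f holomorphic_on S" using bs by auto
    then obtain M2 where M2: "M2 \<ge> 0" "\<forall>f\<in>set ((\<lambda>_. q) # gs). \<forall>u\<in>K. norm (f u) \<le> M2"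
      using ex_bound by blast
    \<comment> \<open>The reciprocals of the infinite products are holomorphic as well, so
      \<open>ex_bound\<close> applied to them yields the lower bound \<open>\<delta>\<close> that
      \<open>norm_qphi_term_le\<close> asks for.\<close>
    define fs2 where "fs2 = map (\<lambda>g u. inverse (qpoch_inf (g u) q)) ((\<lambda>_. q) # gs)"
    have "\<And>f. f \<in> set fs2 \<Longrightarrow> f holomorphic_on S"
      unfolding fs2_def using bs nz qpoch_inf_nonzero[OF q q] q by (auto intro!: holomorphic_intros)
    then obtain D where D: "D \<ge> 0" "\<forall>f\<in>set fs2. \<forall>u\<in>K. norm (f u) \<le> D" using ex_bound by blast
    \<comment> \<open>The maximum of \<open>norm (z u)\<close> over the compact disc is attained,
      hence still below 1, and can be the ratio of a geometric majorant.\<close>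
    have "continuous_on K (\<lambda>u. norm (z u))"
      using z(1) K by (intro continuous_on_norm holomorphic_on_imp_continuous_on) (rule holomorphic_on_subset)
    then obtain v where v: "v \<in> K" "\<And>u. u \<in> K \<Longrightarrow> norm (z u) \<le> norm (z v)"
      using continuous_attains_sup[of K "\<lambda>u. norm (z u)"] K by blast
    define M where "M = max M1 M2"
    \<comment> \<open>\<open>D\<close> is only known to be nonnegative; the added 1 makes
      \<open>\<delta>\<close> well-defined and positive.\<close>
    define \<delta> where "\<delta> = inverse (D + 1)"
    have "\<delta> > 0" "M \<ge> 0" using D M1 by (auto simp: \<delta>_def M_def)
    have \<delta>: "norm (qpoch_inf x q) \<ge> \<delta>" if x: "x \<in> set (q # map (\<lambda>g. g u) gs)" and u: "u \<in> K" for x u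
    proof -
      obtain g where g: "g \<in> set ((\<lambda>_. q) # gs)" "x = g u" using x by auto
      have "inverse (norm (qpoch_inf x q)) \<le> D"
        using D(2) u g unfolding fs2_def by (force simp: norm_inverse)
      hence "inverse (norm (qpoch_inf x q)) \<le> D + 1" by simp
      moreover have "qpoch_inf x q \<noteq> 0" using g nz u K qpoch_inf_nonzero[OF q q] by auto
      ultimately show ?thesis unfolding \<delta>_def using D
        by (metis inverse_inverse_eq inverse_positive_iff_positive le_imp_inverse_le zero_less_norm_iff)
    qed
    have "uniform_limit K (\<lambda>n u. \<Sum>k<n. t k u) (\<lambda>u. \<Sum>k. t k u) sequentially"
    proof (rule Weierstrass_m_test)
      show "norm (t k u) \<le> exp (M / (1 - norm q)) ^ length fs * (exp (M / (1 - norm q)) / \<delta>) ^ Suc (length gs) * norm (z v) ^ k"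
        if "u \<in> K" for k u
      proof -
        have "norm (t k u) \<le> exp (M / (1 - norm q)) ^ length (map (\<lambda>f. f u) fs)
            * (exp (M / (1 - norm q)) / \<delta>) ^ Suc (length (map (\<lambda>g. g u) gs)) * norm (z v) ^ k"
          unfolding t_def
          by (rule norm_qphi_term_le[OF q]) (use M1 M2 that \<delta> \<open>\<delta> > 0\<close> \<open>M \<ge> 0\<close> v in \<open>force simp: M_def\<close>)+
        thus ?thesis by simp
      qed
      show "summable (\<lambda>k. exp (M / (1 - norm q)) ^ length fs * (exp (M / (1 - norm q)) / \<delta>) ^ Suc (length gs) * norm (z v) ^ k)"
        using z(2) v(1) K by (intro summable_mult summable_geometric) auto
    qed
    thus "\<exists>d>0. cball u d \<subseteq> S \<and> uniform_limit (cball u d) (\<lambda>n u. \<Sum>k<n. t k u) (\<lambda>u. \<Sum>k. t k u) sequentially"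
      using d unfolding K_def by blast
  qed
  thus ?thesis unfolding qphi_def t_def .
qed

section \<open>Contour integrals over circles\<close>

lemma open_annulus: "open {y::complex. l < norm y \<and> norm y < u}"
  by (intro open_Collect_conj open_Collect_less continuous_intros)

lemma path_image_circlepath_0: "r > 0 \<Longrightarrow> path_image (circlepath 0 r) = {y::complex. norm y = r}"
  by (auto simp: sphere_def dist_norm)

lemma circle_integrable:
  assumes "g holomorphic_on S" "{y. norm y = \<rho>} \<subseteq> S" "\<rho> > 0"
  shows "g contour_integrable_on circlepath 0 \<rho>"
  using assms by (intro contour_integrable_continuous_circlepath holomorphic_on_imp_continuous_on[OF holomorphic_on_subset[OF assms(1)]])
    (auto simp: sphere_def dist_norm)

lemma circle_bounded:
  assumes "g holomorphic_on S" "{y. norm y = \<rho>} \<subseteq> S" "\<rho> > 0"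
  obtains B where "B \<ge> 0" "\<And>y. norm y = \<rho> \<Longrightarrow> norm (g y) \<le> B"
proof -
  have "continuous_on (sphere 0 \<rho>) g"
    using assms(2) by (intro holomorphic_on_imp_continuous_on holomorphic_on_subset[OF assms(1)]) auto
  hence "bounded (g ` sphere 0 \<rho>)"
    by (intro compact_imp_bounded compact_continuous_image) auto
  then obtain B where "\<forall>y\<in>sphere 0 \<rho>. norm (g y) \<le> B" by (auto simp: bounded_iff)
  hence "norm (g y) \<le> max 0 B" if "norm y = \<rho>" for y using that by (simp add: le_max_iff_disj)
  thus ?thesis using that[of "max 0 B"] by auto
qed

lemma contour_integral_circlepath_annulus:
  fixes f :: "complex \<Rightarrow> complex"
  assumes f: "f holomorphic_on {y. l < norm y \<and> norm y < u}"
    and l: "0 \<le> l" and r: "l < r1" "r1 < u" "l < r2" "r2 < u"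
  shows "contour_integral (circlepath 0 r1) f = contour_integral (circlepath 0 r2) f"
proof (rule Cauchy_theorem_homotopic_loops[OF _ open_annulus f])
  show "homotopic_loops {y. l < norm y \<and> norm y < u} (circlepath 0 r1) (circlepath 0 r2)"
    unfolding homotopic_loops
  proof (intro exI[of _ "\<lambda>w. (r1 + fst w * (r2 - r1)) * exp (2 * of_real pi * \<i> * of_real (snd w))"] conjI ballI)
    show "continuous_on ({0..1} \<times> {0..1})
      (\<lambda>w. complex_of_real (r1 + fst w * (r2 - r1)) * exp (2 * of_real pi * \<i> * of_real (snd w)))"
      by (intro continuous_intros)
    have *: "norm (complex_of_real (r1 + s * (r2 - r1)) * exp (2 * of_real pi * \<i> * of_real t)) = \<bar>r1 + s * (r2 - r1)\<bar>" for s t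
    proof -
      have "exp (2 * of_real pi * \<i> * of_real t) = cis (2 * pi * t)"
        by (simp add: cis_conv_exp mult_ac)
      thus ?thesis by (simp only: norm_mult norm_of_real norm_cis mult_1_right)
    qed
    have **: "l < r1 + s * (r2 - r1) \<and> r1 + s * (r2 - r1) < u" if "s \<in> {0..1}" for s
    proof -
      have "r1 + s * (r2 - r1) = (1 - s) * r1 + s * r2" by (simp add: algebra_simps)
      moreover have "(1 - s) *\<^sub>R r1 + s *\<^sub>R r2 \<in> {l<..<u}"
        by (rule convexD) (use that r in auto)
      ultimately show ?thesis by simp
    qed
    show "(\<lambda>w. complex_of_real (r1 + fst w * (r2 - r1)) * exp (2 * of_real pi * \<i> * of_real (snd w)))
       \<in> {0..1} \<times> {0..1} \<rightarrow> {y. l < norm y \<and> norm y < u}"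
      using ** l by (auto simp only: * mem_Times_iff Pi_iff mem_Collect_eq) force+
  qed (auto simp: circlepath pathstart_def pathfinish_def exp_eq_1)
qed auto

text \<open>Substitution of \<open>c * y\<close> for \<open>y\<close>. As \<open>c\<close> is
  complex, the image circle is also rotated, so it is deformed back through a path of complex
  factors and not merely by a change of radius.\<close>

lemma contour_integral_circlepath_scale:
  fixes f :: "complex \<Rightarrow> complex"
  assumes f: "f holomorphic_on {y. l < norm y}"
    and l: "0 \<le> l" "l < \<rho>" "l < norm c * \<rho>"
  shows "contour_integral (circlepath 0 \<rho>) (\<lambda>y. f (c * y)) * c = contour_integral (circlepath 0 \<rho>) f"
proof -
  have c: "c \<noteq> 0" using l by auto
  define \<gamma> where "\<gamma> = (\<lambda>t. c * circlepath 0 \<rho> t)"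
  have op: "open {y::complex. l < norm y}" by (intro open_Collect_less continuous_intros)
  have der: "(\<gamma> has_vector_derivative c * (2 * pi * \<i> * \<rho> * exp (2 * of_real pi * \<i> * t))) (at t within X)" for t X
    unfolding \<gamma>_def using has_vector_derivative_circlepath[of 0 \<rho> t X]
    by (auto intro!: has_vector_derivative_mult_right)
  have valid: "valid_path \<gamma>"
  proof -
    have "valid_path ((\<lambda>y. c * y) \<circ> circlepath 0 \<rho>)"
      by (rule valid_path_compose_holomorphic[where S = UNIV]) (auto intro!: holomorphic_intros)
    thus ?thesis by (simp add: \<gamma>_def o_def)
  qed
  \<comment> \<open>Factors of norm above \<open>l / \<rho>\<close> keep the circle inside the
    domain of \<open>f\<close>; a path from \<open>c\<close> to 1 among them gives the
    homotopy.\<close>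
  have "path_connected (- cball (0::complex) (l / \<rho>))"
    by (rule path_connected_complement_bounded_convex) auto
  moreover have "1 \<in> - cball (0::complex) (l / \<rho>)" "c \<in> - cball (0::complex) (l / \<rho>)"
    using l by (auto simp: field_simps)
  ultimately obtain g where g: "path g" "path_image g \<subseteq> - cball 0 (l / \<rho>)" "pathstart g = c" "pathfinish g = 1"
    unfolding path_connected_def by blast
  have "homotopic_loops {y. l < norm y} \<gamma> (circlepath 0 \<rho>)"
    unfolding homotopic_loops
  proof (intro exI[of _ "\<lambda>w. g (fst w) * circlepath 0 \<rho> (snd w)"] conjI ballI)
    have "continuous_on ({0..1::real} \<times> {0..1::real}) (\<lambda>w. g (fst w))"
      using g(1) unfolding path_def by (rule continuous_on_compose2) (auto intro!: continuous_intros)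
    moreover have "continuous_on ({0..1::real} \<times> {0..1::real}) (\<lambda>w. circlepath 0 \<rho> (snd w))"
      unfolding circlepath by (intro continuous_intros)
    ultimately show "continuous_on ({0..1} \<times> {0..1}) (\<lambda>w. g (fst w) * circlepath 0 \<rho> (snd w))"
      by (rule continuous_on_mult)
    show "(\<lambda>w. g (fst w) * circlepath 0 \<rho> (snd w)) \<in> {0..1} \<times> {0..1} \<rightarrow> {y. l < norm y}"
    proof
      fix w :: "real \<times> real" assume w: "w \<in> {0..1} \<times> {0..1}"
      have "g (fst w) \<in> path_image g" using w by (auto simp: path_image_def)
      hence "norm (g (fst w)) > l / \<rho>" using g by auto
      moreover have "norm (circlepath 0 \<rho> (snd w)) = \<rho>"
      proof -
        have "exp (2 * of_real pi * \<i> * of_real (snd w)) = cis (2 * pi * snd w)"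
          by (simp add: cis_conv_exp mult_ac)
        thus ?thesis using l by (simp add: circlepath norm_mult)
      qed
      ultimately show "g (fst w) * circlepath 0 \<rho> (snd w) \<in> {y. l < norm y}"
        using l by (simp add: norm_mult field_simps)
    qed
  qed (use g in \<open>auto simp: \<gamma>_def circlepath pathstart_def pathfinish_def exp_eq_1\<close>)
  hence "contour_integral \<gamma> f = contour_integral (circlepath 0 \<rho>) f"
    by (rule Cauchy_theorem_homotopic_loops[OF _ op f valid]) auto
  moreover have "contour_integral \<gamma> f = contour_integral (circlepath 0 \<rho>) (\<lambda>y. c * f (c * y))"
    unfolding contour_integral_integral
  proof (rule integral_cong)
    fix t :: real assume "t \<in> {0..1}"
    have "vector_derivative \<gamma> (at t) = c * vector_derivative (circlepath 0 \<rho>) (at t)"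
      using vector_derivative_at[OF der[of t UNIV]] by (simp add: vector_derivative_circlepath)
    thus "f (\<gamma> t) * vector_derivative \<gamma> (at t) = c * f (c * circlepath 0 \<rho> t) * vector_derivative (circlepath 0 \<rho>) (at t)"
      by (simp add: \<gamma>_def)
  qed
  moreover have "contour_integral (circlepath 0 \<rho>) (\<lambda>y. c * f (c * y)) = c * contour_integral (circlepath 0 \<rho>) (\<lambda>y. f (c * y))"
  proof (rule contour_integral_lmul)
    have "(\<lambda>y. f (c * y)) holomorphic_on {y. l / norm c < norm y}"
      by (rule holomorphic_on_compose_gen[OF _ f, of "\<lambda>y. c * y" "{y. l / norm c < norm y}", unfolded o_def])
         (use c in \<open>auto intro!: holomorphic_intros simp: norm_mult field_simps\<close>)
    moreover have "path_image (circlepath 0 \<rho>) \<subseteq> {y. l / norm c < norm y}"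
      using l c by (subst path_image_circlepath_0) (auto simp: field_simps)
    ultimately show "(\<lambda>y. f (c * y)) contour_integrable_on circlepath 0 \<rho>"
      by (intro contour_integrable_continuous_circlepath holomorphic_on_imp_continuous_on) (rule holomorphic_on_subset)
  qed
  ultimately show ?thesis by (simp add: mult.commute)
qed

text \<open>Residue theorem for simple poles, by induction on the pole set: one principal part is
  subtracted and the remaining singularity removed. Residues enter as limits, the form in which they
  are computed later; a limit 0 is allowed.\<close>

lemma annulus_residues:
  fixes f :: "complex \<Rightarrow> complex"
  assumes "finite P" and l: "0 \<le> l" "l < r1" "r1 < r2" "r2 < u"
    and "f holomorphic_on {y. l < norm y \<and> norm y < u} - P"
    and "\<And>p. p \<in> P \<Longrightarrow> r1 < norm p \<and> norm p < r2"
    and "\<And>p. p \<in> P \<Longrightarrow> ((\<lambda>y. (y - p) * f y) \<longlongrightarrow> c p) (at p)"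
  shows "contour_integral (circlepath 0 r2) f - contour_integral (circlepath 0 r1) f = 2 * pi * \<i> * (\<Sum>p\<in>P. c p)"
  using assms(1,6-8)
proof (induction P arbitrary: f rule: finite_induct)
  case empty
  have "contour_integral (circlepath 0 r1) f = contour_integral (circlepath 0 r2) f"
    by (rule contour_integral_circlepath_annulus[where l = l and u = u]) (use empty l in auto)
  thus ?case by simp
next
  case (insert p P)
  define A where "A = {y::complex. l < norm y \<and> norm y < u}"
  define S where "S = A - P"
  have opS: "open S" unfolding S_def A_def using insert.hyps by (intro open_Diff open_annulus finite_imp_closed)
  have p: "p \<in> S" using insert.hyps insert.prems(2)[of p] l by (auto simp: S_def A_def)
  define g where "g = (\<lambda>y. f y - c p / (y - p))"
  have "g holomorphic_on (S - {p})"
    unfolding g_def using insert.prems(1) unfolding S_def A_def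
    by (intro holomorphic_intros) (auto elim: holomorphic_on_subset)
  moreover have "((\<lambda>y. (y - p) * g y) \<longlongrightarrow> 0) (at p)"
  proof (rule Lim_transform_eventually)
    have "((\<lambda>y. (y - p) * f y - c p) \<longlongrightarrow> c p - c p) (at p)"
      by (intro tendsto_intros insert.prems(3)) auto
    thus "((\<lambda>y. (y - p) * f y - c p) \<longlongrightarrow> 0) (at p)" by simp
    show "\<forall>\<^sub>F y in at p. (y - p) * f y - c p = (y - p) * g y"
      unfolding eventually_at by (intro exI[of _ 1]) (auto simp: g_def right_diff_distrib)
  qed
  ultimately obtain g' where g': "g' holomorphic_on S" "\<And>y. y \<in> S - {p} \<Longrightarrow> g' y = g y"
    using holomorphic_on_extend_lim[of g S p] p opS by (auto simp: interior_open)
  have IH: "contour_integral (circlepath 0 r2) g' - contour_integral (circlepath 0 r1) g' = 2 * pi * \<i> * (\<Sum>p\<in>P. c p)"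
  proof (rule insert.IH)
    show "g' holomorphic_on {y. l < norm y \<and> norm y < u} - P" using g' by (simp add: S_def A_def)
    show "r1 < norm x \<and> norm x < r2" if "x \<in> P" for x using insert.prems(2) that by auto
    show "((\<lambda>y. (y - x) * g' y) \<longlongrightarrow> c x) (at x)" if x: "x \<in> P" for x
    proof (rule Lim_transform_eventually)
      have "x \<noteq> p" using x insert.hyps by auto
      hence "((\<lambda>y. (y - x) * f y - (y - x) * (c p / (y - p))) \<longlongrightarrow> c x - (x - x) * (c p / (x - p))) (at x)"
        by (intro tendsto_intros insert.prems(3)) (use x in auto)
      thus "((\<lambda>y. (y - x) * f y - (y - x) * (c p / (y - p))) \<longlongrightarrow> c x) (at x)" by simp
      have "open (A - (insert p P - {x}))" using insert.hyps by (auto simp: A_def intro!: open_Diff open_annulus finite_imp_closed)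
      moreover have "x \<in> A - (insert p P - {x})" using x insert.prems(2)[of x] l by (auto simp: A_def)
      ultimately have "\<forall>\<^sub>F y in at x. y \<in> A - (insert p P - {x}) - {x}" by (rule eventually_at_in_open)
      thus "\<forall>\<^sub>F y in at x. (y - x) * f y - (y - x) * (c p / (y - p)) = (y - x) * g' y"
      proof eventually_elim
        case (elim y)
        hence "g' y = f y - c p / (y - p)" using g'(2)[of y] by (auto simp: S_def g_def)
        thus ?case by (simp only: right_diff_distrib)
      qed
    qed
  qed
  have int: "contour_integral (circlepath 0 r) g' = contour_integral (circlepath 0 r) f - contour_integral (circlepath 0 r) (\<lambda>y. c p / (y - p))"
    if r: "r = r1 \<or> r = r2" for r
  proof -
    have "r > 0" using l r by auto
    have im: "path_image (circlepath 0 r) \<subseteq> S - {p}"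
      using r l insert.prems(2) \<open>r > 0\<close> by (subst path_image_circlepath_0) (fastforce simp: S_def A_def)+
    have "contour_integral (circlepath 0 r) g' = contour_integral (circlepath 0 r) g"
      by (rule contour_integral_eq) (use im g'(2) in blast)
    also have "\<dots> = contour_integral (circlepath 0 r) f - contour_integral (circlepath 0 r) (\<lambda>y. c p / (y - p))"
      unfolding g_def
    proof (rule contour_integral_diff)
      have "f holomorphic_on S - {p}" using insert.prems(1) unfolding S_def A_def by (rule holomorphic_on_subset) auto
      thus "f contour_integrable_on circlepath 0 r"
        using im by (intro contour_integrable_continuous_circlepath holomorphic_on_imp_continuous_on) (rule holomorphic_on_subset)
      show "(\<lambda>y. c p / (y - p)) contour_integrable_on circlepath 0 r"
        using im by (intro contour_integrable_continuous_circlepath continuous_intros) auto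
    qed
    finally show ?thesis .
  qed
  \<comment> \<open>The pole lies between the circles, so its principal part integrates to 0 over
    the inner one and to \<open>2 * pi * \<i> * c p\<close> over the outer one.\<close>
  have 1: "contour_integral (circlepath 0 r1) (\<lambda>y. c p / (y - p)) = 0"
  proof (rule contour_integral_unique, rule Cauchy_theorem_convex_simple)
    show "(\<lambda>y. c p / (y - p)) holomorphic_on ball 0 (norm p)" by (intro holomorphic_intros) auto
    show "path_image (circlepath 0 r1) \<subseteq> ball 0 (norm p)"
      using l insert.prems(2)[of p] by (subst path_image_circlepath_0) auto
  qed auto
  have 2: "contour_integral (circlepath 0 r2) (\<lambda>y. c p / (y - p)) = 2 * of_real pi * \<i> * c p"
    by (rule contour_integral_unique, rule Cauchy_integral_circlepath_simple[of "\<lambda>_. c p"])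
       (use insert.prems(2)[of p] in auto)
  show ?case
    using IH int[of r1] int[of r2] 1 2 insert.hyps by (simp add: algebra_simps)
qed

section \<open>Gaussian binomial coefficients\<close>

lemma infsum_eq_suminf:
  fixes f :: "nat \<Rightarrow> complex"
  shows "f summable_on UNIV \<Longrightarrow> infsum f UNIV = suminf f"
  by (rule sums_unique[OF has_sum_imp_sums[OF has_sum_infsum]])

text \<open>Fubini for double series: the product majorant gives unconditional summability over
  pairs, where the order of summation is free.\<close>

lemma suminf_swap_dominated:
  fixes f :: "nat \<Rightarrow> nat \<Rightarrow> complex" and A B :: "nat \<Rightarrow> real"
  assumes f: "\<And>n k. norm (f n k) \<le> A n * B k" and A: "summable A" "\<And>n. A n \<ge> 0" and B: "summable B" "\<And>k. B k \<ge> 0"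
  shows "(\<Sum>n. \<Sum>k. f n k) = (\<Sum>k. \<Sum>n. f n k)"
proof -
  have A': "A summable_on UNIV" and B': "B summable_on UNIV"
    using A B by (auto intro!: norm_summable_imp_summable_on)
  have "(\<lambda>x. norm ((\<lambda>(n, k). A n * B k) x)) summable_on UNIV \<times> UNIV"
    unfolding Infinite_Sum.abs_summable_on_Sigma_iff
    using A' B' A B by (auto simp: abs_mult infsum_cmult_right' intro!: summable_on_cmult_right summable_on_cmult_left)
  hence "(\<lambda>x. norm ((\<lambda>(n, k). f n k) x)) summable_on UNIV \<times> UNIV"
    by (rule Infinite_Sum.abs_summable_on_comparison_test) (use f A B in \<open>auto intro: order_trans[OF _ abs_ge_self]\<close>)
  hence S: "(\<lambda>(n, k). f n k) summable_on UNIV \<times> UNIV" by (rule abs_summable_summable)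
  have S': "(\<lambda>(k, n). f n k) summable_on UNIV \<times> UNIV"
    using S summable_on_reindex_bij_betw[of prod.swap "UNIV \<times> UNIV" "UNIV \<times> UNIV" "\<lambda>(n, k). f n k"]
    by (auto simp: case_prod_unfold bij_betw_def inj_on_def image_iff)
  have n: "summable (\<lambda>k. norm (f n k))" for n
    by (rule summable_comparison_test'[where g = "\<lambda>k. A n * B k"]) (use f B in \<open>auto intro: summable_mult\<close>)
  have k: "summable (\<lambda>n. norm (f n k))" for k
    by (rule summable_comparison_test'[where g = "\<lambda>n. A n * B k"]) (use f A in \<open>auto intro: summable_mult2\<close>)
  have "(\<Sum>n. \<Sum>k. f n k) = (\<Sum>\<^sub>\<infinity>n. \<Sum>\<^sub>\<infinity>k. f n k)"
    using summable_on_Sigma_banach[OF S] n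
    by (subst infsum_eq_suminf) (auto simp: infsum_eq_suminf norm_summable_imp_summable_on)
  also have "\<dots> = (\<Sum>\<^sub>\<infinity>k. \<Sum>\<^sub>\<infinity>n. f n k)"
    by (rule infsum_swap_banach[OF S])
  also have "\<dots> = (\<Sum>k. \<Sum>n. f n k)"
    using summable_on_Sigma_banach[OF S'] k
    by (subst infsum_eq_suminf) (auto simp: infsum_eq_suminf norm_summable_imp_summable_on)
  finally show ?thesis .
qed

text \<open>The coefficient of \<open>X ^ j\<close> in the polynomial
  \<open>qpoch (X * q / q ^ k) q k / qpoch q q k\<close>, whose value at \<open>X = q ^ n\<close> is
  the Gaussian binomial.\<close>

definition qdiff_coeff :: "complex \<Rightarrow> nat \<Rightarrow> nat \<Rightarrow> complex" where
  "qdiff_coeff q k j = q ^ j * qpoch (1 / q ^ k) q j / (qpoch q q j * qpoch q q k)"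

text \<open>The Gaussian binomial is encoded as a polynomial in \<open>q ^ n\<close> because
  multiplying the n-th Taylor coefficient by \<open>(q ^ n) ^ j\<close> amounts to evaluating the
  function at \<open>a * q ^ j\<close>. The usual quotient formula is recovered in
  \<open>qbinom_eq\<close>.\<close>

definition qbinom :: "complex \<Rightarrow> nat \<Rightarrow> nat \<Rightarrow> complex" where
  "qbinom q n k = (\<Sum>j\<le>k. qdiff_coeff q k j * (q ^ n) ^ j)"

text \<open>For \<open>f y = (\<Sum>n. c n * y ^ n)\<close> this is \<open>\<Sum>n. c n * a ^ n * qbinom q n k\<close>.\<close>

definition qdiff :: "complex \<Rightarrow> complex \<Rightarrow> nat \<Rightarrow> (complex \<Rightarrow> complex) \<Rightarrow> complex" where
  "qdiff q a k f = (\<Sum>j\<le>k. qdiff_coeff q k j * f (a * q ^ j))"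

definition rogers_szego :: "complex \<Rightarrow> complex \<Rightarrow> complex \<Rightarrow> nat \<Rightarrow> complex" where
  "rogers_szego q a d n = (\<Sum>k\<le>n. qbinom q n k * a ^ (n - k) * d ^ k)"

definition kern :: "complex \<Rightarrow> complex \<Rightarrow> complex \<Rightarrow> complex \<Rightarrow> complex \<Rightarrow> complex" where
  "kern q h a d y = qtheta (h * y / d) q * qtheta (h * a / y) q / (qpoch_inf (a / y) q * qpoch_inf (d / y) q)"

definition moment :: "complex \<Rightarrow> complex \<Rightarrow> complex \<Rightarrow> real \<Rightarrow> complex \<Rightarrow> nat \<Rightarrow> complex" where
  "moment q h a \<rho> d n = contour_integral (circlepath 0 \<rho>) (\<lambda>y. y ^ n * kern q h a d y / y) / (2 * pi * \<i>)"

lemma tendsto_qtheta [tendsto_intros]: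
  assumes "norm q < 1" "(f \<longlongrightarrow> l) F" "l \<noteq> 0"
  shows "((\<lambda>x. qtheta (f x) q) \<longlongrightarrow> qtheta l q) F"
  unfolding qtheta_eq using assms by (intro tendsto_intros)

context
  fixes q :: complex
  assumes q: "norm q < 1" "q \<noteq> 0"
begin

lemma q_power_neq_1: "q ^ Suc n \<noteq> 1"
  using q by (metis norm_one norm_power power_Suc_less_one norm_ge_zero less_irrefl zero_less_norm_iff)

lemma qdiff_coeff_eq_0: "k < j \<Longrightarrow> qdiff_coeff q k j = 0"
  unfolding qdiff_coeff_def qpoch_def using q by (auto intro!: bexI[of _ k])

text \<open>Pascal's rule on the level of coefficients, since
  \<open>(q ^ Suc n) ^ j - q ^ Suc k * (q ^ n) ^ j\<close> equals
  \<open>(q ^ j - q ^ Suc k) * (q ^ n) ^ j\<close>. At \<open>j = Suc k\<close> both sides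
  vanish.\<close>

lemma qdiff_coeff_Suc: "qdiff_coeff q (Suc k) j * (q ^ j - q ^ Suc k) = qdiff_coeff q k j"
proof -
  have "qpoch (1 / q ^ Suc k) q j * (1 - 1 / q ^ Suc k * q ^ j) = (1 - 1 / q ^ Suc k) * qpoch (1 / q ^ Suc k * q) q j"
    using qpoch_Suc[of "1 / q ^ Suc k" q j] qpoch_Suc_left[of "1 / q ^ Suc k" q j] by simp
  hence *: "qpoch (1 / q ^ Suc k) q j * (1 - q ^ j / q ^ Suc k) = (1 - 1 / q ^ Suc k) * qpoch (1 / q ^ k) q j"
    using q by simp
  have "qpoch (1 / q ^ Suc k) q j * (q ^ j - q ^ Suc k) = - (q ^ Suc k) * (qpoch (1 / q ^ Suc k) q j * (1 - q ^ j / q ^ Suc k))"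
    using q by (simp add: field_simps)
  also have "\<dots> = (1 - q ^ Suc k) * qpoch (1 / q ^ k) q j"
    unfolding * using q by (simp add: field_simps)
  finally have "qpoch (1 / q ^ Suc k) q j * (q ^ j - q ^ Suc k) = (1 - q ^ Suc k) * qpoch (1 / q ^ k) q j" .
  moreover have "qpoch q q (Suc k) = qpoch q q k * (1 - q ^ Suc k)" by (simp add: qpoch_Suc)
  ultimately have "qdiff_coeff q (Suc k) j * (q ^ j - q ^ Suc k)
    = q ^ j * ((1 - q ^ Suc k) * qpoch (1 / q ^ k) q j) / (qpoch q q j * (qpoch q q k * (1 - q ^ Suc k)))"
    unfolding qdiff_coeff_def by (metis (no_types, opaque_lifting) mult.assoc times_divide_eq_left)
  thus ?thesis using q_power_neq_1[of k] by (simp add: qdiff_coeff_def del: power_Suc)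
qed

lemma qbinom_Suc_Suc: "qbinom q (Suc n) (Suc k) = qbinom q n k + q ^ Suc k * qbinom q n (Suc k)"
proof -
  have "qbinom q (Suc n) (Suc k) - q ^ Suc k * qbinom q n (Suc k)
    = (\<Sum>j\<le>Suc k. qdiff_coeff q (Suc k) j * (q ^ j - q ^ Suc k) * (q ^ n) ^ j)"
    unfolding qbinom_def sum_distrib_left sum_subtractf[symmetric]
    by (intro sum.cong) (auto simp: power_mult_distrib algebra_simps)
  also have "\<dots> = qbinom q n k"
    unfolding qdiff_coeff_Suc qbinom_def by (simp add: qdiff_coeff_eq_0)
  finally show ?thesis by (simp add: algebra_simps)
qed

lemma qbinom_0_right [simp]: "qbinom q n 0 = 1"
  by (simp add: qbinom_def qdiff_coeff_def)

text \<open>At \<open>x = 1 / q ^ Suc k\<close> and \<open>n = Suc k\<close> the right-hand side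
  contains a zero factor. This is the base case of the vanishing of \<open>qbinom q n k\<close> for
  \<open>n < k\<close>.\<close>

lemma sum_qpoch_telescope: "(\<Sum>j\<le>n. q ^ j * qpoch x q j / qpoch q q j) = qpoch (x * q) q n / qpoch q q n"
proof (induction n)
  case (Suc n)
  have "qpoch (x * q) q n / qpoch q q n + q ^ Suc n * qpoch x q (Suc n) / qpoch q q (Suc n)
    = qpoch (x * q) q n * (1 - x * q * q ^ n) / (qpoch q q n * (1 - q ^ Suc n))"
    using qpoch_q_nonzero[OF q(1), of n] q_power_neq_1[of n]
    by (simp add: qpoch_Suc[of q q] qpoch_Suc_left[of x] del: power_Suc) (simp add: divide_simps, simp add: algebra_simps)
  thus ?case using Suc by (simp add: qpoch_Suc)
qed auto

lemma qbinom_0_Suc: "qbinom q 0 (Suc k) = 0"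
proof -
  have "qbinom q 0 (Suc k) = (\<Sum>j\<le>Suc k. q ^ j * qpoch (1 / q ^ Suc k) q j / qpoch q q j) / qpoch q q (Suc k)"
    unfolding qbinom_def qdiff_coeff_def sum_divide_distrib by simp
  also have "\<dots> = qpoch (1 / q ^ Suc k * q) q (Suc k) / qpoch q q (Suc k) / qpoch q q (Suc k)"
    by (simp only: sum_qpoch_telescope)
  also have "qpoch (1 / q ^ Suc k * q) q (Suc k) = 0"
    unfolding qpoch_def using q by (auto intro!: bexI[of _ k])
  finally show ?thesis by simp
qed

lemma qbinom_eq_0: "n < k \<Longrightarrow> qbinom q n k = 0"
proof (induction n arbitrary: k)
  case 0
  thus ?case using qbinom_0_Suc[of "k - 1"] by simp
next
  case (Suc n)
  then obtain k' where "k = Suc k'" by (cases k) auto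
  thus ?case using Suc by (simp add: qbinom_Suc_Suc)
qed

lemma qbinom_eq: "k \<le> n \<Longrightarrow> qbinom q n k * (qpoch q q k * qpoch q q (n - k)) = qpoch q q n"
proof (induction n arbitrary: k)
  case (Suc n)
  show ?case
  proof (cases k)
    case k: (Suc k')
    show ?thesis
    proof (cases "k' = n")
      case True
      thus ?thesis using Suc.IH[of n] qpoch_q_nonzero[OF q(1), of n] by (simp add: k qbinom_Suc_Suc qbinom_eq_0 qpoch_Suc)
    next
      case False
      hence le: "k' < n" using Suc.prems k by auto
      then obtain m where m: "n - k' = Suc m" "n = k' + Suc m" by (metis Suc_diff_Suc add_diff_inverse_nat less_imp_le_nat not_less)
      have 1: "qbinom q n k' * (qpoch q q k' * qpoch q q (Suc m)) = qpoch q q n"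
        using Suc.IH[of k'] le m by simp
      have 2: "qbinom q n (Suc k') * (qpoch q q (Suc k') * qpoch q q m) = qpoch q q n"
        using Suc.IH[of "Suc k'"] le m by (simp add: m)
      have "qbinom q (Suc n) (Suc k') * (qpoch q q (Suc k') * qpoch q q (Suc m))
        = (qbinom q n k' * (qpoch q q k' * qpoch q q (Suc m))) * (1 - q ^ Suc k')
          + q ^ Suc k' * (1 - q ^ Suc m) * (qbinom q n (Suc k') * (qpoch q q (Suc k') * qpoch q q m))"
        by (simp add: qbinom_Suc_Suc qpoch_Suc[of q q] algebra_simps)
      also have "\<dots> = qpoch q q n * (1 - q ^ Suc k' * q ^ Suc m)"
        unfolding 1 2 by (simp add: algebra_simps)
      also have "q ^ Suc k' * q ^ Suc m = q * q ^ n"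
        by (simp add: m(2) power_add mult_ac)
      finally show ?thesis using m by (simp add: k qpoch_Suc)
    qed
  qed auto
qed auto

text \<open>\<open>qpoch q q n\<close> is bounded above and away from 0, so the quotient formula
  gives one bound for all \<open>n\<close> and \<open>k\<close>. The exchange of summations in the
  kernel integral rests on it.\<close>

lemma qbinom_bounded: "\<exists>C\<ge>0. \<forall>n k. norm (qbinom q n k) \<le> C"
proof -
  define E where "E = exp (norm q / (1 - norm q))"
  have E: "norm (qpoch q q n) \<le> E" for n unfolding E_def by (rule norm_qpoch_le[OF q(1)])
  define D where "D = E / norm (qpoch_inf q q)"
  have pos: "norm (qpoch_inf q q) > 0" using qpoch_inf_nonzero[OF q(1) q(1)] by simp
  have D: "norm (inverse (qpoch q q n)) \<le> D" for n
    using inverse_qpochs_bound[of q "[q]" "norm q" "norm (qpoch_inf q q)" n] q pos unfolding D_def E_def by simp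
  have "E \<ge> 0" "D \<ge> 0" using E[of 0] D[of 0] by auto
  have "norm (qbinom q n k) \<le> E * (D * D)" for n k
  proof (cases "k \<le> n")
    case True
    hence "qbinom q n k = qpoch q q n * (inverse (qpoch q q k) * inverse (qpoch q q (n - k)))"
      using qbinom_eq[OF True] qpoch_q_nonzero[OF q(1)] by (simp add: field_simps)
    thus ?thesis using E D \<open>E \<ge> 0\<close> \<open>D \<ge> 0\<close> by (auto simp only: norm_mult intro!: mult_mono mult_nonneg_nonneg norm_ge_zero)
  next
    case False
    thus ?thesis using \<open>E \<ge> 0\<close> \<open>D \<ge> 0\<close> by (simp add: qbinom_eq_0)
  qed
  thus ?thesis using \<open>E \<ge> 0\<close> \<open>D \<ge> 0\<close> by (intro exI[of _ "E * (D * D)"]) auto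
qed

text \<open>The power of \<open>q\<close> in Pascal's rule is absorbed into \<open>d * q\<close>.
  This is the same shift of \<open>d\<close> as in \<open>moment_Suc\<close>.\<close>

lemma rogers_szego_Suc: "rogers_szego q a d (Suc n) = d * rogers_szego q a d n + a * rogers_szego q a (d * q) n"
proof -
  have "rogers_szego q a d (Suc n) = a ^ Suc n + (\<Sum>k\<le>n. qbinom q (Suc n) (Suc k) * a ^ (n - k) * d ^ Suc k)"
    unfolding rogers_szego_def by (subst sum.atMost_Suc_shift) simp
  also have "\<dots> = (\<Sum>k\<le>n. qbinom q n k * a ^ (n - k) * d ^ Suc k)
      + (a ^ Suc n + (\<Sum>k\<le>n. q ^ Suc k * qbinom q n (Suc k) * a ^ (n - k) * d ^ Suc k))"
    by (simp add: qbinom_Suc_Suc algebra_simps sum.distrib)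
  also have "a ^ Suc n + (\<Sum>k\<le>n. q ^ Suc k * qbinom q n (Suc k) * a ^ (n - k) * d ^ Suc k)
    = (\<Sum>k\<le>Suc n. q ^ k * qbinom q n k * a ^ (Suc n - k) * d ^ k)"
    by (subst sum.atMost_Suc_shift) simp
  also have "\<dots> = (\<Sum>k\<le>n. q ^ k * qbinom q n k * a ^ (Suc n - k) * d ^ k)"
    by (simp add: qbinom_eq_0)
  also have "\<dots> = a * rogers_szego q a (d * q) n"
    unfolding rogers_szego_def sum_distrib_left
    by (intro sum.cong) (auto simp: Suc_diff_le power_mult_distrib)
  also have "(\<Sum>k\<le>n. qbinom q n k * a ^ (n - k) * d ^ Suc k) = d * rogers_szego q a d n"
    unfolding rogers_szego_def sum_distrib_left by (intro sum.cong) auto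
  finally show ?thesis .
qed

end

section \<open>Moments of the theta kernel\<close>

text \<open>Only what is cancelled has to be nonzero. The other denominators may vanish, because
  both sides are then 0 by the convention for division.\<close>

lemma cancel_factor:
  fixes e u v w y :: complex
  shows "e \<noteq> 0 \<Longrightarrow> (y * e) * (u / (v * (e * w))) = y * (u / (v * w))"
    and "e \<noteq> 0 \<Longrightarrow> y \<noteq> 0 \<Longrightarrow> (y * e) * (u / ((e * v) * w) / y) = u / (v * w)"
    and "e \<noteq> 0 \<Longrightarrow> e' \<noteq> 0 \<Longrightarrow> (y * e) * (y * e') * (u / ((e * v) * (e' * w))) = y * y * (u / (v * w))"
  by simp_all

context
  fixes q h a :: complex
  assumes q: "norm q < 1" "q \<noteq> 0" and h: "h \<noteq> 0" and a: "a \<noteq> 0"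
begin

text \<open>The theta function contributes \<open>- h * y / (d * q)\<close>, and the denominator
  loses the factor \<open>1 - d / y\<close>; together they give a multiple of \<open>y - d\<close>.
  Multiplication by \<open>y - d\<close> thus becomes a shift of \<open>d\<close>.\<close>

lemma kern_mult_d:
  assumes "d \<noteq> 0" "y \<noteq> 0" "y \<noteq> d"
  shows "kern q h a (d * q) y = - (h / (d * q)) * (y - d) * kern q h a d y"
proof -
  have 1: "qtheta (h * y / (d * q)) q = - (h * y / d) / q * qtheta (h * y / d) q"
    using qtheta_divide_q[OF q, of "h * y / d"] assms h by simp
  have 2: "qpoch_inf (d / y) q = (1 - d / y) * qpoch_inf (d * q / y) q"
    using qpoch_inf_rec[OF q(1), of "d / y"] by simp
  have 3: "(y - d) * (u / (v * ((1 - d / y) * w))) = y * (u / (v * w))" for u v w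
  proof -
    have "1 - d / y \<noteq> 0" using assms by auto
    hence "(y * (1 - d / y)) * (u / (v * ((1 - d / y) * w))) = y * (u / (v * w))" by (rule cancel_factor)
    moreover have "y * (1 - d / y) = y - d" using assms by (simp add: field_simps)
    ultimately show ?thesis by (simp only:)
  qed
  show ?thesis
    unfolding kern_def 1 2 mult.assoc[of _ "y - d"] 3 by (simp add: field_simps)
qed

text \<open>The two theta functions contribute \<open>- h * y / (d * q)\<close> and
  \<open>- y / (h * a)\<close>. Here \<open>h\<close> cancels, so the relation between moments
  obtained from this shift is free of \<open>h\<close>.\<close>

lemma kern_divide_q:
  assumes "d \<noteq> 0" "y \<noteq> 0" "y \<noteq> d" "y \<noteq> a"
  shows "a * d * q * kern q h a d (y / q) = (y - a) * (y - d) * kern q h a d y"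
proof -
  have 1: "qtheta (h * (y / q) / d) q = - (h * y / d) / q * qtheta (h * y / d) q"
    using qtheta_divide_q[OF q, of "h * y / d"] assms h by (simp add: field_simps)
  have 2: "qtheta (h * a / (y / q)) q = - qtheta (h * a / y) q / (h * a / y)"
    using qtheta_mult_q[OF q, of "h * a / y"] assms h a by (simp add: field_simps)
  have 3: "qpoch_inf (e / y) q = (1 - e / y) * qpoch_inf (e / (y / q)) q" for e
    using qpoch_inf_rec[OF q(1), of "e / y"] by simp
  have nz: "1 - d / y \<noteq> 0" "1 - a / y \<noteq> 0" using assms by auto
  have yd: "y - d = y * (1 - d / y)" "y - a = y * (1 - a / y)" using assms by (auto simp: field_simps)
  have "(y - a) * (y - d) * kern q h a d y = y * y * (qtheta (h * y / d) q * qtheta (h * a / y) q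
     / (qpoch_inf (a / (y / q)) q * qpoch_inf (d / (y / q)) q))"
    unfolding kern_def 3[of a] 3[of d] yd by (rule cancel_factor(3)[OF nz(2,1)])
  also have "\<dots> = a * d * q * kern q h a d (y / q)"
    unfolding kern_def 1 2 using assms q h a by (simp add: divide_simps)
  finally show ?thesis ..
qed

lemma holomorphic_on_kern:
  assumes "d \<noteq> 0"
  shows "kern q h a d holomorphic_on {y. max (norm a) (norm d) < norm y}"
proof -
  have "qpoch_inf (e / y) q \<noteq> 0" if "norm e < norm y" for e y
    using that by (rule qpoch_inf_divide_nonzero[OF q(1)])
  thus ?thesis
    unfolding kern_def[abs_def] using assms q h a by (intro holomorphic_intros) auto
qed

lemma kern_integrable:
  assumes "d \<noteq> 0" "norm a < \<rho>" "norm d < \<rho>" "f holomorphic_on {y. max (norm a) (norm d) < norm y}"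
  shows "(\<lambda>y. f y * kern q h a d y) contour_integrable_on circlepath 0 \<rho>"
proof (rule circle_integrable[of _ "{y. max (norm a) (norm d) < norm y}"])
  show "\<rho> > 0" using assms norm_ge_zero[of a] by linarith
  show "{y. norm y = \<rho>} \<subseteq> {y. max (norm a) (norm d) < norm y}" using assms by auto
  show "(\<lambda>y. f y * kern q h a d y) holomorphic_on {y. max (norm a) (norm d) < norm y}"
    by (intro holomorphic_intros holomorphic_on_kern assms)
qed

lemma moment_integrable:
  assumes "d \<noteq> 0" "norm a < \<rho>" "norm d < \<rho>"
  shows "(\<lambda>y. y ^ n * kern q h a d y / y) contour_integrable_on circlepath 0 \<rho>"
proof -
  have "(\<lambda>y. y ^ n / y * kern q h a d y) contour_integrable_on circlepath 0 \<rho>"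
    by (intro kern_integrable assms holomorphic_intros) auto
  thus ?thesis by simp
qed

text \<open>Write \<open>y = d + (y - d)\<close> and turn the factor \<open>y - d\<close> into a
  shift of \<open>d\<close> by \<open>kern_mult_d\<close>.\<close>

lemma moment_Suc:
  assumes "d \<noteq> 0" "norm a < \<rho>" "norm d < \<rho>"
  shows "moment q h a \<rho> d (Suc n) = d * moment q h a \<rho> d n - d * q / h * moment q h a \<rho> (d * q) n"
proof -
  have "norm (d * q) \<le> norm d" using norm_mult_q_power_le[OF q(1), of d 1] by simp
  hence dq: "norm (d * q) < \<rho>" "d * q \<noteq> 0" using assms q by auto
  have \<rho>: "\<rho> > 0" using assms norm_ge_zero[of a] by linarith
  have "contour_integral (circlepath 0 \<rho>) (\<lambda>y. y ^ Suc n * kern q h a d y / y)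
    = contour_integral (circlepath 0 \<rho>) (\<lambda>y. d * (y ^ n * kern q h a d y / y) - d * q / h * (y ^ n * kern q h a (d * q) y / y))"
  proof (rule contour_integral_eq)
    fix y assume "y \<in> path_image (circlepath 0 \<rho>)"
    hence "norm y = \<rho>" using \<rho> by (simp add: path_image_circlepath_0)
    hence y: "y \<noteq> 0" "y \<noteq> d" using assms \<rho> by auto
    show "y ^ Suc n * kern q h a d y / y = d * (y ^ n * kern q h a d y / y) - d * q / h * (y ^ n * kern q h a (d * q) y / y)"
      unfolding kern_mult_d[OF assms(1) y] using y assms(1) q h by (simp add: field_simps)
  qed
  also have "\<dots> = d * contour_integral (circlepath 0 \<rho>) (\<lambda>y. y ^ n * kern q h a d y / y)
      - d * q / h * contour_integral (circlepath 0 \<rho>) (\<lambda>y. y ^ n * kern q h a (d * q) y / y)"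
    using moment_integrable[OF assms, of n] moment_integrable[OF dq(2) assms(2) dq(1), of n]
    by (simp only: contour_integral_diff contour_integral_lmul contour_integrable_lmul)
  finally show ?thesis by (simp add: moment_def diff_divide_distrib)
qed

text \<open>Substituting \<open>y / q\<close> for \<open>y\<close> in the contour integral.\<close>

lemma moment_1:
  assumes "d \<noteq> 0" "norm a < \<rho>" "norm d < \<rho>"
  shows "moment q h a \<rho> d 1 = (a + d) * moment q h a \<rho> d 0"
proof -
  define l where "l = max (norm a) (norm d)"
  have \<rho>: "\<rho> > 0" using assms norm_ge_zero[of a] by linarith
  have l: "0 \<le> l" "l < \<rho>" using assms by (auto simp: l_def max_def)
  have "\<rho> * norm q \<le> \<rho> * 1" using q \<rho> by (intro mult_left_mono) auto
  hence l2: "l < norm (1 / q) * \<rho>" using q l by (simp add: norm_divide divide_simps) (use mult_left_mono[of "norm q" 1 l] in simp)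
  \<comment> \<open>The weight \<open>1 / y ^ 2\<close> is chosen so that the constant term of
    \<open>(y - a) * (y - d)\<close> reproduces the integral on the other side. That integral
    cancels, and only the moments of order 0 and 1 remain.\<close>
  define f where "f = (\<lambda>y. a * d * (1 / y ^ 2 * kern q h a d y))"
  have hol: "f holomorphic_on {y. l < norm y}"
    unfolding f_def l_def using l by (intro holomorphic_intros holomorphic_on_kern assms) (auto simp: l_def)
  have I: "(\<lambda>y. 1 / y ^ 2 * kern q h a d y) contour_integrable_on circlepath 0 \<rho>"
    by (rule kern_integrable[OF assms]) (use l in \<open>auto intro!: holomorphic_intros\<close>)
  have "contour_integral (circlepath 0 \<rho>) (\<lambda>y. f (1 / q * y)) * (1 / q) = contour_integral (circlepath 0 \<rho>) f"
    by (rule contour_integral_circlepath_scale[OF hol l l2])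
  also have "contour_integral (circlepath 0 \<rho>) (\<lambda>y. f (1 / q * y))
    = contour_integral (circlepath 0 \<rho>) (\<lambda>y. q * (y ^ 1 * kern q h a d y / y) - q * (a + d) * (y ^ 0 * kern q h a d y / y)
         + q * a * d * (1 / y ^ 2 * kern q h a d y))"
  proof (rule contour_integral_eq)
    fix y assume "y \<in> path_image (circlepath 0 \<rho>)"
    hence "norm y = \<rho>" using \<rho> by (simp add: path_image_circlepath_0)
    hence y: "y \<noteq> 0" "y \<noteq> d" "y \<noteq> a" using assms \<rho> by auto
    have "f (1 / q * y) = q / y ^ 2 * (a * d * q * kern q h a d (y / q))"
      using q y by (simp add: f_def power_divide power2_eq_square)
    also have "\<dots> = q / y ^ 2 * ((y - a) * (y - d) * kern q h a d y)"
      by (simp only: kern_divide_q[OF assms(1) y])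
    also have "\<dots> = q * (y ^ 1 * kern q h a d y / y) - q * (a + d) * (y ^ 0 * kern q h a d y / y)
         + q * a * d * (1 / y ^ 2 * kern q h a d y)"
      using y by (simp add: field_simps power2_eq_square)
    finally show "f (1 / q * y) = \<dots>" .
  qed
  also have "\<dots> = q * contour_integral (circlepath 0 \<rho>) (\<lambda>y. y ^ 1 * kern q h a d y / y)
      - q * (a + d) * contour_integral (circlepath 0 \<rho>) (\<lambda>y. y ^ 0 * kern q h a d y / y)
      + q * a * d * contour_integral (circlepath 0 \<rho>) (\<lambda>y. 1 / y ^ 2 * kern q h a d y)"
    using moment_integrable[OF assms, of 0] moment_integrable[OF assms, of 1] I
    by (simp only: contour_integral_diff contour_integral_add contour_integral_lmul contour_integrable_lmul
        contour_integrable_diff contour_integrable_add)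
  also have "contour_integral (circlepath 0 \<rho>) f = a * d * contour_integral (circlepath 0 \<rho>) (\<lambda>y. 1 / y ^ 2 * kern q h a d y)"
    unfolding f_def using I by (intro contour_integral_lmul)
  finally have eq: "(q * contour_integral (circlepath 0 \<rho>) (\<lambda>y. y ^ 1 * kern q h a d y / y)
      - q * (a + d) * contour_integral (circlepath 0 \<rho>) (\<lambda>y. y ^ 0 * kern q h a d y / y)
      + q * a * d * contour_integral (circlepath 0 \<rho>) (\<lambda>y. 1 / y ^ 2 * kern q h a d y)) * (1 / q)
    = a * d * contour_integral (circlepath 0 \<rho>) (\<lambda>y. 1 / y ^ 2 * kern q h a d y)" .
  have "x = s * w" if "(q * x - q * s * w + q * a * d * v) * (1 / q) = a * d * v" for x s w v
  proof -
    have "(q * x - q * s * w + q * a * d * v) * (1 / q) = x - s * w + a * d * v" using q by (simp add: field_simps)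
    thus ?thesis using that by simp
  qed
  from this[OF eq] have "contour_integral (circlepath 0 \<rho>) (\<lambda>y. y ^ 1 * kern q h a d y / y)
      = (a + d) * contour_integral (circlepath 0 \<rho>) (\<lambda>y. y ^ 0 * kern q h a d y / y)" .
  thus ?thesis by (simp add: moment_def del: power_0 power_one_right)
qed

text \<open>Both \<open>moment_Suc\<close> and \<open>moment_1\<close> evaluate the first moment;
  comparing them determines the zeroth moment at \<open>d * q\<close>.\<close>

lemma moment_0_mult_q:
  assumes "d \<noteq> 0" "norm a < \<rho>" "norm d < \<rho>"
  shows "moment q h a \<rho> (d * q) 0 = - (h * a / (d * q)) * moment q h a \<rho> d 0"
proof -
  have "d * q / h * moment q h a \<rho> (d * q) 0 = - (a * moment q h a \<rho> d 0)"
    using moment_Suc[OF assms, of 0] moment_1[OF assms] unfolding One_nat_def by algebra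
  thus ?thesis using assms q h by (simp add: field_simps)
qed

text \<open>Both sides satisfy the same recurrence in \<open>n\<close>. It shifts \<open>d\<close>,
  hence the induction over arbitrary \<open>d\<close>; by \<open>moment_0_mult_q\<close> the
  coefficient of the shifted term becomes \<open>a\<close>, without \<open>h\<close>.\<close>

lemma moment_eq_rogers_szego:
  assumes "d \<noteq> 0" "norm a < \<rho>" "norm d < \<rho>"
  shows "moment q h a \<rho> d n = moment q h a \<rho> d 0 * rogers_szego q a d n"
  using assms
proof (induction n arbitrary: d)
  case 0
  show ?case by (simp add: rogers_szego_def qbinom_0_right[OF q])
next
  case (Suc n)
  have "norm (d * q) \<le> norm d" using norm_mult_q_power_le[OF q(1), of d 1] by simp
  hence dq: "norm (d * q) < \<rho>" "d * q \<noteq> 0" using Suc.prems q by auto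
  have "moment q h a \<rho> d (Suc n) = d * (moment q h a \<rho> d 0 * rogers_szego q a d n)
    - d * q / h * (moment q h a \<rho> (d * q) 0 * rogers_szego q a (d * q) n)"
    unfolding moment_Suc[OF Suc.prems] using Suc.IH[OF Suc.prems] Suc.IH[OF dq(2) Suc.prems(2) dq(1)] by simp
  also have "\<dots> = moment q h a \<rho> d 0 * rogers_szego q a d (Suc n)"
    unfolding moment_0_mult_q[OF Suc.prems] rogers_szego_Suc[OF q] using q h Suc.prems by (simp add: field_simps)
  finally show ?case .
qed

text \<open>The iterated kernel, theta function and zeroth moment share the product of the factors
  \<open>- (h / (d * q ^ Suc i))\<close>, which the limit argument for \<open>moment_0\<close>
  divides out.\<close>

lemma kern_iterate:
  assumes "d \<noteq> 0" "norm d < norm y"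
  shows "kern q h a (d * q ^ N) y = (\<Prod>i<N. - (h / (d * q ^ Suc i))) * y ^ N * qpoch (d / y) q N * kern q h a d y"
proof (induction N)
  case (Suc N)
  have "norm (d * q ^ N) \<le> norm d" by (rule norm_mult_q_power_le[OF q(1)])
  hence y: "y \<noteq> 0" "y \<noteq> d * q ^ N" "d * q ^ N \<noteq> 0" using assms q by auto
  have "y - d * q ^ N = y * (1 - d / y * q ^ N)" using y by (simp add: field_simps)
  thus ?case
    using kern_mult_d[OF y(3,1,2)] Suc by (simp add: qpoch_Suc mult_ac)
qed auto

lemma qtheta_iterate:
  assumes "d \<noteq> 0"
  shows "qtheta (h * a / (d * q ^ N)) q = (\<Prod>i<N. - (h / (d * q ^ Suc i))) * a ^ N * qtheta (h * a / d) q"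
proof (induction N)
  case (Suc N)
  have "qtheta (h * a / (d * q ^ Suc N)) q = qtheta (h * a / (d * q ^ N) / q) q"
    by (simp add: mult_ac)
  also have "\<dots> = - (h * a / (d * q ^ N)) / q * qtheta (h * a / (d * q ^ N)) q"
    by (rule qtheta_divide_q[OF q]) (use assms h a q in auto)
  finally show ?case using Suc by (simp add: mult_ac)
qed auto

lemma moment_0_iterate:
  assumes "d \<noteq> 0" "norm a < \<rho>" "norm d < \<rho>"
  shows "moment q h a \<rho> (d * q ^ N) 0 = (\<Prod>i<N. - (h / (d * q ^ Suc i))) * a ^ N * moment q h a \<rho> d 0"
proof (induction N)
  case (Suc N)
  have "norm (d * q ^ N) \<le> norm d" by (rule norm_mult_q_power_le[OF q(1)])
  hence *: "d * q ^ N \<noteq> 0" "norm (d * q ^ N) < \<rho>" using assms q by auto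
  show ?case using moment_0_mult_q[OF *(1) assms(2) *(2)] Suc by (simp add: mult_ac)
qed auto

text \<open>Shrinking the circle from radius \<open>\<rho>\<close> to \<open>\<rho>'\<close> crosses
  the pole at \<open>a\<close> only, since \<open>d\<close> and \<open>a * q\<close> stay
  inside.\<close>

lemma moment_0_residue:
  assumes "d \<noteq> 0" "norm d < \<rho>'" "norm (a * q) < \<rho>'" "\<rho>' < norm a" "norm a < \<rho>"
  shows "moment q h a \<rho> d 0 = qtheta (h * a / d) q * qtheta h q / (qpoch_inf q q * qpoch_inf (d / a) q)
    + moment q h a \<rho>' d 0"
proof -
  define l where "l = max (norm d) (norm (a * q))"
  have l: "0 \<le> l" "l < \<rho>'" using assms by (auto simp: l_def le_max_iff_disj)
  define A where "A = {y. l < norm y \<and> norm y < \<rho> + 1}"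
  define f where "f = (\<lambda>y. kern q h a d y / y)"
  have nz: "qpoch_inf (e / y) q \<noteq> 0" if "norm e < norm y" for e y
    using that by (rule qpoch_inf_divide_nonzero[OF q(1)])
  have rec: "qpoch_inf (a / y) q = (1 - a / y) * qpoch_inf (a * q / y) q" for y
    using qpoch_inf_rec[OF q(1), of "a / y"] by simp
  have "contour_integral (circlepath 0 \<rho>) f - contour_integral (circlepath 0 \<rho>') f
    = 2 * pi * \<i> * (\<Sum>p\<in>{a}. qtheta (h * p / d) q * qtheta h q / (qpoch_inf q q * qpoch_inf (d / p) q))"
  proof (rule annulus_residues[where l = l and u = "\<rho> + 1"])
    show "f holomorphic_on {y. l < norm y \<and> norm y < \<rho> + 1} - {a}"
      unfolding f_def kern_def using l assms(1) q h a nz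
      by (intro holomorphic_intros) (auto simp: rec l_def)
    fix p assume "p \<in> {a}"
    hence p: "p = a" by simp
    show "((\<lambda>y. (y - p) * f y) \<longlongrightarrow> qtheta (h * p / d) q * qtheta h q / (qpoch_inf q q * qpoch_inf (d / p) q)) (at p)"
      unfolding p
    proof (rule Lim_transform_eventually)
      have "((\<lambda>y. qtheta (h * y / d) q * qtheta (h * a / y) q / (qpoch_inf (a * q / y) q * qpoch_inf (d / y) q))
        \<longlongrightarrow> qtheta (h * a / d) q * qtheta (h * a / a) q / (qpoch_inf (a * q / a) q * qpoch_inf (d / a) q)) (at a)"
        using assms a q h nz[of d a] qpoch_inf_nonzero[OF q(1) q(1)] by (intro tendsto_intros) auto
      thus "((\<lambda>y. qtheta (h * y / d) q * qtheta (h * a / y) q / (qpoch_inf (a * q / y) q * qpoch_inf (d / y) q))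
        \<longlongrightarrow> qtheta (h * a / d) q * qtheta h q / (qpoch_inf q q * qpoch_inf (d / a) q)) (at a)"
        using a by simp
      have "\<forall>\<^sub>F y in at a. y \<in> - {0} - {a}"
        by (rule eventually_at_in_open) (use a in auto)
      thus "\<forall>\<^sub>F y in at a. qtheta (h * y / d) q * qtheta (h * a / y) q / (qpoch_inf (a * q / y) q * qpoch_inf (d / y) q) = (y - a) * f y"
      proof eventually_elim
        case (elim y)
        hence "1 - a / y \<noteq> 0" "y \<noteq> 0" and ya: "y - a = y * (1 - a / y)" by (auto simp: field_simps)
        thus ?case unfolding f_def kern_def rec[of y] ya by (subst cancel_factor(2)) auto
      qed
    qed
  qed (use l assms in auto)
  thus ?thesis by (simp add: moment_def f_def field_simps)
qed

text \<open>Replacing \<open>d\<close> by \<open>d * q ^ N\<close> changes both the moment and the residue at \<open>a\<close> by explicit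
  factors, and the remaining integral vanishes in the limit.\<close>

lemma moment_0:
  assumes "d \<noteq> 0" "norm d < norm a" "norm a < \<rho>"
  shows "moment q h a \<rho> d 0 = qtheta h q * qtheta (h * a / d) q / qpoch_inf q q"
proof -
  have "norm (a * q) < norm a" using q a by (simp add: norm_mult)
  then obtain \<rho>' where \<rho>': "max (norm d) (norm (a * q)) < \<rho>'" "\<rho>' < norm a"
    using assms dense[of "max (norm d) (norm (a * q))" "norm a"] by auto
  have pos: "\<rho>' > 0" using \<rho>' norm_ge_zero[of d] by linarith
  have d\<rho>: "norm d < \<rho>" using assms by simp
  \<comment> \<open>\<open>K N\<close> is the common factor of the moment at
    \<open>d * q ^ N\<close> and of its residue at \<open>a\<close>. After division the residue
    depends on \<open>N\<close> only through \<open>d / a * q ^ N\<close>, which tends to 0.\<close>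
  define K where "K = (\<lambda>N. (\<Prod>i<N. - (h / (d * q ^ Suc i))) * a ^ N)"
  have K: "K N \<noteq> 0" for N using h a q assms by (auto simp: K_def)
  define c where "c = circlepath 0 \<rho>'"
  define E where "E = (\<lambda>N. moment q h a \<rho>' (d * q ^ N) 0 / K N)"
  have nz: "qpoch_inf (e / y) q \<noteq> 0" if "norm e < norm y" for e y
    using that by (rule qpoch_inf_divide_nonzero[OF q(1)])
  have rec: "qpoch_inf (a / y) q = (1 - a / y) * qpoch_inf (a * q / y) q" for y
    using qpoch_inf_rec[OF q(1), of "a / y"] by simp
  have dN: "norm (d * q ^ N) \<le> norm d" "d * q ^ N \<noteq> 0" for N
    using norm_mult_q_power_le[OF q(1)] assms q by auto
  have eq: "moment q h a \<rho> d 0 = qtheta (h * a / d) q * qtheta h q / (qpoch_inf q q * qpoch_inf (d / a * q ^ N) q) + E N" for N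
  proof -
    have "K N * moment q h a \<rho> d 0 = qtheta (h * a / (d * q ^ N)) q * qtheta h q / (qpoch_inf q q * qpoch_inf (d * q ^ N / a) q)
       + moment q h a \<rho>' (d * q ^ N) 0"
      using moment_0_residue[of "d * q ^ N" \<rho>' \<rho>] moment_0_iterate[OF assms(1,3) d\<rho>, of N] dN[of N] \<rho>' assms
      by (simp add: K_def)
    also have "qtheta (h * a / (d * q ^ N)) q = K N * qtheta (h * a / d) q"
      using qtheta_iterate[OF assms(1)] by (simp add: K_def)
    finally show ?thesis using K[of N] by (simp add: E_def field_simps)
  qed
  have hol: "kern q h a d holomorphic_on {y. l < norm y \<and> norm y < norm a}" if "l = max (norm d) (norm (a * q))" for l
    unfolding kern_def[abs_def] using that assms q h a nz norm_ge_zero[of d]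
    by (intro holomorphic_intros) (auto simp: rec)
  define S :: "complex set" where "S = {y. max (norm d) (norm (a * q)) < norm y \<and> norm y < norm a}"
  have S0: "0 \<notin> S" unfolding S_def using norm_ge_zero[of d] by (auto simp del: norm_ge_zero)
  have S: "{y. norm y = \<rho>'} \<subseteq> S" using \<rho>' by (auto simp: S_def)
  have holS: "(\<lambda>y. kern q h a d y / y) holomorphic_on S"
    unfolding S_def using hol[OF refl] S0 by (intro holomorphic_intros) (auto simp: S_def)
  obtain B where B: "B \<ge> 0" "\<And>y. norm y = \<rho>' \<Longrightarrow> norm (kern q h a d y / y) \<le> B"
    using circle_bounded[OF holS S pos] by metis
  \<comment> \<open>\<open>kern_iterate\<close> supplies \<open>y ^ N\<close> where
    \<open>K N\<close> has \<open>a ^ N\<close>, and \<open>norm y = \<rho>' < norm a\<close> on the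
    circle, so the quotient decays geometrically.\<close>
  have bound: "norm (E N) \<le> B * exp (1 / (1 - norm q)) * \<rho>' * (\<rho>' / norm a) ^ N" for N
  proof -
    have "norm (contour_integral c (\<lambda>y. y ^ 0 * kern q h a (d * q ^ N) y / y))
       \<le> (norm (K N) * (\<rho>' / norm a) ^ N * exp (1 / (1 - norm q)) * B) * (2 * pi * \<rho>')"
      unfolding c_def
    proof (rule has_contour_integral_bound_circlepath[of _ _ 0])
      have "(\<lambda>y. y ^ 0 * kern q h a (d * q ^ N) y / y) holomorphic_on S"
      proof -
        have "(\<lambda>y. (\<Prod>i<N. - (h / (d * q ^ Suc i))) * y ^ N * qpoch (d / y) q N * (kern q h a d y / y)) holomorphic_on S"
          unfolding qpoch_def using S0 by (intro holomorphic_intros holS) auto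
        thus ?thesis by (rule holomorphic_transform) (use kern_iterate[OF assms(1)] in \<open>auto simp: S_def\<close>)
      qed
      hence "(\<lambda>y. y ^ 0 * kern q h a (d * q ^ N) y / y) contour_integrable_on circlepath 0 \<rho>'"
        by (rule circle_integrable[OF _ S pos])
      thus "((\<lambda>y. y ^ 0 * kern q h a (d * q ^ N) y / y) has_contour_integral
          contour_integral (circlepath 0 \<rho>') (\<lambda>y. y ^ 0 * kern q h a (d * q ^ N) y / y)) (circlepath 0 \<rho>')"
        by (rule has_contour_integral_integral)
      show "0 \<le> norm (K N) * (\<rho>' / norm a) ^ N * exp (1 / (1 - norm q)) * B"
        using B(1) pos by auto
      fix y :: complex assume "norm (y - 0) = \<rho>'"
      hence y: "norm y = \<rho>'" by simp
      have "norm (qpoch (d / y) q N) \<le> exp (norm (d / y) / (1 - norm q))" by (rule norm_qpoch_le[OF q(1)])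
      also have "\<dots> \<le> exp (1 / (1 - norm q))"
        using y \<rho>' pos q by (auto simp: norm_divide divide_simps)
      finally have 1: "norm (qpoch (d / y) q N) \<le> exp (1 / (1 - norm q))" .
      have "y ^ 0 * kern q h a (d * q ^ N) y / y = (K N * (y / a) ^ N) * qpoch (d / y) q N * (kern q h a d y / y)"
        using kern_iterate[OF assms(1), of y N] y \<rho>' a by (simp add: K_def power_divide)
      also have "norm \<dots> \<le> (norm (K N) * (\<rho>' / norm a) ^ N) * exp (1 / (1 - norm q)) * B"
        unfolding norm_mult[of _ "kern q h a d y / y"] norm_mult[of _ "qpoch (d / y) q N"]
        using 1 B(2)[OF y] pos y by (intro mult_mono) (auto simp: norm_mult norm_power norm_divide)
      finally show "norm (y ^ 0 * kern q h a (d * q ^ N) y / y) \<le> norm (K N) * (\<rho>' / norm a) ^ N * exp (1 / (1 - norm q)) * B" .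
    qed (use pos in auto)
    note le = this
    have "norm (E N) = norm (contour_integral c (\<lambda>y. y ^ 0 * kern q h a (d * q ^ N) y / y)) / (2 * pi) / norm (K N)"
      by (simp add: E_def moment_def c_def norm_divide norm_mult)
    also have "\<dots> \<le> (norm (K N) * (\<rho>' / norm a) ^ N * exp (1 / (1 - norm q)) * B) * (2 * pi * \<rho>') / (2 * pi) / norm (K N)"
      by (intro divide_right_mono le) auto
    also have "\<dots> = B * exp (1 / (1 - norm q)) * \<rho>' * (\<rho>' / norm a) ^ N"
      using K[of N] by (simp add: field_simps)
    finally show ?thesis .
  qed
  have "(\<lambda>N. B * exp (1 / (1 - norm q)) * \<rho>' * (\<rho>' / norm a) ^ N) \<longlonglongrightarrow> B * exp (1 / (1 - norm q)) * \<rho>' * 0"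
    using pos \<rho>' a by (intro tendsto_intros LIMSEQ_power_zero) (auto simp: divide_simps)
  hence "E \<longlonglongrightarrow> 0"
    by (intro Lim_null_comparison[of E "\<lambda>N. B * exp (1 / (1 - norm q)) * \<rho>' * (\<rho>' / norm a) ^ N"]) (use bound in auto)
  moreover have "(\<lambda>N. qtheta (h * a / d) q * qtheta h q / (qpoch_inf q q * qpoch_inf (d / a * q ^ N) q))
     \<longlonglongrightarrow> qtheta (h * a / d) q * qtheta h q / (qpoch_inf q q * qpoch_inf (d / a * 0) q)"
    using q qpoch_inf_nonzero[OF q(1) q(1)] by (intro tendsto_intros LIMSEQ_power_zero) auto
  ultimately have "(\<lambda>N. qtheta (h * a / d) q * qtheta h q / (qpoch_inf q q * qpoch_inf (d / a * q ^ N) q) + E N)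
     \<longlonglongrightarrow> qtheta (h * a / d) q * qtheta h q / (qpoch_inf q q * qpoch_inf (d / a * 0) q) + 0"
    by (intro tendsto_add)
  hence "(\<lambda>N. moment q h a \<rho> d 0) \<longlonglongrightarrow> qtheta (h * a / d) q * qtheta h q / (qpoch_inf q q * qpoch_inf (d / a * 0) q) + 0"
    by (simp only: eq[symmetric])
  hence "moment q h a \<rho> d 0 = qtheta (h * a / d) q * qtheta h q / (qpoch_inf q q * qpoch_inf (d / a * 0) q) + 0"
    using LIMSEQ_unique tendsto_const by blast
  thus ?thesis by (simp add: mult.commute)
qed

end

section \<open>Integration of a power series against the kernel\<close>

lemma power_series_ball:
  fixes f :: "complex \<Rightarrow> complex"
  assumes "f holomorphic_on ball 0 R"
  obtains c where "\<And>y. norm y < R \<Longrightarrow> (\<lambda>n. c n * y ^ n) sums f y"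
    "\<And>y :: complex. norm y < R \<Longrightarrow> summable (\<lambda>n. norm (c n) * norm y ^ n)"
proof -
  define c where "c = (\<lambda>n. (deriv ^^ n) f 0 / fact n)"
  have c: "(\<lambda>n. c n * y ^ n) sums f y" if "norm y < R" for y
    using holomorphic_power_series[OF assms, of y] that by (simp add: c_def)
  have "summable (\<lambda>n. norm (c n) * norm y ^ n)" if y: "norm y < R" for y :: complex
  proof -
    obtain x where x: "norm y < x" "x < R" using dense[OF y] by blast
    hence "x > 0" using norm_ge_zero[of y] by linarith
    hence "summable (\<lambda>n. c n * of_real x ^ n)" using c[of "of_real x"] x by (auto simp: sums_iff)
    hence "summable (\<lambda>n. norm (c n * y ^ n))"
      by (rule powser_insidea) (use x \<open>x > 0\<close> in auto)
    thus ?thesis by (simp add: norm_mult norm_power)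
  qed
  with c show ?thesis using that by blast
qed

context
  fixes q :: complex
  assumes q: "norm q < 1" "q \<noteq> 0"
begin

lemma qdiff_sums:
  assumes "\<And>j. (\<lambda>n. c n * (a * q ^ j) ^ n) sums f (a * q ^ j)"
  shows "(\<lambda>n. c n * a ^ n * qbinom q n k) sums qdiff q a k f"
proof -
  have "(\<lambda>n. \<Sum>j\<le>k. qdiff_coeff q k j * (c n * (a * q ^ j) ^ n)) sums qdiff q a k f"
    unfolding qdiff_def by (intro sums_sum sums_mult assms)
  moreover have "(\<lambda>n. \<Sum>j\<le>k. qdiff_coeff q k j * (c n * (a * q ^ j) ^ n)) = (\<lambda>n. c n * a ^ n * qbinom q n k)"
    unfolding qbinom_def sum_distrib_left
    by (intro ext sum.cong) (auto simp: power_mult_distrib power_mult[symmetric] mult_ac)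
  ultimately show ?thesis by simp
qed

text \<open>The bound is independent of \<open>k\<close> because \<open>qbinom\<close> is bounded.
  The factor \<open>norm a ^ m\<close> is kept explicit, as it is later paired with the coefficients
  of Euler's series.\<close>

lemma qdiff_monom_bound:
  assumes "f holomorphic_on ball 0 R" "norm a < R"
  shows "\<exists>C\<ge>0. \<forall>k m. norm (qdiff q a k (\<lambda>y. y ^ m * f y)) \<le> C * norm a ^ m"
proof -
  obtain c where c: "\<And>y. norm y < R \<Longrightarrow> (\<lambda>n. c n * y ^ n) sums f y"
    "\<And>y::complex. norm y < R \<Longrightarrow> summable (\<lambda>n. norm (c n) * norm y ^ n)"
    using power_series_ball[OF assms(1)] by blast
  obtain C where C: "C \<ge> 0" "\<And>n k. norm (qbinom q n k) \<le> C" using qbinom_bounded[OF q] by blast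
  define S where "S = (\<Sum>n. norm (c n) * norm a ^ n)"
  have "S \<ge> 0" unfolding S_def using c(2)[OF assms(2)] by (intro suminf_nonneg) auto
  have "norm (qdiff q a k (\<lambda>y. y ^ m * f y)) \<le> S * C * norm a ^ m" for k m
  proof -
    define c' where "c' = (\<lambda>n. if n < m then 0 else c (n - m))"
    have "(\<lambda>n. c' n * (a * q ^ j) ^ n) sums ((a * q ^ j) ^ m * f (a * q ^ j))" for j
    proof -
      have "norm (a * q ^ j) \<le> norm a" by (rule norm_mult_q_power_le[OF q(1)])
      hence "norm (a * q ^ j) < R" using assms by simp
      hence "(\<lambda>n. (a * q ^ j) ^ m * (c n * (a * q ^ j) ^ n)) sums ((a * q ^ j) ^ m * f (a * q ^ j))"
        by (intro sums_mult c)
      hence "(\<lambda>n. c' (n + m) * (a * q ^ j) ^ (n + m)) sums ((a * q ^ j) ^ m * f (a * q ^ j))"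
        by (simp add: c'_def power_add mult_ac)
      thus ?thesis
        using sums_iff_shift[of "\<lambda>n. c' n * (a * q ^ j) ^ n" m "(a * q ^ j) ^ m * f (a * q ^ j)"] by (simp add: c'_def)
    qed
    hence s: "(\<lambda>n. c' n * a ^ n * qbinom q n k) sums qdiff q a k (\<lambda>y. y ^ m * f y)"
      by (rule qdiff_sums)
    hence s': "(\<lambda>n. c' (n + m) * a ^ (n + m) * qbinom q (n + m) k) sums qdiff q a k (\<lambda>y. y ^ m * f y)"
      using sums_iff_shift[of "\<lambda>n. c' n * a ^ n * qbinom q n k" m "qdiff q a k (\<lambda>y. y ^ m * f y)"] by (simp add: c'_def)
    have le: "norm (c' (n + m) * a ^ (n + m) * qbinom q (n + m) k) \<le> norm (c n) * norm a ^ n * (C * norm a ^ m)" for n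
    proof -
      have "norm (c' (n + m) * a ^ (n + m) * qbinom q (n + m) k) = norm (c n) * norm a ^ n * (norm (qbinom q (n + m) k) * norm a ^ m)"
        by (simp add: c'_def norm_mult norm_power power_add mult_ac)
      also have "\<dots> \<le> norm (c n) * norm a ^ n * (C * norm a ^ m)"
        using C by (intro mult_left_mono mult_right_mono) auto
      finally show ?thesis .
    qed
    have sm: "summable (\<lambda>n. norm (c n) * norm a ^ n * (C * norm a ^ m))"
      by (intro summable_mult2 c assms)
    have "norm (qdiff q a k (\<lambda>y. y ^ m * f y)) = norm (\<Sum>n. c' (n + m) * a ^ (n + m) * qbinom q (n + m) k)"
      using s' by (simp add: sums_iff)
    also have "\<dots> \<le> (\<Sum>n. norm (c n) * norm a ^ n * (C * norm a ^ m))"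
      by (rule norm_suminf_le[OF le sm])
    also have "\<dots> = S * (C * norm a ^ m)"
      unfolding S_def using c(2)[OF assms(2)] by (rule suminf_mult2[symmetric])
    finally show ?thesis by (simp add: mult_ac)
  qed
  thus ?thesis using \<open>S \<ge> 0\<close> C by (intro exI[of _ "S * C"]) auto
qed

text \<open>Expand \<open>f\<close>, integrate termwise to Rogers-Szego polynomials, and regroup by
  powers of \<open>d / a\<close>: at fixed \<open>k\<close> the sum over \<open>n\<close> is
  \<open>qdiff\<close>. The hypothesis \<open>norm d < norm a\<close> gives convergence in
  \<open>k\<close> and the value of the zeroth moment.\<close>

lemma kern_integral_eq_qdiff_series:
  assumes h: "h \<noteq> 0" and a: "a \<noteq> 0" and d: "d \<noteq> 0" "norm d < norm a" and \<rho>: "norm a < \<rho>" "\<rho> < R"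
    and f: "f holomorphic_on ball 0 R"
  shows "contour_integral (circlepath 0 \<rho>) (\<lambda>y. kern q h a d y * f y / y)
    = 2 * pi * \<i> * (qtheta h q * qtheta (h * a / d) q / qpoch_inf q q * (\<Sum>k. (d / a) ^ k * qdiff q a k f))"
proof -
  obtain c where c: "\<And>y. norm y < R \<Longrightarrow> (\<lambda>n. c n * y ^ n) sums f y"
    "\<And>y::complex. norm y < R \<Longrightarrow> summable (\<lambda>n. norm (c n) * norm y ^ n)"
    using power_series_ball[OF f] by blast
  obtain C where C: "C \<ge> 0" "\<And>n k. norm (qbinom q n k) \<le> C" using qbinom_bounded[OF q] by blast
  define \<mu> where "\<mu> = qtheta h q * qtheta (h * a / d) q / qpoch_inf q q"
  have pos: "\<rho> > 0" using \<rho> norm_ge_zero[of a] by linarith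
  have d\<rho>: "norm d < \<rho>" using d \<rho> by simp
  define S where "S = {y::complex. max (norm a) (norm d) < norm y}"
  have S: "{y. norm y = \<rho>} \<subseteq> S" using \<rho> d by (auto simp: S_def)
  have hol: "(\<lambda>y. kern q h a d y / y) holomorphic_on S"
    unfolding S_def by (intro holomorphic_intros holomorphic_on_kern q h a d) auto
  obtain B where B: "\<And>y. norm y = \<rho> \<Longrightarrow> norm (kern q h a d y / y) \<le> B"
    using circle_bounded[OF hol S pos] by metis
  have ul: "uniform_limit (sphere 0 \<rho>) (\<lambda>N y. \<Sum>n<N. c n * (y ^ n * kern q h a d y / y)) (\<lambda>y. \<Sum>n. c n * (y ^ n * kern q h a d y / y)) sequentially"
  proof (rule Weierstrass_m_test)
    fix n and y :: complex assume "y \<in> sphere 0 \<rho>"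
    hence y: "norm y = \<rho>" by simp
    have "norm (c n * (y ^ n * kern q h a d y / y)) = norm (c n) * \<rho> ^ n * norm (kern q h a d y / y)"
      using y by (simp add: norm_mult norm_divide norm_power)
    also have "\<dots> \<le> norm (c n) * \<rho> ^ n * B"
      using B[OF y] pos by (intro mult_left_mono) auto
    finally show "norm (c n * (y ^ n * kern q h a d y / y)) \<le> norm (c n) * \<rho> ^ n * B" .
  next
    show "summable (\<lambda>n. norm (c n) * \<rho> ^ n * B)"
      using c(2)[of "of_real \<rho>"] \<rho> pos by (intro summable_mult2) simp
  qed
  have int: "(\<lambda>y. \<Sum>n<N. c n * (y ^ n * kern q h a d y / y)) contour_integrable_on circlepath 0 \<rho>" for N
    by (intro contour_integrable_sum contour_integrable_lmul moment_integrable q h a d \<rho> d\<rho>) simp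
  have "(\<lambda>N. contour_integral (circlepath 0 \<rho>) (\<lambda>y. \<Sum>n<N. c n * (y ^ n * kern q h a d y / y)))
    \<longlonglongrightarrow> contour_integral (circlepath 0 \<rho>) (\<lambda>y. \<Sum>n. c n * (y ^ n * kern q h a d y / y))"
    by (rule contour_integral_uniform_limit_circlepath[OF _ ul])
       (use pos int in auto)
  also have "contour_integral (circlepath 0 \<rho>) (\<lambda>y. \<Sum>n. c n * (y ^ n * kern q h a d y / y))
    = contour_integral (circlepath 0 \<rho>) (\<lambda>y. kern q h a d y * f y / y)"
  proof (rule contour_integral_eq)
    fix y assume "y \<in> path_image (circlepath 0 \<rho>)"
    hence "norm y = \<rho>" using pos by (simp add: path_image_circlepath_0)
    hence "(\<lambda>n. c n * y ^ n * (kern q h a d y / y)) sums (f y * (kern q h a d y / y))"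
      using \<rho> by (intro sums_mult2 c) auto
    thus "(\<Sum>n. c n * (y ^ n * kern q h a d y / y)) = kern q h a d y * f y / y"
      by (simp add: sums_iff mult_ac)
  qed
  also have "(\<lambda>N. contour_integral (circlepath 0 \<rho>) (\<lambda>y. \<Sum>n<N. c n * (y ^ n * kern q h a d y / y)))
     = (\<lambda>N. \<Sum>n<N. 2 * pi * \<i> * \<mu> * (c n * rogers_szego q a d n))"
  proof
    fix N
    have m: "moment q h a \<rho> d n = \<mu> * rogers_szego q a d n" for n
      unfolding \<mu>_def moment_0[OF q h a d \<rho>(1), symmetric] by (rule moment_eq_rogers_szego[OF q h a d(1) \<rho>(1) d\<rho>])
    have "contour_integral (circlepath 0 \<rho>) (\<lambda>y. \<Sum>n<N. c n * (y ^ n * kern q h a d y / y))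
      = (\<Sum>n<N. contour_integral (circlepath 0 \<rho>) (\<lambda>y. c n * (y ^ n * kern q h a d y / y)))"
      by (rule contour_integral_sum[OF finite_lessThan]) (rule contour_integrable_lmul[OF moment_integrable[OF q h a d(1) \<rho>(1) d\<rho>]])
    also have "\<dots> = (\<Sum>n<N. c n * contour_integral (circlepath 0 \<rho>) (\<lambda>y. y ^ n * kern q h a d y / y))"
      by (rule sum.cong[OF refl]) (rule contour_integral_lmul[OF moment_integrable[OF q h a d(1) \<rho>(1) d\<rho>]])
    also have "\<dots> = (\<Sum>n<N. c n * (2 * pi * \<i> * moment q h a \<rho> d n))"
      by (simp add: moment_def)
    also have "\<dots> = (\<Sum>n<N. 2 * pi * \<i> * \<mu> * (c n * rogers_szego q a d n))"
      unfolding m by (intro sum.cong) (auto simp: mult_ac)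
    finally show "contour_integral (circlepath 0 \<rho>) (\<lambda>y. \<Sum>n<N. c n * (y ^ n * kern q h a d y / y))
      = (\<Sum>n<N. 2 * pi * \<i> * \<mu> * (c n * rogers_szego q a d n))" .
  qed
  finally have sums: "(\<lambda>n. 2 * pi * \<i> * \<mu> * (c n * rogers_szego q a d n)) sums
    contour_integral (circlepath 0 \<rho>) (\<lambda>y. kern q h a d y * f y / y)"
    by (simp add: sums_def)
  \<comment> \<open>Since \<open>qbinom q n k\<close> vanishes for \<open>k > n\<close>, each
    polynomial may be written as a full series in \<open>k\<close>.\<close>
  define g where "g = (\<lambda>n k. c n * a ^ n * qbinom q n k * (d / a) ^ k)"
  have rs: "c n * rogers_szego q a d n = (\<Sum>k. g n k)" for n
  proof -
    have "(\<Sum>k. g n k) = (\<Sum>k\<le>n. g n k)"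
      by (rule suminf_finite) (auto simp: g_def qbinom_eq_0[OF q])
    also have "\<dots> = c n * rogers_szego q a d n"
      unfolding rogers_szego_def sum_distrib_left g_def
      by (intro sum.cong) (use a in \<open>auto simp: power_diff power_divide\<close>)
    finally show ?thesis ..
  qed
  have gb: "norm (g n k) \<le> (norm (c n) * norm a ^ n * C) * (norm (d / a)) ^ k" for n k
  proof -
    have "norm (g n k) = norm (c n) * norm a ^ n * norm (qbinom q n k) * (norm (d / a)) ^ k"
      by (simp add: g_def norm_mult norm_power)
    also have "\<dots> \<le> (norm (c n) * norm a ^ n * C) * (norm (d / a)) ^ k"
      using C by (intro mult_right_mono mult_left_mono) auto
    finally show ?thesis .
  qed
  have aR: "norm a < R" using \<rho> by simp
  have sA: "summable (\<lambda>n. norm (c n) * norm a ^ n * C)" by (intro summable_mult2 c aR)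
  have sB: "summable (\<lambda>k. (norm (d / a)) ^ k)" using d a by (intro summable_geometric) (auto simp: norm_divide)
  have swap: "(\<Sum>n. \<Sum>k. g n k) = (\<Sum>k. \<Sum>n. g n k)"
    by (rule suminf_swap_dominated[OF gb sA _ sB]) (use C in auto)
  have inner: "(\<Sum>n. g n k) = (d / a) ^ k * qdiff q a k f" for k
  proof -
    have "(\<lambda>n. c n * (a * q ^ j) ^ n) sums f (a * q ^ j)" for j
    proof -
      have "norm (a * q ^ j) \<le> norm a" by (rule norm_mult_q_power_le[OF q(1)])
      thus ?thesis using aR by (intro c) auto
    qed
    from qdiff_sums[OF this] have "(\<lambda>n. c n * a ^ n * qbinom q n k) sums qdiff q a k f" .
    hence "(\<lambda>n. g n k) sums (qdiff q a k f * (d / a) ^ k)" unfolding g_def by (rule sums_mult2)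
    thus ?thesis by (simp add: sums_iff mult_ac)
  qed
  have "summable (\<lambda>n. \<Sum>k. g n k)"
  proof (rule summable_comparison_test'[of "\<lambda>n. norm (c n) * norm a ^ n * C * (\<Sum>k. (norm (d / a)) ^ k)" 0])
    show "summable (\<lambda>n. norm (c n) * norm a ^ n * C * (\<Sum>k. (norm (d / a)) ^ k))" by (intro summable_mult2 sA)
    show "norm (\<Sum>k. g n k) \<le> norm (c n) * norm a ^ n * C * (\<Sum>k. (norm (d / a)) ^ k)" for n
      unfolding suminf_mult[OF sB, symmetric] by (rule norm_suminf_le[OF gb summable_mult[OF sB]])
  qed
  hence "(\<Sum>n. 2 * pi * \<i> * \<mu> * (\<Sum>k. g n k)) = 2 * pi * \<i> * \<mu> * (\<Sum>n. \<Sum>k. g n k)"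
    by (rule suminf_mult)
  thus ?thesis
    using sums unfolding sums_iff rs swap inner by (simp add: \<mu>_def mult_ac)
qed

end

section \<open>The inner evaluation\<close>

context
  fixes q :: complex
  assumes q: "norm q < 1" "q \<noteq> 0"
begin

section \<open>The finite q-binomial theorem and Euler's expansion\<close>

lemma finite_qbinomial: "qpoch x q n = (\<Sum>m\<le>n. (\<Prod>i<m. - (q ^ i)) * qbinom q n m * x ^ m)"
proof (induction n arbitrary: x)
  case (Suc n)
  define s where "s = (\<lambda>m. \<Prod>i<m. - (q ^ i))"
  have s: "s (Suc m) = - (q ^ m) * s m" "s 0 = 1" for m by (simp_all add: s_def)
  have "(\<Sum>m\<le>Suc n. s m * qbinom q (Suc n) m * x ^ m)
    = 1 + (\<Sum>m\<le>n. s (Suc m) * (qbinom q n m + q ^ Suc m * qbinom q n (Suc m)) * x ^ Suc m)"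
    by (subst sum.atMost_Suc_shift) (simp add: s qbinom_Suc_Suc[OF q] qbinom_0_right[OF q])
  also have "\<dots> = (1 + (\<Sum>m\<le>n. s (Suc m) * qbinom q n (Suc m) * (x * q) ^ Suc m)) - x * (\<Sum>m\<le>n. s m * qbinom q n m * (x * q) ^ m)"
    by (simp add: s sum_distrib_left sum.distrib[symmetric] sum_subtractf[symmetric] power_mult_distrib algebra_simps
          sum_negf[symmetric] del: sum_negf)
  also have "1 + (\<Sum>m\<le>n. s (Suc m) * qbinom q n (Suc m) * (x * q) ^ Suc m) = (\<Sum>m\<le>Suc n. s m * qbinom q n m * (x * q) ^ m)"
    by (subst sum.atMost_Suc_shift) (simp add: s qbinom_0_right[OF q])
  also have "\<dots> = (\<Sum>m\<le>n. s m * qbinom q n m * (x * q) ^ m)"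
    by (simp add: qbinom_eq_0[OF q])
  also have "\<dots> = qpoch (x * q) q n" unfolding s_def by (rule Suc.IH[symmetric])
  finally show ?case by (simp add: s_def qpoch_Suc_left algebra_simps)
qed (simp add: qbinom_0_right[OF q])

text \<open>The product is the usual \<open>(-1) ^ m * q ^ (m * (m - 1) / 2)\<close>; in this form
  no exponent has to be halved.\<close>

definition euler_coeff :: "nat \<Rightarrow> complex" where
  "euler_coeff m = (\<Prod>i<m. - (q ^ i)) / qpoch q q m"

lemma euler_coeff_Suc: "euler_coeff (Suc m) * (1 - q ^ Suc m) = - (q ^ m) * euler_coeff m"
  using q_power_neq_1[OF q, of m] by (simp add: euler_coeff_def qpoch_Suc)

text \<open>The ratio of consecutive terms is \<open>- q ^ m * x / (1 - q ^ Suc m)\<close>. It tends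
  to 0, so the series converges for every \<open>x\<close>.\<close>

lemma euler_coeff_summable: "summable (\<lambda>m. norm (euler_coeff m * x ^ m))"
proof -
  define \<epsilon> where "\<epsilon> = 1 - norm q"
  have "(\<lambda>m. norm q ^ m * norm x) \<longlonglongrightarrow> 0 * norm x"
    using q by (intro tendsto_intros LIMSEQ_power_zero) auto
  moreover have "0 * norm x < (1 - norm q) / 2" using q by simp
  ultimately have "eventually (\<lambda>m. norm q ^ m * norm x < (1 - norm q) / 2) sequentially"
    by (metis order_tendstoD(2))
  then obtain N where N: "\<And>m. m \<ge> N \<Longrightarrow> norm q ^ m * norm x < (1 - norm q) / 2"
    by (auto simp: eventually_sequentially)
  show ?thesis
  proof (rule summable_ratio_test[of "1 / 2" N])
    fix m assume "m \<ge> N"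
    have "norm q * norm q ^ m \<le> norm q * 1" using q by (intro mult_left_mono power_le_one) auto
    moreover have "norm (1 - q ^ Suc m) \<ge> 1 - norm (q ^ Suc m)" by (metis norm_one norm_triangle_ineq2)
    ultimately have ge: "norm (1 - q ^ Suc m) \<ge> 1 - norm q" by (simp add: norm_mult norm_power)
    have "norm (euler_coeff (Suc m) * x ^ Suc m) * norm (1 - q ^ Suc m) = norm ((euler_coeff (Suc m) * (1 - q ^ Suc m)) * x ^ Suc m)"
      by (simp add: norm_mult)
    also have "\<dots> = norm (euler_coeff m * x ^ m) * (norm q ^ m * norm x)"
      by (subst euler_coeff_Suc) (simp add: norm_mult norm_power)
    also have "\<dots> \<le> norm (euler_coeff m * x ^ m) * ((1 - norm q) / 2)"
      using N[OF \<open>m \<ge> N\<close>] by (intro mult_left_mono) auto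
    finally have "norm (euler_coeff (Suc m) * x ^ Suc m) * norm (1 - q ^ Suc m) \<le> norm (euler_coeff m * x ^ m) * ((1 - norm q) / 2)" .
    moreover have "norm (euler_coeff (Suc m) * x ^ Suc m) * (1 - norm q) \<le> norm (euler_coeff (Suc m) * x ^ Suc m) * norm (1 - q ^ Suc m)"
      using ge by (intro mult_left_mono) auto
    ultimately have "norm (euler_coeff (Suc m) * x ^ Suc m) * (1 - norm q) \<le> (1 / 2 * norm (euler_coeff m * x ^ m)) * (1 - norm q)"
      by (simp del: power_Suc)
    hence "norm (euler_coeff (Suc m) * x ^ Suc m) \<le> 1 / 2 * norm (euler_coeff m * x ^ m)"
      using q by (simp only: mult_le_cancel_right)
    thus "norm (norm (euler_coeff (Suc m) * x ^ Suc m)) \<le> 1 / 2 * norm (norm (euler_coeff m * x ^ m))"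
      by (simp only: real_norm_def abs_norm_cancel)
  qed auto
qed

text \<open>The series satisfies \<open>g x = (1 - x) * g (x * q)\<close>, the functional equation
  of the product. Iterating it moves the argument to 0, where \<open>g\<close> is continuous with
  value 1.\<close>

lemma euler_expansion: "(\<lambda>m. euler_coeff m * x ^ m) sums qpoch_inf x q"
proof -
  define g where "g = (\<lambda>x. \<Sum>m. euler_coeff m * x ^ m)"
  have sm: "summable (\<lambda>m. euler_coeff m * x ^ m)" for x
    by (rule summable_norm_cancel[OF euler_coeff_summable])
  have rec: "g x = (1 - x) * g (x * q)" for x
  proof -
    have shift: "(\<Sum>m. euler_coeff (Suc m) * y ^ Suc m) = g y - 1" for y
      using suminf_split_head[OF sm[of y]] by (simp add: g_def euler_coeff_def)
    have "g x - g (x * q) = (\<Sum>m. euler_coeff (Suc m) * x ^ Suc m) - (\<Sum>m. euler_coeff (Suc m) * (x * q) ^ Suc m)"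
      unfolding shift by simp
    also have "\<dots> = (\<Sum>m. euler_coeff (Suc m) * x ^ Suc m - euler_coeff (Suc m) * (x * q) ^ Suc m)"
      using sm[of x] sm[of "x * q"] by (intro suminf_diff) (subst summable_Suc_iff; assumption)+
    also have "\<dots> = (\<Sum>m. - x * (euler_coeff m * (x * q) ^ m))"
    proof (rule suminf_cong)
      fix m
      have "euler_coeff (Suc m) * x ^ Suc m - euler_coeff (Suc m) * (x * q) ^ Suc m = (euler_coeff (Suc m) * (1 - q ^ Suc m)) * x ^ Suc m"
        by (simp add: power_mult_distrib algebra_simps)
      thus "euler_coeff (Suc m) * x ^ Suc m - euler_coeff (Suc m) * (x * q) ^ Suc m = - x * (euler_coeff m * (x * q) ^ m)"
        unfolding euler_coeff_Suc by (simp add: power_mult_distrib)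
    qed
    also have "\<dots> = - x * g (x * q)"
      unfolding g_def by (rule suminf_mult[OF sm])
    finally show ?thesis by (simp add: algebra_simps)
  qed
  have iter: "g x = qpoch x q n * g (x * q ^ n)" for x n
  proof (induction n)
    case (Suc n)
    thus ?case using rec[of "x * q ^ n"] by (simp add: qpoch_Suc mult_ac)
  qed auto
  have "isCont g 0"
    unfolding g_def by (rule isCont_powser[of _ 1]) (use sm[of 1] in auto)
  moreover have "(\<lambda>n. x * q ^ n) \<longlonglongrightarrow> x * 0" using q by (intro tendsto_intros LIMSEQ_power_zero) auto
  ultimately have "(\<lambda>n. g (x * q ^ n)) \<longlonglongrightarrow> g 0" by (metis isCont_tendsto_compose mult_zero_right)
  hence "(\<lambda>n. qpoch x q n * g (x * q ^ n)) \<longlonglongrightarrow> qpoch_inf x q * g 0"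
    by (intro tendsto_mult qpoch_LIMSEQ q)
  moreover have "g 0 = 1" unfolding g_def by (subst powser_zero) (simp add: euler_coeff_def)
  ultimately have "(\<lambda>n. g x) \<longlonglongrightarrow> qpoch_inf x q" by (simp add: iter[symmetric])
  hence "g x = qpoch_inf x q" using LIMSEQ_unique tendsto_const by blast
  thus ?thesis using sm[of x] by (simp add: g_def sums_iff)
qed

section \<open>Terminating sums\<close>

lemma qpoch_inverse_power:
  assumes "j \<le> k"
  shows "qpoch (1 / q ^ k) q j * (qpoch q q (k - j) * q ^ (k * j)) = qpoch q q k * (\<Prod>i<j. - (q ^ i))"
  using assms
proof (induction j)
  case (Suc j)
  then obtain i where i: "k - j = Suc i" "k = Suc i + j" by (metis Suc_diff_Suc Suc_le_lessD le_add_diff_inverse2 less_imp_le_nat)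
  have kj: "k - Suc j = i" using i by simp
  have "(1 - 1 / q ^ k * q ^ j) * q ^ k = - (q ^ j) * (1 - q ^ Suc i)"
    using q by (simp add: i(2) power_add field_simps)
  have "qpoch (1 / q ^ k) q (Suc j) * (qpoch q q (k - Suc j) * q ^ (k * Suc j))
    = qpoch (1 / q ^ k) q j * (qpoch q q i * q ^ (k * j)) * ((1 - 1 / q ^ k * q ^ j) * q ^ k)"
    by (simp add: qpoch_Suc[of "1 / q ^ k"] kj power_add mult_ac)
  also have "\<dots> = qpoch (1 / q ^ k) q j * (qpoch q q (k - j) * q ^ (k * j)) * (- (q ^ j))"
    unfolding \<open>_ = - (q ^ j) * (1 - q ^ Suc i)\<close> i(1) qpoch_Suc[of q q i] by (simp add: mult_ac)
  also have "\<dots> = qpoch q q k * (\<Prod>i<Suc j. - (q ^ i))"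
    using Suc by simp
  finally show ?case .
qed auto

lemma qdiff_coeff_eq:
  assumes "j \<le> k"
  shows "qdiff_coeff q k j = q ^ j * (\<Prod>i<j. - (q ^ i)) / (qpoch q q j * qpoch q q (k - j) * q ^ (k * j))"
proof -
  have nz: "qpoch q q n \<noteq> 0" for n by (rule qpoch_q_nonzero[OF q(1)])
  have "qpoch (1 / q ^ k) q j = qpoch q q k * (\<Prod>i<j. - (q ^ i)) / (qpoch q q (k - j) * q ^ (k * j))"
    using qpoch_inverse_power[OF assms] nz q by (simp add: field_simps)
  thus ?thesis using nz q by (simp add: qdiff_coeff_def field_simps)
qed

text \<open>Replacing \<open>k\<close> by \<open>k - m\<close> in \<open>qdiff_coeff\<close>
  produces a Gaussian binomial and an additional \<open>q ^ (j * m)\<close>. The latter turns the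
  argument \<open>x * q ^ j\<close> into \<open>x * q ^ (2 * j)\<close>, and the finite q-binomial
  theorem applies. With \<open>x = a\<close> the result completes the factorial
  \<open>qpoch a q (2 * j)\<close> coming from \<open>y ^ 2 / a\<close>.\<close>

lemma euler_qdiff_convolution:
  assumes "j \<le> k"
  shows "(\<Sum>m\<le>k. euler_coeff m * qdiff_coeff q (k - m) j * (x * q ^ j) ^ m) = qdiff_coeff q k j * qpoch (x * q ^ (2 * j)) q (k - j)"
proof -
  have nz: "qpoch q q n \<noteq> 0" for n by (rule qpoch_q_nonzero[OF q(1)])
  have "(\<Sum>m\<le>k. euler_coeff m * qdiff_coeff q (k - m) j * (x * q ^ j) ^ m)
    = (\<Sum>m\<le>k - j. euler_coeff m * qdiff_coeff q (k - m) j * (x * q ^ j) ^ m)"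
    using assms by (intro sum.mono_neutral_right) (auto simp: qdiff_coeff_eq_0[OF q])
  also have "\<dots> = (\<Sum>m\<le>k - j. qdiff_coeff q k j * ((\<Prod>i<m. - (q ^ i)) * qbinom q (k - j) m * (x * q ^ (2 * j)) ^ m))"
  proof (intro sum.cong refl)
    fix m assume "m \<in> {..k - j}"
    hence m: "m \<le> k - j" "j \<le> k - m" "m \<le> k" using assms by auto
    define K where "K = k - m - j"
    have k: "k = K + m + j" "k - m = K + j" "k - j = K + m" using m assms by (auto simp: K_def)
    have 1: "qbinom q (k - j) m = qpoch q q (K + m) / (qpoch q q m * qpoch q q K)"
      using qbinom_eq[OF q m(1)] nz by (simp add: k field_simps)
    have pow: "q ^ ((K + j) * j) = q ^ (K * j) * q ^ (j * j)" "q ^ ((K + m + j) * j) = q ^ (K * j) * q ^ (j * m) * q ^ (j * j)"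
      "(x * q ^ j) ^ m = x ^ m * q ^ (j * m)" "(x * q ^ (2 * j)) ^ m = x ^ m * (q ^ (j * m) * q ^ (j * m))"
    proof -
      show "q ^ ((K + j) * j) = q ^ (K * j) * q ^ (j * j)" "q ^ ((K + m + j) * j) = q ^ (K * j) * q ^ (j * m) * q ^ (j * j)"
        by (simp_all add: power_add[symmetric] algebra_simps)
      show "(x * q ^ j) ^ m = x ^ m * q ^ (j * m)" by (simp add: power_mult_distrib power_mult)
      have "(q ^ (2 * j)) ^ m = q ^ (j * m + j * m)" unfolding power_mult[symmetric] by (rule arg_cong[of _ _ "\<lambda>n. q ^ n"]) simp
      thus "(x * q ^ (2 * j)) ^ m = x ^ m * (q ^ (j * m) * q ^ (j * m))" by (simp add: power_mult_distrib power_add)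
    qed
    have 2: "qdiff_coeff q (k - m) j = q ^ j * (\<Prod>i<j. - (q ^ i)) / (qpoch q q j * qpoch q q K * (q ^ (K * j) * q ^ (j * j)))"
      using qdiff_coeff_eq[OF m(2)] by (simp only: k(2) pow diff_add_inverse2)
    have 3: "qdiff_coeff q k j = q ^ j * (\<Prod>i<j. - (q ^ i)) / (qpoch q q j * qpoch q q (K + m) * (q ^ (K * j) * q ^ (j * m) * q ^ (j * j)))"
      using qdiff_coeff_eq[OF assms] by (simp only: k(1) pow diff_add_inverse2)
    show "euler_coeff m * qdiff_coeff q (k - m) j * (x * q ^ j) ^ m
      = qdiff_coeff q k j * ((\<Prod>i<m. - (q ^ i)) * qbinom q (k - j) m * (x * q ^ (2 * j)) ^ m)"
      unfolding 1 2 3 euler_coeff_def pow using nz q by (simp add: field_simps)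
  qed
  also have "\<dots> = qdiff_coeff q k j * qpoch (x * q ^ (2 * j)) q (k - j)"
    unfolding finite_qbinomial[of "x * q ^ (2 * j)"] sum_distrib_left ..
  finally show ?thesis .
qed

text \<open>Drives the induction for \<open>q_Saalschuetz\<close>: the increment in \<open>k\<close>
  of the weight at \<open>Suc j\<close> is a multiple, independent of \<open>j\<close>, of the
  weight at \<open>j\<close> with \<open>a * q\<close> in place of \<open>a\<close>.\<close>

lemma qdiff_coeff_qpoch_diff:
  "qpoch q q (Suc k) * qdiff_coeff q (Suc k) (Suc j) * qpoch (a * q ^ Suc k) q (Suc j)
     = qpoch q q k * qdiff_coeff q k (Suc j) * qpoch (a * q ^ k) q (Suc j)
       - (1 - a * q ^ (2 * k + 1)) / q ^ k * (qpoch q q k * qdiff_coeff q k j * qpoch (a * q * q ^ k) q j)"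
proof -
  define x where "x = q ^ k"
  define y where "y = q ^ j"
  define Q where "Q = qpoch q q j"
  define A where "A = qpoch (1 / q ^ k) q j"
  define B where "B = qpoch (a * q * q ^ k) q j"
  have nz: "qpoch q q n \<noteq> 0" for n by (rule qpoch_q_nonzero[OF q(1)])
  have x: "x \<noteq> 0" using q by (simp add: x_def)
  have yq: "1 - y * q \<noteq> 0" using q_power_neq_1[OF q, of j] by (simp add: y_def mult.commute)
  have Q: "Q \<noteq> 0" unfolding Q_def by (rule nz)
  have c1: "qpoch q q (Suc k) * qdiff_coeff q (Suc k) (Suc j) = q * y * ((1 - 1 / (q * x)) * A) / (Q * (1 - y * q))"
    using nz[of "Suc k"] q by (simp add: qdiff_coeff_def qpoch_Suc_left[of "1 / _"] qpoch_Suc[of q q j] x_def y_def A_def Q_def mult_ac)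
  have c2: "qpoch q q k * qdiff_coeff q k (Suc j) = q * y * (A * (1 - y / x)) / (Q * (1 - y * q))"
    using nz[of k] by (simp add: qdiff_coeff_def qpoch_Suc[of _ q j] x_def y_def A_def Q_def mult_ac)
  have c3: "qpoch q q k * qdiff_coeff q k j = y * A / Q"
    using nz[of k] by (simp add: qdiff_coeff_def y_def A_def Q_def)
  have p1: "qpoch (a * q ^ Suc k) q (Suc j) = B * (1 - a * q * x * y)"
    by (simp add: qpoch_Suc B_def x_def y_def mult_ac)
  have p2: "qpoch (a * q ^ k) q (Suc j) = (1 - a * x) * B"
    by (simp add: qpoch_Suc_left B_def x_def mult_ac)
  have p4: "q ^ (2 * k + 1) = q * x ^ 2" by (simp add: x_def power_mult[symmetric] mult.commute)
  have "q * y * ((1 - 1 / (q * x)) * A) / (Q * (1 - y * q)) * (B * (1 - a * q * x * y))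
    - q * y * (A * (1 - y / x)) / (Q * (1 - y * q)) * ((1 - a * x) * B)
    = q * y * A * B / (Q * (1 - y * q)) * ((1 - 1 / (q * x)) * (1 - a * q * x * y) - (1 - y / x) * (1 - a * x))"
  proof -
    have "q * y * (u * A) / (Q * e) * (B * v) - q * y * (A * r) / (Q * e) * (w * B) = q * y * A * B / (Q * e) * (u * v - r * w)" for u v w r e
      by (simp add: algebra_simps diff_divide_distrib)
    thus ?thesis .
  qed
  also have "(1 - 1 / (q * x)) * (1 - a * q * x * y) - (1 - y / x) * (1 - a * x) = - (1 - y * q) * (1 - a * (q * x ^ 2)) / (q * x)"
    using x q by (simp add: field_simps power2_eq_square)
  also have "q * y * A * B / (Q * (1 - y * q)) * (- (1 - y * q) * (1 - a * (q * x ^ 2)) / (q * x))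
    = - ((1 - a * (q * x ^ 2)) / x * (y * A / Q * B))"
  proof -
    have "q * y * A * B / (Q * e) * (- e * w / (q * x)) = - (w / x * (y * A / Q * B))" if "e \<noteq> 0" for e w
      using that q x Q by (simp add: field_simps)
    from this[OF yq] show ?thesis .
  qed
  finally have fin: "q * y * ((1 - 1 / (q * x)) * A) / (Q * (1 - y * q)) * (B * (1 - a * q * x * y))
    - q * y * (A * (1 - y / x)) / (Q * (1 - y * q)) * ((1 - a * x) * B) = - ((1 - a * (q * x ^ 2)) / x * (y * A / Q * B))" .
  have "u = v - w" if "u - v = - w" for u v w :: complex
    using that by (simp add: diff_eq_eq)
  from this[OF fin] show ?thesis
    unfolding c1 c2 c3 p1 p2 p4 B_def[symmetric] unfolding x_def[symmetric] .
qed

text \<open>The sum is the balanced series with upper parameters \<open>1 / q ^ k\<close>,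
  \<open>a * q ^ k\<close> and \<open>q * a / (b * c)\<close>. Induction on \<open>k\<close> runs
  over all \<open>a\<close>, because the increment in \<open>k\<close> is the same sum at
  \<open>a * q\<close>.\<close>

lemma q_Saalschuetz:
  fixes a b c :: complex
  assumes "b \<noteq> 0" "c \<noteq> 0" "\<And>j. qpoch (q * a / b) q j \<noteq> 0" "\<And>j. qpoch (q * a / c) q j \<noteq> 0"
  shows "(\<Sum>j\<le>k. qpoch q q k * qdiff_coeff q k j * qpoch (a * q ^ k) q j * (qpoch (q * a / (b * c)) q j / (qpoch (q * a / b) q j * qpoch (q * a / c) q j)))
    = qpoch b q k * qpoch c q k * (q * a / (b * c)) ^ k / (qpoch (q * a / b) q k * qpoch (q * a / c) q k)"
  using assms(3,4)
proof (induction k arbitrary: a)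
  case 0
  show ?case by (simp add: qdiff_coeff_def)
next
  case (Suc k)
  define \<beta> \<gamma> e where "\<beta> = q * a / b" and "\<gamma> = q * a / c" and "e = q * a / (b * c)"
  define f where "f = (\<lambda>j. qpoch e q j / (qpoch \<beta> q j * qpoch \<gamma> q j))"
  define f' where "f' = (\<lambda>j. qpoch (e * q) q j / (qpoch (\<beta> * q) q j * qpoch (\<gamma> * q) q j))"
  have sh: "q * (a * q) / b = \<beta> * q" "q * (a * q) / c = \<gamma> * q" "q * (a * q) / (b * c) = e * q"
    by (auto simp: \<beta>_def \<gamma>_def e_def)
  have nz: "qpoch \<beta> q j \<noteq> 0" "qpoch \<gamma> q j \<noteq> 0" for j using Suc.prems by (auto simp: \<beta>_def \<gamma>_def)
  have nzs: "1 - \<beta> \<noteq> 0" "1 - \<gamma> \<noteq> 0" using nz[of "Suc 0"] by (auto simp: qpoch_Suc)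
  have nz': "qpoch (\<beta> * q) q j \<noteq> 0" "qpoch (\<gamma> * q) q j \<noteq> 0" for j
    using nz[of "Suc j"] by (auto simp: qpoch_Suc_left)
  have ff': "f (Suc j) = (1 - e) / ((1 - \<beta>) * (1 - \<gamma>)) * f' j" for j
    by (simp add: f_def f'_def qpoch_Suc_left)
  have IH1: "(\<Sum>j\<le>k. qpoch q q k * qdiff_coeff q k j * qpoch (a * q ^ k) q j * f j)
     = qpoch b q k * qpoch c q k * e ^ k / (qpoch \<beta> q k * qpoch \<gamma> q k)"
    unfolding f_def \<beta>_def \<gamma>_def e_def by (rule Suc.IH) (use Suc.prems in auto)
  have IH2: "(\<Sum>j\<le>k. qpoch q q k * qdiff_coeff q k j * qpoch (a * q * q ^ k) q j * f' j)
     = qpoch b q k * qpoch c q k * (e * q) ^ k / (qpoch (\<beta> * q) q k * qpoch (\<gamma> * q) q k)"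
    unfolding f'_def sh[symmetric] by (rule Suc.IH) (use nz' in \<open>auto simp: sh\<close>)
  define t where "t = (\<lambda>k a j. qpoch q q k * qdiff_coeff q k j * qpoch (a * q ^ k) q j)"
  define w where "w = (1 - a * q ^ (2 * k + 1)) / q ^ k"
  have tS: "t (Suc k) a (Suc j) = t k a (Suc j) - w * t k (a * q) j" for j
    unfolding t_def w_def by (rule qdiff_coeff_qpoch_diff)
  have t0: "t (Suc k) a 0 = t k a 0" using qpoch_q_nonzero[OF q(1)] by (simp add: t_def qdiff_coeff_def)
  have "(\<Sum>j\<le>Suc k. t (Suc k) a j * f j) = t k a 0 * f 0 + (\<Sum>j\<le>k. t k a (Suc j) * f (Suc j)) - w * (\<Sum>j\<le>k. t k (a * q) j * f (Suc j))"
    by (subst sum.atMost_Suc_shift) (simp add: t0 tS algebra_simps sum_subtractf sum_distrib_left)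
  also have "t k a 0 * f 0 + (\<Sum>j\<le>k. t k a (Suc j) * f (Suc j)) = (\<Sum>j\<le>Suc k. t k a j * f j)"
    by (subst sum.atMost_Suc_shift) simp
  also have "\<dots> = (\<Sum>j\<le>k. t k a j * f j)" by (simp add: t_def qdiff_coeff_eq_0[OF q])
  also have "(\<Sum>j\<le>k. t k (a * q) j * f (Suc j)) = (1 - e) / ((1 - \<beta>) * (1 - \<gamma>)) * (\<Sum>j\<le>k. t k (a * q) j * f' j)"
    unfolding ff' sum_distrib_left by (intro sum.cong) (auto simp: mult_ac)
  finally have "(\<Sum>j\<le>Suc k. t (Suc k) a j * f j) = qpoch b q k * qpoch c q k * e ^ k / (qpoch \<beta> q k * qpoch \<gamma> q k)
     - w * ((1 - e) / ((1 - \<beta>) * (1 - \<gamma>)) * (qpoch b q k * qpoch c q k * (e * q) ^ k / (qpoch (\<beta> * q) q k * qpoch (\<gamma> * q) q k)))"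
    unfolding t_def IH1 IH2 .
  also have "\<dots> = qpoch b q (Suc k) * qpoch c q (Suc k) * e ^ Suc k / (qpoch \<beta> q (Suc k) * qpoch \<gamma> q (Suc k))"
  proof -
    define x where "x = q ^ k"
    have x: "x \<noteq> 0" using q by (simp add: x_def)
    have k1: "(1 - \<beta>) * qpoch (\<beta> * q) q k = qpoch \<beta> q k * (1 - \<beta> * x)" "(1 - \<gamma>) * qpoch (\<gamma> * q) q k = qpoch \<gamma> q k * (1 - \<gamma> * x)"
      using qpoch_Suc[of \<beta> q k] qpoch_Suc_left[of \<beta> q k] qpoch_Suc[of \<gamma> q k] qpoch_Suc_left[of \<gamma> q k] by (simp_all add: x_def)
    have nzx: "1 - \<beta> * x \<noteq> 0" "1 - \<gamma> * x \<noteq> 0" using nz[of "Suc k"] by (auto simp: qpoch_Suc x_def)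
    have w: "w = (1 - a * q * x ^ 2) / x" by (simp add: w_def x_def power_mult[symmetric] mult_ac)
    define W where "W = qpoch b q k * qpoch c q k * e ^ k"
    have "w * ((1 - e) / ((1 - \<beta>) * (1 - \<gamma>)) * (qpoch b q k * qpoch c q k * (e * q) ^ k / (qpoch (\<beta> * q) q k * qpoch (\<gamma> * q) q k)))
      = (w * x) * (1 - e) * W / (((1 - \<beta>) * qpoch (\<beta> * q) q k) * ((1 - \<gamma>) * qpoch (\<gamma> * q) q k))"
      by (simp add: W_def x_def power_mult_distrib mult_ac)
    also have "\<dots> = (1 - a * q * x ^ 2) * (1 - e) * W / (qpoch \<beta> q k * (1 - \<beta> * x) * (qpoch \<gamma> q k * (1 - \<gamma> * x)))"
      unfolding k1 using x by (simp add: w)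
    also have "W / (qpoch \<beta> q k * qpoch \<gamma> q k) - \<dots>
      = W * ((1 - \<beta> * x) * (1 - \<gamma> * x) - (1 - a * q * x ^ 2) * (1 - e)) / (qpoch \<beta> q k * (1 - \<beta> * x) * (qpoch \<gamma> q k * (1 - \<gamma> * x)))"
    proof -
      have "W / (u * v) - p * W / (u * r * (v * s)) = W * (r * s - p) / (u * r * (v * s))"
        if "u \<noteq> 0" "v \<noteq> 0" "r \<noteq> 0" "s \<noteq> 0" for u v r s p
        using that by (simp add: field_simps)
      from this[OF nz(1)[of k] nz(2)[of k] nzx] show ?thesis .
    qed
    \<comment> \<open>The terms with \<open>a * q * e * x ^ 2\<close> cancel because
      \<open>\<beta> * \<gamma> = a * q * e\<close>; what is left has the factor
      \<open>e\<close>.\<close>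
    also have "(1 - \<beta> * x) * (1 - \<gamma> * x) - (1 - a * q * x ^ 2) * (1 - e) = (1 - b * x) * (1 - c * x) * e"
      unfolding \<beta>_def \<gamma>_def e_def using assms(1,2) by (simp add: field_simps power2_eq_square)
    finally show ?thesis by (simp add: W_def qpoch_Suc x_def mult_ac)
  qed
  finally show ?case by (simp only: t_def f_def \<beta>_def \<gamma>_def e_def)
qed

end

text \<open>Cauchy-type regrouping by \<open>n = k + m\<close>. Monotonicity of \<open>A\<close>
  weakens the majorant to \<open>A k * B m\<close>, so that the exchange for product majorants
  applies on both sides.\<close>

lemma suminf_diagonal:
  fixes F :: "nat \<Rightarrow> nat \<Rightarrow> complex" and A B :: "nat \<Rightarrow> real"
  assumes F: "\<And>k m. norm (F k m) \<le> A (k + m) * B m" and A: "summable A" "decseq A" "\<And>n. A n \<ge> 0"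
    and B: "summable B" "\<And>k. B k \<ge> 0"
  shows "(\<Sum>k. \<Sum>m. F k m) = (\<Sum>n. \<Sum>m\<le>n. F (n - m) m)"
proof -
  define g where "g = (\<lambda>n m. if m \<le> n then F (n - m) m else 0)"
  have g: "norm (g n m) \<le> A n * B m" for n m
    using F[of "n - m" m] A B by (auto simp: g_def)
  have F': "norm (F k m) \<le> A k * B m" for k m
    using decseqD[OF A(2), of k "k + m"] B(2)[of m] by (intro order_trans[OF F mult_right_mono]) auto
  have sg: "summable (\<lambda>n. g n m)" for m
    by (rule summable_norm_cancel, rule summable_comparison_test'[where g = "\<lambda>n. A n * B m"])
       (use g A in \<open>auto intro: summable_mult2\<close>)
  have "(\<Sum>k. \<Sum>m. F k m) = (\<Sum>m. \<Sum>k. F k m)"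
    by (rule suminf_swap_dominated[OF F' A(1,3) B])
  also have "\<dots> = (\<Sum>m. \<Sum>n. g n m)"
  proof (rule suminf_cong)
    fix m
    have "(\<Sum>n. g n m) = (\<Sum>n. g (n + m) m) + (\<Sum>n<m. g n m)"
      by (rule suminf_split_initial_segment[OF sg])
    thus "(\<Sum>k. F k m) = (\<Sum>n. g n m)" by (simp add: g_def)
  qed
  also have "\<dots> = (\<Sum>n. \<Sum>m. g n m)"
    by (rule suminf_swap_dominated[OF g A(1,3) B, symmetric])
  also have "\<dots> = (\<Sum>n. \<Sum>m\<le>n. F (n - m) m)"
  proof (rule suminf_cong)
    fix n
    have "(\<Sum>m. g n m) = (\<Sum>m\<le>n. g n m)" by (rule suminf_finite) (auto simp: g_def)
    thus "(\<Sum>m. g n m) = (\<Sum>m\<le>n. F (n - m) m)" by (simp add: g_def)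
  qed
  finally show ?thesis .
qed

definition cofactor :: "complex \<Rightarrow> complex \<Rightarrow> complex \<Rightarrow> complex \<Rightarrow> complex \<Rightarrow> complex \<Rightarrow> complex" where
  "cofactor q a b c d y = qpoch_inf (q * y / b) q * qpoch_inf (q * y / c) q * qpoch_inf (d * y / a) q
     / (qpoch_inf (q * y / (b * c)) q * qpoch_inf (y ^ 2 / a) q)"

context
  fixes q :: complex
  assumes q: "norm q < 1" "q \<noteq> 0"
begin

lemma qpoch_inf_shift: "qpoch_inf x q \<noteq> 0 \<Longrightarrow> qpoch_inf (x * q ^ j) q = qpoch_inf x q / qpoch x q j"
  using qpoch_inf_split[OF q(1), of x j] by auto

text \<open>At the points \<open>a * q ^ j\<close> the infinite products in \<open>\<Phi>\<close>
  are those at \<open>a\<close> divided by finite factorials. The double sum therefore reduces, via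
  \<open>euler_qdiff_convolution\<close>, to a q-Saalschuetz sum.\<close>

lemma qdiff_convolution:
  assumes a: "a \<noteq> 0" "qpoch_inf a q \<noteq> 0" and b: "b \<noteq> 0" "qpoch_inf (q * a / b) q \<noteq> 0" and c: "c \<noteq> 0" "qpoch_inf (q * a / c) q \<noteq> 0"
    and e: "qpoch_inf (q * a / (b * c)) q \<noteq> 0"
  defines "\<Phi> \<equiv> \<lambda>y. qpoch_inf (q * y / b) q * qpoch_inf (q * y / c) q / (qpoch_inf (q * y / (b * c)) q * qpoch_inf (y ^ 2 / a) q)"
  shows "(\<Sum>m\<le>k. euler_coeff q m * qdiff q a (k - m) (\<lambda>y. y ^ m * \<Phi> y))
    = qpoch_inf (q * a / b) q * qpoch_inf (q * a / c) q / (qpoch_inf (q * a / (b * c)) q * qpoch_inf a q)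
      * (qpochs [a, b, c] q k / qpochs [q, q * a / b, q * a / c] q k * (q * a / (b * c)) ^ k)"
proof -
  define \<beta> \<gamma> \<epsilon> where "\<beta> = q * a / b" and "\<gamma> = q * a / c" and "\<epsilon> = q * a / (b * c)"
  note folds = \<beta>_def[symmetric] \<gamma>_def[symmetric] \<epsilon>_def[symmetric]
  define C where "C = qpoch_inf \<beta> q * qpoch_inf \<gamma> q / (qpoch_inf \<epsilon> q * qpoch_inf a q)"
  have inf_nz: "qpoch_inf \<beta> q \<noteq> 0" "qpoch_inf \<gamma> q \<noteq> 0" "qpoch_inf \<epsilon> q \<noteq> 0" using b c e by (auto simp: \<beta>_def \<gamma>_def \<epsilon>_def)
  have nz: "qpoch \<beta> q j \<noteq> 0" "qpoch \<gamma> q j \<noteq> 0" "qpoch \<epsilon> q j \<noteq> 0" "qpoch a q j \<noteq> 0" "qpoch q q j \<noteq> 0" for j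
    using qpoch_nonzero_if_inf[OF q(1)] inf_nz a qpoch_q_nonzero[OF q(1)] by auto
  have "(\<Sum>m\<le>k. euler_coeff q m * qdiff q a (k - m) (\<lambda>y. y ^ m * \<Phi> y))
    = (\<Sum>m\<le>k. euler_coeff q m * (\<Sum>j\<le>k. qdiff_coeff q (k - m) j * ((a * q ^ j) ^ m * \<Phi> (a * q ^ j))))"
    unfolding qdiff_def by (intro sum.cong refl arg_cong2[of _ _ _ _ "(*)"] sum.mono_neutral_left) (auto simp: qdiff_coeff_eq_0[OF q])
  also have "\<dots> = (\<Sum>j\<le>k. \<Phi> (a * q ^ j) * (\<Sum>m\<le>k. euler_coeff q m * qdiff_coeff q (k - m) j * (a * q ^ j) ^ m))"
    unfolding sum_distrib_left by (subst sum.swap) (simp add: mult_ac)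
  also have "\<dots> = (\<Sum>j\<le>k. C * (qpoch a q k / qpoch q q k) * (qpoch q q k * qdiff_coeff q k j * qpoch (a * q ^ k) q j * (qpoch \<epsilon> q j / (qpoch \<beta> q j * qpoch \<gamma> q j))))"
  proof (intro sum.cong refl)
    fix j assume "j \<in> {..k}"
    hence j: "j \<le> k" by simp
    have sq: "(a * q ^ j) ^ 2 / a = a * q ^ (2 * j)"
      using a by (simp add: power2_eq_square power_mult[symmetric] mult_2 power_add)
    have arg: "q * (a * q ^ j) / b = \<beta> * q ^ j" "q * (a * q ^ j) / c = \<gamma> * q ^ j" "q * (a * q ^ j) / (b * c) = \<epsilon> * q ^ j"
      by (simp_all add: \<beta>_def \<gamma>_def \<epsilon>_def)
    have \<Phi>: "\<Phi> (a * q ^ j) = C * (qpoch \<epsilon> q j * qpoch a q (2 * j) / (qpoch \<beta> q j * qpoch \<gamma> q j))"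
      unfolding \<Phi>_def sq arg C_def using nz inf_nz a by (simp add: qpoch_inf_shift)
    \<comment> \<open>Both factorials combine to length \<open>k + j\<close>, which is then split at
      \<open>k\<close> to expose the parameter \<open>a * q ^ k\<close>.\<close>
    have "qpoch a q (2 * j) * qpoch (a * q ^ (2 * j)) q (k - j) = qpoch a q (k + j)"
      using j qpoch_add[of a q "2 * j" "k - j"] by (simp add: add.commute)
    also have "\<dots> = qpoch a q k * qpoch (a * q ^ k) q j" by (rule qpoch_add)
    finally have 2: "qpoch a q (2 * j) * qpoch (a * q ^ (2 * j)) q (k - j) = qpoch a q k * qpoch (a * q ^ k) q j" .
    have "\<Phi> (a * q ^ j) * (\<Sum>m\<le>k. euler_coeff q m * qdiff_coeff q (k - m) j * (a * q ^ j) ^ m)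
      = C * qdiff_coeff q k j * (qpoch \<epsilon> q j / (qpoch \<beta> q j * qpoch \<gamma> q j)) * (qpoch a q (2 * j) * qpoch (a * q ^ (2 * j)) q (k - j))"
      unfolding euler_qdiff_convolution[OF q j] \<Phi> by (simp add: mult_ac)
    also have "\<dots> = C * (qpoch a q k / qpoch q q k) * (qpoch q q k * qdiff_coeff q k j * qpoch (a * q ^ k) q j * (qpoch \<epsilon> q j / (qpoch \<beta> q j * qpoch \<gamma> q j)))"
      unfolding 2 using nz(5)[of k] by simp
    finally show "\<Phi> (a * q ^ j) * (\<Sum>m\<le>k. euler_coeff q m * qdiff_coeff q (k - m) j * (a * q ^ j) ^ m) = \<dots>" .
  qed
  also have "\<dots> = C * (qpoch a q k / qpoch q q k) * (qpoch b q k * qpoch c q k * \<epsilon> ^ k / (qpoch \<beta> q k * qpoch \<gamma> q k))"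
    unfolding sum_distrib_left[symmetric] \<beta>_def \<gamma>_def \<epsilon>_def
    by (subst q_Saalschuetz[OF q b(1) c(1)]) (use nz in \<open>auto simp: \<beta>_def \<gamma>_def\<close>)
  finally show ?thesis unfolding folds C_def by (simp add: mult_ac)
qed

text \<open>Euler's expansion of \<open>qpoch_inf (d * y / a) q\<close> contributes
  \<open>(d / a) ^ m\<close> next to the outer \<open>(d / a) ^ k\<close>. Collecting by
  \<open>n = k + m\<close> leaves the convolution already summed. The bounds on \<open>R\<close>
  keep both denominators of \<open>cofactor\<close> nonzero on the disc.\<close>

lemma qdiff_series_eq_3phi2:
  assumes a: "a \<noteq> 0" and b: "b \<noteq> 0" "qpoch_inf (q * a / b) q \<noteq> 0" and c: "c \<noteq> 0" "qpoch_inf (q * a / c) q \<noteq> 0"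
    and d: "norm d < norm a" and R: "norm a < R" "R \<le> norm (b * c / q)" "R ^ 2 \<le> norm a"
  shows "(\<Sum>k. (d / a) ^ k * qdiff q a k (cofactor q a b c d))
    = qpoch_inf (q * a / b) q * qpoch_inf (q * a / c) q / (qpoch_inf (q * a / (b * c)) q * qpoch_inf a q)
      * qphi [a, b, c] [q * a / b, q * a / c] q (q * d / (b * c))"
proof -
  define \<Phi> where "\<Phi> = (\<lambda>y. qpoch_inf (q * y / b) q * qpoch_inf (q * y / c) q / (qpoch_inf (q * y / (b * c)) q * qpoch_inf (y ^ 2 / a) q))"
  define C where "C = qpoch_inf (q * a / b) q * qpoch_inf (q * a / c) q / (qpoch_inf (q * a / (b * c)) q * qpoch_inf a q)"
  have Rpos: "R > 0" using R norm_ge_zero[of a] by linarith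
  have den: "qpoch_inf (q * y / (b * c)) q \<noteq> 0" "qpoch_inf (y ^ 2 / a) q \<noteq> 0" if y: "norm y < R" for y
  proof -
    have "norm y < norm (b * c / q)" using R y by simp
    hence "norm (q * y / (b * c)) < 1" using q b c by (simp add: norm_mult norm_divide field_simps)
    thus "qpoch_inf (q * y / (b * c)) q \<noteq> 0" by (rule qpoch_inf_nonzero[OF q(1)])
    have "norm y ^ 2 < R ^ 2" using y by (intro power_strict_mono) auto
    hence "norm (y ^ 2 / a) < 1" using R a by (simp add: norm_power norm_divide)
    thus "qpoch_inf (y ^ 2 / a) q \<noteq> 0" by (rule qpoch_inf_nonzero[OF q(1)])
  qed
  have "\<Phi> holomorphic_on ball 0 R"
    unfolding \<Phi>_def using den a b c q by (intro holomorphic_intros) auto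
  then obtain D where D: "D \<ge> 0" "\<And>k m. norm (qdiff q a k (\<lambda>y. y ^ m * \<Phi> y)) \<le> D * norm a ^ m"
    using qdiff_monom_bound[OF q _ R(1)] by blast
  have a1: "qpoch_inf a q \<noteq> 0" using den(2)[OF R(1)] a by (simp add: power2_eq_square)
  have e: "qpoch_inf (q * a / (b * c)) q \<noteq> 0" by (rule den(1)[OF R(1)])
  define x where "x = d / a"
  have x: "norm x < 1" using d a by (simp add: x_def norm_divide)
  define F where "F = (\<lambda>k m. x ^ (k + m) * (euler_coeff q m * qdiff q a k (\<lambda>y. y ^ m * \<Phi> y)))"
  have F: "norm (F k m) \<le> norm x ^ (k + m) * (norm (euler_coeff q m * a ^ m) * D)" for k m
    unfolding F_def norm_mult norm_power mult.assoc using D(2)[of k m]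
    by (intro mult_left_mono) (auto simp: mult.commute)
  have "(\<Sum>k. (d / a) ^ k * qdiff q a k (cofactor q a b c d)) = (\<Sum>k. \<Sum>m. F k m)"
  proof (rule suminf_cong)
    fix k
    have "(\<lambda>m. \<Sum>j\<le>k. qdiff_coeff q k j * (euler_coeff q m * (x * (a * q ^ j)) ^ m * \<Phi> (a * q ^ j)))
      sums (\<Sum>j\<le>k. qdiff_coeff q k j * (qpoch_inf (x * (a * q ^ j)) q * \<Phi> (a * q ^ j)))"
      by (intro sums_sum sums_mult sums_mult2 euler_expansion[OF q])
    also have "(\<Sum>j\<le>k. qdiff_coeff q k j * (qpoch_inf (x * (a * q ^ j)) q * \<Phi> (a * q ^ j)))
      = qdiff q a k (cofactor q a b c d)"
      unfolding qdiff_def \<Phi>_def x_def cofactor_def by (simp add: mult_ac)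
    also have "(\<lambda>m. \<Sum>j\<le>k. qdiff_coeff q k j * (euler_coeff q m * (x * (a * q ^ j)) ^ m * \<Phi> (a * q ^ j)))
      = (\<lambda>m. x ^ m * (euler_coeff q m * qdiff q a k (\<lambda>y. y ^ m * \<Phi> y)))"
      unfolding qdiff_def sum_distrib_left by (intro ext sum.cong) (auto simp: power_mult_distrib mult_ac)
    finally have "(\<lambda>m. x ^ k * (x ^ m * (euler_coeff q m * qdiff q a k (\<lambda>y. y ^ m * \<Phi> y)))) sums
       (x ^ k * qdiff q a k (cofactor q a b c d))"
      by (rule sums_mult)
    thus "(d / a) ^ k * qdiff q a k (cofactor q a b c d) = (\<Sum>m. F k m)"
      by (simp add: sums_iff F_def x_def power_add mult_ac)
  qed
  also have "\<dots> = (\<Sum>n. \<Sum>m\<le>n. F (n - m) m)"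
  proof (rule suminf_diagonal[where A = "\<lambda>n. norm x ^ n" and B = "\<lambda>m. norm (euler_coeff q m * a ^ m) * D"])
    show "decseq (\<lambda>n. norm x ^ n)" using x by (intro decseq_SucI) (auto intro: mult_left_le_one_le)
  qed (use F x D(1) euler_coeff_summable[OF q] in \<open>auto intro: summable_mult2\<close>)
  also have "\<dots> = (\<Sum>n. C * (qpochs [a, b, c] q n / qpochs (q # [q * a / b, q * a / c]) q n * (q * d / (b * c)) ^ n))"
  proof (rule suminf_cong)
    fix n
    have "(\<Sum>m\<le>n. F (n - m) m) = x ^ n * (\<Sum>m\<le>n. euler_coeff q m * qdiff q a (n - m) (\<lambda>y. y ^ m * \<Phi> y))"
      unfolding sum_distrib_left F_def by (intro sum.cong) auto
    also have "\<dots> = C * (qpochs [a, b, c] q n / qpochs (q # [q * a / b, q * a / c]) q n * (x ^ n * (q * a / (b * c)) ^ n))"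
      unfolding \<Phi>_def C_def qdiff_convolution[OF a a1 b c e] by (simp add: mult_ac)
    also have "x ^ n * (q * a / (b * c)) ^ n = (q * d / (b * c)) ^ n"
      unfolding power_mult_distrib[symmetric] using a by (simp add: x_def mult_ac)
    finally show "(\<Sum>m\<le>n. F (n - m) m) = C * (qpochs [a, b, c] q n / qpochs (q # [q * a / b, q * a / c]) q n * (q * d / (b * c)) ^ n)" .
  qed
  also have "\<dots> = C * qphi [a, b, c] [q * a / b, q * a / c] q (q * d / (b * c))"
    unfolding qphi_def
  proof (rule suminf_mult, rule summable_norm_cancel, rule summable_qphi[OF q(1)])
    have "norm d * norm q < norm (b * c)"
    proof -
      have "norm d < norm (b * c / q)" using d R by simp
      thus ?thesis using q by (simp add: norm_divide field_simps)
    qed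
    thus "norm (q * d / (b * c)) < 1" using b c by (simp add: norm_mult norm_divide field_simps)
  qed (use b c in auto)
  finally show ?thesis by (simp add: C_def)
qed

end

section \<open>Residues outside the circle\<close>

context
  fixes q :: complex
  assumes q: "norm q < 1" "q \<noteq> 0"
begin

text \<open>The relation between \<open>f (y / q)\<close> and \<open>f y\<close> does two things: it
  generates all residues from those at the base points in \<open>B\<close>, and, as
  \<open>\<psi>\<close> tends to \<open>q\<close>, it makes the integrals over growing circles
  vanish.\<close>

lemma outer_residues:
  fixes f \<psi> c :: "complex \<Rightarrow> complex" and B :: "complex set"
  defines "poles \<equiv> {p / q ^ k |p k. p \<in> B}"
  assumes l: "0 \<le> l" "l < \<rho>" and B: "finite B" "\<And>p. p \<in> B \<Longrightarrow> \<rho> < norm p"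
    and inj: "\<And>p p' k k'. p \<in> B \<Longrightarrow> p' \<in> B \<Longrightarrow> p / q ^ k = p' / q ^ k' \<Longrightarrow> p = p'"
    and f: "f holomorphic_on {y. l < norm y} - poles"
    and c: "\<And>p. p \<in> B \<Longrightarrow> ((\<lambda>y. (y - p) * f y) \<longlongrightarrow> c p) (at p)"
    and fun_eq: "\<And>y. l < norm y \<Longrightarrow> y \<notin> poles \<Longrightarrow> y / q \<notin> poles \<Longrightarrow> f (y / q) = q * \<psi> y * f y"
    and \<psi>: "\<And>y. y \<in> poles \<Longrightarrow> isCont \<psi> y" "(\<psi> \<longlongrightarrow> q) at_infinity"
  shows "contour_integral (circlepath 0 \<rho>) f = - (2 * pi * \<i> * (\<Sum>p\<in>B. \<Sum>k. c p * (\<Prod>i<k. \<psi> (p / q ^ i))))"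
proof -
  define C where "C = (\<lambda>p k. c p * (\<Prod>i<k. \<psi> (p / q ^ i)))"
  have \<rho>: "\<rho> > 0" using l by linarith
  have B0: "p \<noteq> 0" if "p \<in> B" for p using B(2)[OF that] \<rho> by auto
  have nq: "norm q > 0" using q by simp
  have grow: "norm p \<le> norm (p / q ^ k)" for p k
  proof -
    have "norm p * norm q ^ k \<le> norm p * 1" using q by (intro mult_left_mono power_le_one) auto
    thus ?thesis using nq by (simp add: norm_divide norm_power field_simps)
  qed
  have poles_gt: "\<rho> < norm x" if "x \<in> poles" for x
    using that B(2) grow unfolding poles_def by (fastforce intro: less_le_trans)
  have fin_k: "finite {k. norm p / norm q ^ k < R}" if "p \<in> B" for p R
  proof -
    have "(\<lambda>k. R * norm q ^ k) \<longlonglongrightarrow> R * 0" using q by (intro tendsto_intros LIMSEQ_power_zero) auto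
    moreover have "R * 0 < norm p" using B0[OF that] by simp
    ultimately have "eventually (\<lambda>k. R * norm q ^ k < norm p) sequentially" by (metis order_tendstoD(2))
    then obtain K where K: "\<And>k. k \<ge> K \<Longrightarrow> R * norm q ^ k < norm p" by (auto simp: eventually_sequentially)
    have "{k. norm p / norm q ^ k < R} \<subseteq> {..<K}"
    proof
      fix k assume "k \<in> {k. norm p / norm q ^ k < R}"
      hence "norm p < R * norm q ^ k" using nq by (simp add: field_simps)
      thus "k \<in> {..<K}" using K[of k] by (auto simp: not_le[symmetric])
    qed
    thus ?thesis using finite_subset by blast
  qed
  define J where "J = (\<lambda>R. SIGMA p:B. {k. norm p / norm q ^ k < R})"
  define P where "P = (\<lambda>R. poles \<inter> ball 0 R)"
  have PJ: "P R = (\<lambda>(p, k). p / q ^ k) ` J R" for R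
    by (auto simp: P_def J_def poles_def norm_divide norm_power image_iff)
  have finJ: "finite (J R)" for R unfolding J_def using B(1) fin_k by auto
  have finP: "finite (P R)" for R unfolding PJ using finJ by simp
  have inj2: "p = p' \<and> k = k'" if "p \<in> B" "p' \<in> B" "p / q ^ k = p' / q ^ k'" for p p' k k'
  proof -
    have pp: "p = p'" by (rule inj[OF that])
    hence "norm q ^ k = norm q ^ k'" using that B0[OF that(1)] nq by (auto simp: field_simps norm_power[symmetric])
    hence "k = k'" using q nq by (auto simp: power_inject_exp')
    with pp show ?thesis by simp
  qed
  have injJ: "inj_on (\<lambda>(p, k). p / q ^ k) (J R)" for R
    unfolding inj_on_def J_def using inj2 by auto
  have evp: "\<forall>\<^sub>F y in at x. y \<notin> poles" for x
  proof -
    have "open (ball 0 (norm x + 1) - (P (norm x + 1) - {x}))"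
      using finP by (intro open_Diff finite_imp_closed) auto
    hence "\<forall>\<^sub>F y in at x. y \<in> ball 0 (norm x + 1) - (P (norm x + 1) - {x}) - {x}"
      by (rule eventually_at_in_open) auto
    thus ?thesis by eventually_elim (auto simp: P_def)
  qed
  \<comment> \<open>The factor \<open>q\<close> in \<open>fun_eq\<close> cancels the Jacobian of the
    substitution \<open>y / q\<close>, so passing to the next pole multiplies the residue by
    \<open>\<psi>\<close> exactly.\<close>
  have res: "((\<lambda>y. (y - p / q ^ k) * f y) \<longlongrightarrow> C p k) (at (p / q ^ k))" if p: "p \<in> B" for p k
  proof (induction k)
    case 0
    thus ?case using c[OF p] by (simp add: C_def)
  next
    case (Suc k)
    define x where "x = p / q ^ k"
    have xp: "x \<in> poles" using p by (auto simp: x_def poles_def)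
    have "((\<lambda>y. \<psi> y * ((y - x) * f y)) \<longlongrightarrow> \<psi> x * C p k) (at x)"
      using Suc \<psi>(1)[OF xp] unfolding x_def[symmetric] isCont_def by (intro tendsto_mult)
    hence "((\<lambda>y. (y / q - x / q) * f (y / q)) \<longlongrightarrow> \<psi> x * C p k) (at x)"
    proof (rule Lim_transform_eventually)
      have "filterlim (\<lambda>y. y / q) (at (x / q)) (at x)"
        unfolding filterlim_at
        using q by (auto intro!: tendsto_intros simp: eventually_at_filter field_simps)
      hence "\<forall>\<^sub>F y in at x. y / q \<notin> poles" using evp[of "x / q"] by (auto simp: filterlim_iff)
      moreover have "\<forall>\<^sub>F y in at x. y \<in> {y. l < norm y} - {x}"
        using poles_gt[OF xp] l by (intro eventually_at_in_open open_Collect_less continuous_intros) auto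
      ultimately show "\<forall>\<^sub>F y in at x. \<psi> y * ((y - x) * f y) = (y / q - x / q) * f (y / q)"
        using evp[of x]
      proof eventually_elim
        case (elim y)
        thus ?case using fun_eq[of y] q by (simp add: field_simps)
      qed
    qed
    moreover have "filterlim (\<lambda>y. y * q) (at x) (at (x / q))"
      unfolding filterlim_at using q by (auto intro!: tendsto_eq_intros simp: eventually_at_filter field_simps)
    ultimately have "((\<lambda>y. (y * q / q - x / q) * f (y * q / q)) \<longlongrightarrow> \<psi> x * C p k) (at (x / q))"
      by (rule filterlim_compose)
    thus ?case using q by (simp add: x_def C_def mult_ac)
  qed
  \<comment> \<open>Any number strictly between \<open>norm q\<close> and 1: it eventually bounds
    \<open>\<psi>\<close> and serves both the ratio test for the residues and the decay on the
    circles.\<close>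
  define \<kappa> where "\<kappa> = (1 + norm q) / 2"
  have \<kappa>: "norm q < \<kappa>" "\<kappa> < 1" "\<kappa> > 0" using q(1) norm_ge_zero[of q] unfolding \<kappa>_def by (simp_all add: add_pos_nonneg)
  have "\<forall>\<^sub>F y in at_infinity. norm (\<psi> y) < \<kappa>"
    using tendsto_norm[OF \<psi>(2)] \<kappa>(1) by (rule order_tendstoD(2))
  then obtain Y where Y: "\<And>y. norm y \<ge> Y \<Longrightarrow> norm (\<psi> y) < \<kappa>" by (auto simp: eventually_at_infinity)
  have sumC: "summable (\<lambda>k. norm (C p k))" if p: "p \<in> B" for p
  proof -
    define K where "K = Max (insert 0 {k. norm p / norm q ^ k < Y})"
    have K: "norm p / norm q ^ k \<ge> Y" if "k \<ge> Suc K" for k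
    proof (rule ccontr)
      assume "\<not> ?thesis"
      hence "k \<le> K" unfolding K_def using fin_k[OF p, of Y] by (intro Max_ge) auto
      thus False using that by simp
    qed
    show ?thesis
    proof (rule summable_ratio_test[of \<kappa> "Suc K"])
      fix k assume "k \<ge> Suc K"
      hence "norm (\<psi> (p / q ^ k)) \<le> \<kappa>" using Y[of "p / q ^ k"] K[of k] by (simp add: norm_divide norm_power)
      hence "norm (C p k) * norm (\<psi> (p / q ^ k)) \<le> norm (C p k) * \<kappa>" by (rule mult_left_mono) auto
      thus "norm (norm (C p (Suc k))) \<le> \<kappa> * norm (norm (C p k))"
        by (simp add: C_def norm_mult mult_ac)
    qed (use \<kappa> in auto)
  qed
  define m where "m = max \<rho> Y"
  \<comment> \<open>The radii \<open>R0 / norm q ^ N\<close> must avoid the moduli of all poles,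
    which excludes only countably many \<open>R0\<close>. Beyond \<open>m\<close> the bound on
    \<open>\<psi>\<close> holds, and dividing by \<open>q\<close> maps each circle to the
    next.\<close>
  have "uncountable {m<..<m + 1}" by (simp add: uncountable_open_interval)
  moreover have "countable (\<Union>p\<in>B. \<Union>k. range (\<lambda>n. norm p / norm q ^ k * norm q ^ n))"
    using B(1) by (intro countable_UN) (auto intro: countable_finite)
  ultimately obtain R0 where R0: "m < R0" "R0 \<notin> (\<Union>p\<in>B. \<Union>k. range (\<lambda>n. norm p / norm q ^ k * norm q ^ n))"
    by (metis countable_subset greaterThanLessThan_iff subsetI)
  define R where "R = (\<lambda>N. R0 / norm q ^ N)"
  have R0pos: "R0 > 0" using R0 \<rho> by (simp add: m_def)
  have R_ge: "R N \<ge> R0" for N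
  proof -
    have "R0 * norm q ^ N \<le> R0 * 1" using q R0pos by (intro mult_left_mono power_le_one) auto
    thus ?thesis using nq by (simp add: R_def field_simps)
  qed
  have Rpos: "R N > 0" for N using R_ge[of N] R0pos by linarith
  have R\<rho>: "\<rho> < R N" "Y < R N" "l < R N" for N using R_ge[of N] R0(1) l by (auto simp: m_def)
  have R_poles: "norm x \<noteq> R N" if "x \<in> poles" for x N
  proof
    assume x: "norm x = R N"
    obtain p k where pk: "p \<in> B" "x = p / q ^ k" using \<open>x \<in> poles\<close> by (auto simp: poles_def)
    hence "R0 = norm p / norm q ^ k * norm q ^ N" using x nq by (simp add: R_def norm_divide norm_power field_simps)
    thus False using R0(2) pk(1) by blast
  qed
  have int: "contour_integral (circlepath 0 (R N)) f - contour_integral (circlepath 0 \<rho>) f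
      = 2 * pi * \<i> * (\<Sum>p\<in>B. \<Sum>k\<in>{k. norm p / norm q ^ k < R N}. C p k)" for N
  proof -
    \<comment> \<open>\<open>u\<close> is at most the modulus of any pole beyond the circle; the
      \<open>R N + 1\<close> covers the case that no pole is near. Below \<open>u\<close> only the
      poles in \<open>P (R N)\<close> occur.\<close>
    define u where "u = Min (insert (R N + 1) (norm ` {x\<in>P (R N + 1). R N < norm x}))"
    have u: "R N < u" unfolding u_def using finP by (subst Min_gr_iff) auto
    have u1: "u \<le> R N + 1" unfolding u_def using finP by (intro Min_le) auto
    have nou: "norm x \<ge> u" if "x \<in> poles" "R N < norm x" for x
    proof (cases "norm x < R N + 1")
      case True
      hence "norm x \<in> insert (R N + 1) (norm ` {x\<in>P (R N + 1). R N < norm x})" using that by (auto simp: P_def)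
      thus ?thesis unfolding u_def using finP by (intro Min_le) auto
    qed (use u1 in auto)
    \<comment> \<open>Residues are indexed by pairs \<open>(p, k)\<close>; the inverse of the
      injective pole map recovers the pair from the pole.\<close>
    define cc where "cc = (\<lambda>x. C (fst (inv_into (J (R N)) (\<lambda>(p, k). p / q ^ k) x)) (snd (inv_into (J (R N)) (\<lambda>(p, k). p / q ^ k) x)))"
    have cc: "cc (p / q ^ k) = C p k" if "(p, k) \<in> J (R N)" for p k
      using inv_into_f_f[OF injJ that] by (simp add: cc_def)
    have "contour_integral (circlepath 0 (R N)) f - contour_integral (circlepath 0 \<rho>) f = 2 * pi * \<i> * (\<Sum>x\<in>P (R N). cc x)"
    proof (rule annulus_residues[where l = l and u = u])
      show "f holomorphic_on {y. l < norm y \<and> norm y < u} - P (R N)"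
      proof (rule holomorphic_on_subset[OF f], intro subsetI)
        fix y assume y: "y \<in> {y. l < norm y \<and> norm y < u} - P (R N)"
        have "y \<notin> poles"
        proof
          assume yp: "y \<in> poles"
          hence "R N \<le> norm y" using y by (auto simp: P_def not_less)
          hence "R N < norm y" using R_poles[OF yp, of N] by simp
          thus False using nou[OF yp] y by auto
        qed
        thus "y \<in> {y. l < norm y} - poles" using y by auto
      qed
      show "((\<lambda>y. (y - x) * f y) \<longlongrightarrow> cc x) (at x)" if xP: "x \<in> P (R N)" for x
      proof -
        obtain p k where "(p, k) \<in> J (R N)" "x = p / q ^ k" using xP unfolding PJ by auto
        thus ?thesis using cc res[of p k] by (auto simp: J_def)
      qed
    qed (use l R\<rho>[of N] u finP poles_gt in \<open>auto simp: P_def\<close>)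
    also have "(\<Sum>x\<in>P (R N). cc x) = (\<Sum>(p, k)\<in>J (R N). C p k)"
      unfolding PJ by (subst sum.reindex[OF injJ]) (auto intro!: sum.cong cc)
    also have "\<dots> = (\<Sum>p\<in>B. \<Sum>k\<in>{k. norm p / norm q ^ k < R N}. C p k)"
      unfolding J_def using B(1) fin_k by (subst sum.Sigma) auto
    finally show ?thesis .
  qed
  \<comment> \<open>The truncated index sets exhaust the naturals, so absolute summability gives the
    limit along finite subsets without computing their largest element.\<close>
  have lim1: "(\<lambda>N. \<Sum>k\<in>{k. norm p / norm q ^ k < R N}. C p k) \<longlonglongrightarrow> (\<Sum>k. C p k)" if p: "p \<in> B" for p
  proof -
    have "(C p has_sum (\<Sum>k. C p k)) UNIV"
      using sumC[OF p] by (intro norm_summable_imp_has_sum) (auto intro: summable_sums summable_norm_cancel)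
    moreover have "filterlim (\<lambda>N. {k. norm p / norm q ^ k < R N}) (finite_subsets_at_top UNIV) sequentially"
      unfolding filterlim_finite_subsets_at_top
    proof (intro allI impI)
      fix X :: "nat set" assume X: "finite X \<and> X \<subseteq> UNIV"
      have "\<forall>\<^sub>F N in sequentially. norm p / norm q ^ k < R N" for k
      proof -
        have "(\<lambda>N. norm p / norm q ^ k * norm q ^ N) \<longlonglongrightarrow> norm p / norm q ^ k * 0"
          using q by (intro tendsto_intros LIMSEQ_power_zero) auto
        moreover have "norm p / norm q ^ k * 0 < R0" using R0pos by simp
        ultimately have "\<forall>\<^sub>F N in sequentially. norm p / norm q ^ k * norm q ^ N < R0" by (metis order_tendstoD(2))
        thus ?thesis by eventually_elim (use nq in \<open>simp add: R_def field_simps\<close>)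
      qed
      hence "\<forall>\<^sub>F N in sequentially. \<forall>k\<in>X. norm p / norm q ^ k < R N" using X by (simp add: eventually_ball_finite)
      thus "\<forall>\<^sub>F N in sequentially. finite {k. norm p / norm q ^ k < R N} \<and> X \<subseteq> {k. norm p / norm q ^ k < R N}
          \<and> {k. norm p / norm q ^ k < R N} \<subseteq> UNIV"
        by eventually_elim (use fin_k[OF p] in auto)
    qed
    ultimately show ?thesis unfolding has_sum_def by (rule filterlim_compose)
  qed
  have integrable: "f contour_integrable_on circlepath 0 (R N)" for N
    by (rule circle_integrable[OF f]) (use R_poles R\<rho>(3)[of N] Rpos in auto)
  have im: "{y. norm y = R N} \<subseteq> {y. l < norm y} - poles" for N using R_poles R\<rho>(3)[of N] by auto
  obtain M where M0: "M \<ge> 0" and M: "\<And>y. norm y = R 0 \<Longrightarrow> norm (f y) \<le> M"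
    using circle_bounded[OF f im[of 0] Rpos[of 0]] by metis
  \<comment> \<open>Each step outwards gains \<open>norm q * \<kappa>\<close> while the circle
    lengthens by \<open>1 / norm q\<close>, so the integral is of order
    \<open>\<kappa> ^ N\<close>.\<close>
  have bound: "norm (f y) \<le> M * (norm q * \<kappa>) ^ N" if "norm y = R N" for y N
    using that
  proof (induction N arbitrary: y)
    case (Suc N)
    define y' where "y' = y * q"
    have y': "norm y' = R N" using Suc.prems nq by (simp add: y'_def norm_mult R_def field_simps)
    have yy: "y = y' / q" using q by (simp add: y'_def)
    have "f y = q * \<psi> y' * f y'"
      unfolding yy using y' R\<rho>(3)[of N] R_poles Suc.prems yy by (intro fun_eq) auto
    also have "norm \<dots> \<le> norm q * \<kappa> * (M * (norm q * \<kappa>) ^ N)"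
      unfolding norm_mult using Y[of y'] R\<rho>(2)[of N] y' Suc.IH[OF y'] \<kappa> by (intro mult_mono) auto
    finally show ?case by (simp add: mult_ac)
  qed (use M in auto)
  have "(\<lambda>N. contour_integral (circlepath 0 (R N)) f) \<longlonglongrightarrow> 0"
  proof (rule Lim_null_comparison)
    show "\<forall>\<^sub>F N in sequentially. norm (contour_integral (circlepath 0 (R N)) f) \<le> M * (2 * pi * R0) * \<kappa> ^ N"
    proof (intro always_eventually allI)
      fix N
      have "norm (contour_integral (circlepath 0 (R N)) f) \<le> M * (norm q * \<kappa>) ^ N * (2 * pi * R N)"
        by (rule has_contour_integral_bound_circlepath[OF has_contour_integral_integral[OF integrable]])
           (use M0 Rpos \<kappa> bound in \<open>auto intro!: mult_nonneg_nonneg zero_le_power\<close>)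
      also have "\<dots> = M * (2 * pi * R0) * \<kappa> ^ N"
        using nq by (simp add: R_def power_mult_distrib)
      finally show "norm (contour_integral (circlepath 0 (R N)) f) \<le> M * (2 * pi * R0) * \<kappa> ^ N" .
    qed
    have "(\<lambda>N. M * (2 * pi * R0) * \<kappa> ^ N) \<longlonglongrightarrow> M * (2 * pi * R0) * 0"
      using \<kappa> by (intro tendsto_intros LIMSEQ_power_zero) auto
    thus "(\<lambda>N. M * (2 * pi * R0) * \<kappa> ^ N) \<longlonglongrightarrow> 0" by simp
  qed
  hence "(\<lambda>N. contour_integral (circlepath 0 (R N)) f - contour_integral (circlepath 0 \<rho>) f) \<longlonglongrightarrow> 0 - contour_integral (circlepath 0 \<rho>) f"
    by (intro tendsto_intros)
  moreover have "(\<lambda>N. contour_integral (circlepath 0 (R N)) f - contour_integral (circlepath 0 \<rho>) f)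
      \<longlonglongrightarrow> 2 * pi * \<i> * (\<Sum>p\<in>B. \<Sum>k. C p k)"
    unfolding int by (intro tendsto_intros lim1)
  ultimately have "0 - contour_integral (circlepath 0 \<rho>) f = 2 * pi * \<i> * (\<Sum>p\<in>B. \<Sum>k. C p k)"
    by (rule LIMSEQ_unique)
  thus ?thesis unfolding C_def by (metis diff_0 minus_minus)
qed

end

text \<open>The function \<open>\<psi>\<close> of \<open>outer_residues\<close> for the integrand
  \<open>f\<close> at hand, namely \<open>f (y / q) / (q * f y)\<close> in cancelled form.\<close>

definition integrand_ratio :: "complex \<Rightarrow> complex \<Rightarrow> complex \<Rightarrow> complex \<Rightarrow> complex \<Rightarrow> complex \<Rightarrow> complex" where
  "integrand_ratio q a b c d y = (y - a) * (y - d) * (1 - y / b) * (1 - y / c) * (1 - d * y / (a * q))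
     / (q * d * a * (1 - y / (b * c)) * (1 - y ^ 2 / (a * q ^ 2)) * (1 - y ^ 2 / (a * q)))"

context
  fixes q a b c d h :: complex
  assumes q: "norm q < 1" "q \<noteq> 0" and nz: "a \<noteq> 0" "b \<noteq> 0" "c \<noteq> 0" "d \<noteq> 0" and h: "h \<noteq> 0"
begin

text \<open>Dividing \<open>y\<close> by \<open>q\<close> divides \<open>y ^ 2 / a\<close> by
  \<open>q ^ 2\<close>, so two factors split off from that product and only one from each of the
  others.\<close>

lemma cofactor_divide_q:
  "cofactor q a b c d (y / q) = (1 - y / b) * (1 - y / c) * (1 - d * y / (a * q))
     / ((1 - y / (b * c)) * (1 - y ^ 2 / (a * q ^ 2)) * (1 - y ^ 2 / (a * q))) * cofactor q a b c d y"
proof -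
  have 1: "qpoch_inf (q * (y / q) / e) q = (1 - y / e) * qpoch_inf (q * y / e) q" for e
    using qpoch_inf_rec[OF q(1), of "y / e"] q by (simp add: mult.commute)
  have 2: "qpoch_inf (d * (y / q) / a) q = (1 - d * y / (a * q)) * qpoch_inf (d * y / a) q"
    using qpoch_inf_rec[OF q(1), of "d * (y / q) / a"] q by (simp add: mult.commute)
  have "qpoch_inf ((y / q) ^ 2 / a) q = (1 - y ^ 2 / (a * q ^ 2)) * qpoch_inf (y ^ 2 / (a * q)) q"
    using qpoch_inf_rec[OF q(1), of "(y / q) ^ 2 / a"] q by (simp add: power2_eq_square mult_ac)
  also have "qpoch_inf (y ^ 2 / (a * q)) q = (1 - y ^ 2 / (a * q)) * qpoch_inf (y ^ 2 / a) q"
    using qpoch_inf_rec[OF q(1), of "y ^ 2 / (a * q)"] q by simp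
  finally have 3: "qpoch_inf ((y / q) ^ 2 / a) q = (1 - y ^ 2 / (a * q ^ 2)) * ((1 - y ^ 2 / (a * q)) * qpoch_inf (y ^ 2 / a) q)" .
  show ?thesis unfolding cofactor_def 1 2 3 by (simp add: mult_ac)
qed

lemma integrand_divide_q:
  assumes "y \<noteq> 0" "y \<noteq> d" "y \<noteq> a"
  shows "kern q h a d (y / q) * cofactor q a b c d (y / q) / (y / q)
    = q * integrand_ratio q a b c d y * (kern q h a d y * cofactor q a b c d y / y)"
proof -
  have k: "kern q h a d (y / q) = (y - a) * (y - d) * kern q h a d y / (a * d * q)"
    using kern_divide_q[OF q h nz(1) nz(4) assms] q nz by (simp add: field_simps)
  show ?thesis
    unfolding k cofactor_divide_q integrand_ratio_def by (simp add: mult_ac)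
qed

text \<open>Numerator and denominator both have degree 5 in \<open>y\<close>, and their leading
  coefficients have quotient \<open>q\<close>. The function \<open>g\<close> is the ratio in the
  variable \<open>1 / y\<close> after division by \<open>y ^ 5\<close>.\<close>

lemma integrand_ratio_at_infinity: "(integrand_ratio q a b c d \<longlongrightarrow> q) at_infinity"
proof -
  define g where "g = (\<lambda>u. (1 - a * u) * (1 - d * u) * (u - 1 / b) * (u - 1 / c) * (u - d / (a * q))
     / (q * d * a * (u - 1 / (b * c)) * (u ^ 2 - 1 / (a * q ^ 2)) * (u ^ 2 - 1 / (a * q))))"
  have "isCont g 0"
    unfolding g_def using q nz by (intro continuous_intros) (auto simp: field_simps)
  moreover have "g 0 = q" unfolding g_def using q nz by (simp add: field_simps power2_eq_square)
  ultimately have "((\<lambda>y. g (inverse y)) \<longlongrightarrow> q) at_infinity"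
    using tendsto_inverse_0 by (metis isCont_tendsto_compose)
  thus ?thesis
  proof (rule Lim_transform_eventually)
    have "\<forall>\<^sub>F y in at_infinity. (y :: complex) \<noteq> 0"
      by (rule eventually_mono[OF eventually_not_equal_at_infinity]) auto
    thus "\<forall>\<^sub>F y in at_infinity. g (inverse y) = integrand_ratio q a b c d y"
    proof eventually_elim
      case (elim y)
      define u where "u = inverse y"
      have u: "u \<noteq> 0" "y = 1 / u" using elim by (auto simp: u_def field_simps)
      have "g u = (1 / u * (1 - a * u)) * (1 / u * (1 - d * u)) * (1 / u * (u - 1 / b)) * (1 / u * (u - 1 / c)) * (1 / u * (u - d / (a * q)))
       / (q * d * a * (1 / u * (u - 1 / (b * c))) * (1 / u ^ 2 * (u ^ 2 - 1 / (a * q ^ 2))) * (1 / u ^ 2 * (u ^ 2 - 1 / (a * q))))"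
      proof -
        have "A1 * A2 * A3 * A4 * A5 / (e * B1 * B2 * B3)
          = (1 / u * A1) * (1 / u * A2) * (1 / u * A3) * (1 / u * A4) * (1 / u * A5) / (e * (1 / u * B1) * (1 / u ^ 2 * B2) * (1 / u ^ 2 * B3))"
          for A1 A2 A3 A4 A5 B1 B2 B3 e using u(1) by (simp add: power2_eq_square)
        thus ?thesis unfolding g_def .
      qed
      also have "\<dots> = integrand_ratio q a b c d y"
        unfolding integrand_ratio_def using u by (simp add: right_diff_distrib power_divide)
      finally show ?case by (simp add: u_def)
    qed
  qed
qed

text \<open>All five families of poles are of the form \<open>\<sigma> / q ^ k\<close>, and this evaluates the ratio
  of consecutive residues for all of them at once.\<close>

lemma integrand_ratio_pole:
  assumes "\<sigma> \<noteq> 0" "x \<noteq> 0"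
  shows "integrand_ratio q a b c d (\<sigma> / x) = q * ((1 - a / \<sigma> * x) * (1 - b / \<sigma> * x) * (1 - c / \<sigma> * x) * (1 - d / \<sigma> * x) * (1 - q * a / (d * \<sigma>) * x))
     / ((1 - b * c / \<sigma> * x) * (1 - q ^ 2 * a / \<sigma> ^ 2 * x ^ 2) * (1 - q * a / \<sigma> ^ 2 * x ^ 2))"
proof -
  have *: "\<sigma> / x - a = \<sigma> / x * (1 - a / \<sigma> * x)" "\<sigma> / x - d = \<sigma> / x * (1 - d / \<sigma> * x)"
    "1 - \<sigma> / x / b = - (\<sigma> / (b * x)) * (1 - b / \<sigma> * x)" "1 - \<sigma> / x / c = - (\<sigma> / (c * x)) * (1 - c / \<sigma> * x)"
    "1 - d * (\<sigma> / x) / (a * q) = - (d * \<sigma> / (a * q * x)) * (1 - q * a / (d * \<sigma>) * x)"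
    "1 - \<sigma> / x / (b * c) = - (\<sigma> / (b * c * x)) * (1 - b * c / \<sigma> * x)"
    "1 - (\<sigma> / x) ^ 2 / (a * q ^ 2) = - (\<sigma> ^ 2 / (a * q ^ 2 * x ^ 2)) * (1 - q ^ 2 * a / \<sigma> ^ 2 * x ^ 2)"
    "1 - (\<sigma> / x) ^ 2 / (a * q) = - (\<sigma> ^ 2 / (a * q * x ^ 2)) * (1 - q * a / \<sigma> ^ 2 * x ^ 2)"
    using assms q nz by (simp_all add: field_simps power2_eq_square)
  have "(\<sigma> / x * A1) * (\<sigma> / x * A4) * (- (\<sigma> / (b * x)) * A2) * (- (\<sigma> / (c * x)) * A3) * (- (d * \<sigma> / (a * q * x)) * A5)
     / (q * d * a * (- (\<sigma> / (b * c * x)) * B1) * (- (\<sigma> ^ 2 / (a * q ^ 2 * x ^ 2)) * B2) * (- (\<sigma> ^ 2 / (a * q * x ^ 2)) * B3))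
     = q * (A1 * A2 * A3 * A4 * A5) / (B1 * B2 * B3)" for A1 A2 A3 A4 A5 B1 B2 B3
    using assms q nz by (simp add: divide_simps power2_eq_square)
  thus ?thesis unfolding integrand_ratio_def * .
qed

text \<open>The parameter lists enter only through their one-step recurrences, because the quadratic
  factors split into different pairs of opposite parameters for the different families of
  poles.\<close>

lemma prod_integrand_ratio:
  assumes \<sigma>: "\<sigma> \<noteq> 0"
    and as: "\<And>k. qpochs as q (Suc k) = qpochs as q k *
      ((1 - a / \<sigma> * q ^ k) * (1 - b / \<sigma> * q ^ k) * (1 - c / \<sigma> * q ^ k) * (1 - d / \<sigma> * q ^ k) * (1 - q * a / (d * \<sigma>) * q ^ k))"
    and bs: "\<And>k. qpochs (q # bs) q (Suc k) = qpochs (q # bs) q k *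
      ((1 - b * c / \<sigma> * q ^ k) * (1 - q ^ 2 * a / \<sigma> ^ 2 * (q ^ k) ^ 2) * (1 - q * a / \<sigma> ^ 2 * (q ^ k) ^ 2))"
    and init: "qpochs as q 0 = 1" "qpochs (q # bs) q 0 = 1"
    and sm: "summable (\<lambda>k. qpochs as q k / qpochs (q # bs) q k * q ^ k)"
  shows "(\<Sum>k. C * (\<Prod>i<k. integrand_ratio q a b c d (\<sigma> / q ^ i))) = C * (\<Sum>k. qpochs as q k / qpochs (q # bs) q k * q ^ k)"
proof -
  have "(\<Prod>i<k. integrand_ratio q a b c d (\<sigma> / q ^ i)) = qpochs as q k / qpochs (q # bs) q k * q ^ k" for k
  proof (induction k)
    case (Suc k)
    have "q ^ k \<noteq> 0" using q by simp
    from integrand_ratio_pole[OF \<sigma> this] show ?case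
      unfolding as bs using Suc by (simp add: mult_ac)
  qed (use init in simp)
  thus ?thesis using suminf_mult[OF sm] by simp
qed

lemma isCont_integrand_ratio:
  assumes "\<sigma> \<noteq> 0" "(1 - b * c / \<sigma> * q ^ k) * (1 - q ^ 2 * a / \<sigma> ^ 2 * (q ^ k) ^ 2) * (1 - q * a / \<sigma> ^ 2 * (q ^ k) ^ 2) \<noteq> 0"
  shows "isCont (integrand_ratio q a b c d) (\<sigma> / q ^ k)"
proof -
  define x where "x = q ^ k"
  have x: "x \<noteq> 0" using q by (simp add: x_def)
  have "1 - \<sigma> / x / (b * c) = - (\<sigma> / (b * c * x)) * (1 - b * c / \<sigma> * x)"
    "1 - (\<sigma> / x) ^ 2 / (a * q ^ 2) = - (\<sigma> ^ 2 / (a * q ^ 2 * x ^ 2)) * (1 - q ^ 2 * a / \<sigma> ^ 2 * x ^ 2)"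
    "1 - (\<sigma> / x) ^ 2 / (a * q) = - (\<sigma> ^ 2 / (a * q * x ^ 2)) * (1 - q * a / \<sigma> ^ 2 * x ^ 2)"
    using assms q nz x by (simp_all add: field_simps power2_eq_square)
  hence "1 - \<sigma> / x / (b * c) \<noteq> 0" "1 - (\<sigma> / x) ^ 2 / (a * q ^ 2) \<noteq> 0" "1 - (\<sigma> / x) ^ 2 / (a * q) \<noteq> 0"
    using assms q nz x by (auto simp only: x_def[symmetric] mult_eq_0_iff neg_equal_0_iff_equal divide_eq_0_iff power_eq_0_iff)
  thus ?thesis
    unfolding integrand_ratio_def[abs_def] x_def[symmetric] using q nz by (intro continuous_intros) auto
qed

section \<open>Residues at the base points\<close>

lemma tendsto_kern:
  assumes "p \<noteq> 0" "qpoch_inf (a / p) q \<noteq> 0" "qpoch_inf (d / p) q \<noteq> 0"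
  shows "(kern q h a d \<longlongrightarrow> kern q h a d p) (at p)"
  unfolding kern_def[abs_def] using assms q nz h by (intro tendsto_intros) auto

lemma residue_bc:
  assumes "p = b * c / q" "qpoch_inf (a / p) q \<noteq> 0" "qpoch_inf (d / p) q \<noteq> 0" "qpoch_inf (p ^ 2 / a) q \<noteq> 0"
  shows "((\<lambda>y. (y - p) * (kern q h a d y * cofactor q a b c d y / y)) \<longlongrightarrow>
    - (kern q h a d p * (qpoch_inf c q * qpoch_inf b q * qpoch_inf (d * p / a) q / (qpoch_inf q q * qpoch_inf (p ^ 2 / a) q)))) (at p)"
proof -
  have p: "p \<noteq> 0" using assms(1) nz q by simp
  \<comment> \<open>\<open>g\<close> is the integrand times \<open>y - p\<close> with the vanishing
    factor \<open>1 - y / p\<close> divided out; it is continuous at \<open>p\<close>.\<close>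
  define g where "g = (\<lambda>y. - (p / y) * (kern q h a d y * (qpoch_inf (q * y / b) q * qpoch_inf (q * y / c) q * qpoch_inf (d * y / a) q
     / (qpoch_inf (q * (q * y / (b * c))) q * qpoch_inf (y ^ 2 / a) q))))"
  have pp: "q * p / b = c" "q * p / c = b" "q * (q * p / (b * c)) = q" using assms(1) nz q by auto
  have "(g \<longlongrightarrow> g p) (at p)"
    unfolding g_def using p assms q nz qpoch_inf_nonzero[OF q(1) q(1)] pp by (intro tendsto_intros tendsto_kern) auto
  hence "(g \<longlongrightarrow> - (kern q h a d p * (qpoch_inf c q * qpoch_inf b q * qpoch_inf (d * p / a) q / (qpoch_inf q q * qpoch_inf (p ^ 2 / a) q)))) (at p)"
    unfolding g_def pp using p by simp
  thus ?thesis
  proof (rule Lim_transform_eventually)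
    have "\<forall>\<^sub>F y in at p. y \<in> - {0} - {p}" by (rule eventually_at_in_open) (use p in auto)
    thus "\<forall>\<^sub>F y in at p. g y = (y - p) * (kern q h a d y * cofactor q a b c d y / y)"
    proof eventually_elim
      case (elim y)
      have 1: "qpoch_inf (q * y / (b * c)) q = (1 - y / p) * qpoch_inf (q * (q * y / (b * c))) q"
        using qpoch_inf_rec[OF q(1), of "q * y / (b * c)"] assms(1) q nz by (simp add: mult.commute)
      have "1 - y / p \<noteq> 0" using elim p by auto
      moreover have "y - p = - p * (1 - y / p)" using p by (simp add: field_simps)
      moreover have "- (p / y) * (K * (N / (A * B))) = (- p * e) * (K * (N / ((e * A) * B)) / y)" if "e \<noteq> 0" for K N A B e
        using that by simp
      ultimately show ?case unfolding g_def cofactor_def 1 by metis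
    qed
  qed
qed

text \<open>Both kinds of roots are treated together: the factor \<open>1 - y ^ 2 / p ^ 2\<close>
  vanishes at \<open>p\<close>, and its other root \<open>- p\<close> accounts for the
  \<open>1 / 2\<close>. For \<open>p = s / r\<close> the preceding factor
  \<open>1 - y ^ 2 / a\<close> survives with value \<open>1 - 1 / q\<close>, which is
  \<open>e\<close>.\<close>

lemma residue_sqrt:
  assumes "s ^ 2 = a" "p = s \<or> p = s / r" "r ^ 2 = q" "qpoch_inf (a / p) q \<noteq> 0" "qpoch_inf (d / p) q \<noteq> 0" "qpoch_inf (q * p / (b * c)) q \<noteq> 0"
    "e = (if p = s then 1 else 1 - 1 / q)" "p = s / r \<Longrightarrow> s \<noteq> s / r"
  shows "((\<lambda>y. (y - p) * (kern q h a d y * cofactor q a b c d y / y)) \<longlongrightarrow>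
    - (1 / 2) * (kern q h a d p * (qpoch_inf (q * p / b) q * qpoch_inf (q * p / c) q * qpoch_inf (d * p / a) q / (qpoch_inf (q * p / (b * c)) q * (e * qpoch_inf q q))))) (at p)"
proof -
  have s: "s \<noteq> 0" "r \<noteq> 0" using assms nz q by auto
  have p: "p \<noteq> 0" using assms s by auto
  \<comment> \<open>The product \<open>qpoch_inf (y ^ 2 / a) q\<close> without the factor that
    vanishes at \<open>p\<close>: the first one if \<open>p = s\<close>, the second one
    otherwise.\<close>
  define E where "E = (\<lambda>y. if p = s then qpoch_inf (q * y ^ 2 / a) q else (1 - y ^ 2 / a) * qpoch_inf (q ^ 2 * y ^ 2 / a) q)"
  define g where "g = (\<lambda>y. - (p ^ 2 / ((y + p) * y)) * (kern q h a d y * (qpoch_inf (q * y / b) q * qpoch_inf (q * y / c) q * qpoch_inf (d * y / a) q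
     / (qpoch_inf (q * y / (b * c)) q * E y))))"
  have q1: "q \<noteq> 1" using q by auto
  have Ep: "E p = e * qpoch_inf q q"
  proof (cases "p = s")
    case False
    hence "p ^ 2 = a / q" using assms by (simp add: power_divide)
    thus ?thesis using False assms(7) q nz by (simp add: E_def power2_eq_square)
  qed (use assms nz in \<open>auto simp: E_def\<close>)
  have e: "e \<noteq> 0" using assms(7) q1 q by (auto simp: field_simps)
  have "(E \<longlongrightarrow> E p) (at p)"
    unfolding E_def using q nz by (cases "p = s") (auto intro!: tendsto_intros)
  hence "(g \<longlongrightarrow> g p) (at p)"
    unfolding g_def using p assms q nz e Ep qpoch_inf_nonzero[OF q(1) q(1)] by (intro tendsto_intros tendsto_kern) auto
  moreover have "g p = - (1 / 2) * (kern q h a d p * (qpoch_inf (q * p / b) q * qpoch_inf (q * p / c) q * qpoch_inf (d * p / a) q / (qpoch_inf (q * p / (b * c)) q * (e * qpoch_inf q q))))"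
  proof -
    have "p ^ 2 / ((p + p) * p) = 1 / 2" using p by (simp add: power2_eq_square field_simps)
    thus ?thesis unfolding g_def Ep by simp
  qed
  ultimately have "(g \<longlongrightarrow> - (1 / 2) * (kern q h a d p * (qpoch_inf (q * p / b) q * qpoch_inf (q * p / c) q * qpoch_inf (d * p / a) q / (qpoch_inf (q * p / (b * c)) q * (e * qpoch_inf q q))))) (at p)"
    by simp
  thus ?thesis
  proof (rule Lim_transform_eventually)
    have "\<forall>\<^sub>F y in at p. y \<in> - {0, - p} - {p}" by (rule eventually_at_in_open) (use p in auto)
    thus "\<forall>\<^sub>F y in at p. g y = (y - p) * (kern q h a d y * cofactor q a b c d y / y)"
    proof eventually_elim
      case (elim y)
      have 1: "qpoch_inf (y ^ 2 / a) q = (1 - y ^ 2 / p ^ 2) * E y"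
      proof (cases "p = s")
        case True
        thus ?thesis using qpoch_inf_rec[OF q(1), of "y ^ 2 / a"] assms(1) by (simp add: E_def mult.commute)
      next
        case False
        hence "p ^ 2 = a / q" using assms by (simp add: power_divide)
        moreover have "qpoch_inf (y ^ 2 / a) q = (1 - y ^ 2 / a) * ((1 - q * y ^ 2 / a) * qpoch_inf (q ^ 2 * y ^ 2 / a) q)"
          using qpoch_inf_rec[OF q(1), of "y ^ 2 / a"] qpoch_inf_rec[OF q(1), of "q * y ^ 2 / a"]
          by (simp add: power2_eq_square mult_ac)
        ultimately show ?thesis using False by (simp add: E_def mult_ac)
      qed
      have "y ^ 2 \<noteq> p ^ 2" using elim by (auto simp: power2_eq_iff)
      hence nz1: "1 - y ^ 2 / p ^ 2 \<noteq> 0" using p by (simp add: field_simps)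
      have yp: "y + p \<noteq> 0" "y \<noteq> 0" using elim by (auto simp: add_eq_0_iff2)
      have "y - p = - (p ^ 2 / (y + p)) * (1 - y ^ 2 / p ^ 2)"
      proof -
        have "1 - y ^ 2 / p ^ 2 = (p - y) * (y + p) / p ^ 2" using p by (simp add: field_simps power2_eq_square)
        thus ?thesis using yp p by simp
      qed
      moreover have "- (p ^ 2 / ((y + p) * y)) * (K * (N / (A * B))) = (- (p ^ 2 / (y + p)) * w) * (K * (N / (A * (w * B))) / y)" if "w \<noteq> 0" for K N A B w
        using that by simp
      ultimately show ?case unfolding g_def cofactor_def 1 using nz1 by metis
    qed
  qed
qed

end

text \<open>Odd and even powers of \<open>norm r\<close> never agree. Hence poles
  \<open>s / q ^ k\<close> and \<open>s' / (r * q ^ k')\<close> have different moduli.\<close>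

lemma norm_power_parity:
  fixes r :: complex
  assumes "norm r < 1" "r \<noteq> 0"
  shows "norm r * (norm r ^ 2) ^ k \<noteq> (norm r ^ 2) ^ l"
proof
  assume "norm r * (norm r ^ 2) ^ k = (norm r ^ 2) ^ l"
  hence "norm r ^ (2 * k + 1) = norm r ^ (2 * l)" by (simp add: power_mult)
  hence "2 * k + 1 = 2 * l" using assms by (subst (asm) power_inject_exp') auto
  thus False by presburger
qed

text \<open>The case in which a circle separates the poles: \<open>norm d < norm a\<close> makes the
  series in \<open>d / a\<close> converge, and the other two inequalities leave room for the circle
  between \<open>a\<close> and the poles \<open>t\<close>, \<open>- t\<close> and
  \<open>b * c / q\<close>.\<close>

lemma transformation_small:
  fixes q r z t a b c h :: complex
  assumes q: "norm q < 1" "q \<noteq> 0" and z: "norm z < 1" "z \<noteq> 0" and nz: "t \<noteq> 0" "b \<noteq> 0" "c \<noteq> 0" "h \<noteq> 0"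
    and roots: "r ^ 2 = q" "t ^ 2 = a"
    and small: "norm (b * c * z / q) < norm a" "norm a < norm t" "norm a < norm (b * c / q)"
    and \<beta>: "qpoch_inf (q * a / b) q \<noteq> 0" "qpoch_inf (q * a / c) q \<noteq> 0"
    and theta: "qtheta h q \<noteq> 0" "qtheta (h * (q * a / (b * c * z))) q \<noteq> 0"
    and xnz: "qpoch_inf (b ^ 2 * c ^ 2 / (q ^ 2 * a)) q \<noteq> 0"
    and lowX: "\<And>x. x \<in> {q * r * t / (b * c), - (q * r * t / (b * c)), q ^ 2 * t / (b * c), - (q ^ 2 * t / (b * c))} \<Longrightarrow> qpoch_inf x q \<noteq> 0"
    and T: "\<And>s x. s \<in> {t, - t} \<Longrightarrow> x \<in> {s, q * s / (b * c), b * c * z / (q * s), r * s, r * s / (b * c), b * c * z / (r * s), b * c / s, r * b * c / s}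
         \<Longrightarrow> qpoch_inf x q \<noteq> 0"
    and lowT: "\<And>x. x \<in> {- q, r, - r, r ^ 3, - (r ^ 3)} \<Longrightarrow> qpoch_inf x q \<noteq> 0"
  shows "qphi [a, b, c] [q * a / b, q * a / c] q z =
    X_term q r z a t b c h
    + qpochs_inf [a, q * a / (b * c)] q
      / (2 * qthetas [h, h * (q * a / (b * c * z))] q * qpochs_inf [q * a / b, q * a / c] q)
      * (T_term q r z b c h t + T_term q r z b c h (- t))"
proof -
  define d where "d = b * c * z / q"
  have d: "d \<noteq> 0" using q z nz by (simp add: d_def)
  have a: "a \<noteq> 0" using nz roots by auto
  have r: "r \<noteq> 0" using q roots by auto
  have nq: "norm q = norm r ^ 2" using roots(1) by (metis norm_power)
  have r1: "norm r < 1"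
  proof (rule ccontr)
    assume "\<not> norm r < 1"
    hence "1 \<le> norm r ^ 2" by (simp add: one_le_power)
    thus False using q nq by simp
  qed
  have dz: "q * d / (b * c) = z" using q nz by (simp add: d_def)
  define l where "l = norm a"
  have la: "max (norm a) (norm d) = l" using small by (simp add: d_def l_def)
  have l: "l \<ge> 0" by (simp add: l_def)
  obtain \<rho> where \<rho>: "norm a < \<rho>" "\<rho> < min (norm t) (norm (b * c / q))"
    using dense[of "norm a" "min (norm t) (norm (b * c / q))"] small by auto
  define R where "R = min (norm t) (norm (b * c / q))"
  define f where "f = (\<lambda>y. kern q h a d y * cofactor q a b c d y / y)"
  define \<psi> where "\<psi> = integrand_ratio q a b c d"
  define B where "B = {b * c / q, t, - t, t / r, - t / r}"
  define poles where "poles = {p / q ^ k |p k. p \<in> B}"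
  define \<mu> where "\<mu> = qtheta h q * qtheta (h * a / d) q / qpoch_inf q q"
  define C where "C = qpoch_inf (q * a / b) q * qpoch_inf (q * a / c) q / (qpoch_inf (q * a / (b * c)) q * qpoch_inf a q)"
  define \<phi> where "\<phi> = qphi [a, b, c] [q * a / b, q * a / c] q z"
  note fnz = a nz(2,3) d
  have Pnz: "qpoch_inf x q \<noteq> 0" if "norm x < 1" for x by (rule qpoch_inf_nonzero[OF q(1) that])
  have cof_nz: "qpoch_inf (q * y / (b * c)) q \<noteq> 0" "qpoch_inf (y ^ 2 / a) q \<noteq> 0" if y: "norm y < R" for y
  proof -
    have "norm y < norm (b * c / q)" using y by (simp add: R_def)
    thus "qpoch_inf (q * y / (b * c)) q \<noteq> 0" using q nz by (intro Pnz) (simp add: norm_mult norm_divide field_simps)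
    have "norm y ^ 2 < norm t ^ 2" using y by (intro power_strict_mono) (auto simp: R_def)
    thus "qpoch_inf (y ^ 2 / a) q \<noteq> 0" using nz by (intro Pnz) (simp add: roots(2)[symmetric] norm_power norm_divide)
  qed
  have aR: "norm a < R" using small by (simp add: R_def)
  have C_nz: "qpoch_inf (q * a / (b * c)) q \<noteq> 0" "qpoch_inf a q \<noteq> 0"
    using cof_nz[OF aR] a by (auto simp: power2_eq_square)

  \<comment> \<open>The integral as a multiple of the left-hand series\<close>
  have inner: "contour_integral (circlepath 0 \<rho>) f = 2 * pi * \<i> * (\<mu> * (C * \<phi>))"
  proof -
    have hol: "cofactor q a b c d holomorphic_on ball 0 R"
      unfolding cofactor_def[abs_def] using cof_nz fnz q by (intro holomorphic_intros) auto
    have "(\<Sum>k. (d / a) ^ k * qdiff q a k (cofactor q a b c d)) = C * \<phi>"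
      unfolding C_def \<phi>_def dz[symmetric]
    proof (rule qdiff_series_eq_3phi2[OF q a nz(2) \<beta>(1) nz(3) \<beta>(2) _ aR])
      show "norm d < norm a" using small by (simp add: d_def)
      have "R ^ 2 \<le> norm t ^ 2" using small by (intro power_mono) (auto simp: R_def)
      thus "R ^ 2 \<le> norm a" using roots(2) by (metis norm_power)
    qed (auto simp: R_def)
    thus ?thesis
      unfolding f_def \<mu>_def using kern_integral_eq_qdiff_series[OF q nz(4) a d _ \<rho>(1) _ hol] small \<rho> by (simp add: d_def R_def)
  qed

  \<comment> \<open>Distinctness of the five families of poles\<close>
  have st: "s \<noteq> 0" "s ^ 2 = a" if "s \<in> {t, - t}" for s using that nz roots by auto
  have mult_q_neq: "x * q ^ k \<noteq> 1" if "qpoch_inf x q \<noteq> 0" for x k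
    using that qpoch_inf_eq_0_iff[OF q(1)] by blast
  \<comment> \<open>A coincidence would make \<open>b * c / s\<close> or
    \<open>q * s / (b * c)\<close> a power \<open>1 / q ^ i\<close>, depending on which exponent is
    larger; both are excluded since their infinite products do not vanish.\<close>
  have D1: "b * c / q / q ^ k \<noteq> s / q ^ k'" if s: "s \<in> {t, - t}" for s k k'
  proof
    assume "b * c / q / q ^ k = s / q ^ k'"
    hence eq: "b * c * q ^ k' = s * q ^ Suc k" using q by (simp add: field_simps)
    show False
    proof (cases "k' \<ge> Suc k")
      case True
      then obtain i where "k' = i + Suc k" by (metis le_add_diff_inverse2)
      hence "b * c / s * q ^ i = 1" using eq q st(1)[OF s] by (simp add: power_add field_simps)
      thus False using mult_q_neq[OF T[OF s, of "b * c / s"]] by simp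
    next
      case False
      then obtain i where "k = i + k'" by (metis le_add_diff_inverse2 not_less_eq_eq)
      hence "q * s / (b * c) * q ^ i = 1" using eq q nz st(1)[OF s] by (simp add: power_add field_simps)
      thus False using mult_q_neq[OF T[OF s, of "q * s / (b * c)"]] by simp
    qed
  qed
  have D2: "b * c / q / q ^ k \<noteq> s / r / q ^ k'" if s: "s \<in> {t, - t}" for s k k'
  proof
    assume "b * c / q / q ^ k = s / r / q ^ k'"
    hence eq: "r * b * c * q ^ k' = s * q ^ Suc k" using q r by (simp add: field_simps)
    show False
    proof (cases "k' \<ge> Suc k")
      case True
      then obtain i where "k' = i + Suc k" by (metis le_add_diff_inverse2)
      hence "r * b * c / s * q ^ i = 1" using eq q st(1)[OF s] by (simp add: power_add field_simps)
      thus False using mult_q_neq[OF T[OF s, of "r * b * c / s"]] by simp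
    next
      case False
      then obtain i where "k = i + k'" by (metis le_add_diff_inverse2 not_less_eq_eq)
      hence "r * (b * c) = s * (r * r) * q ^ i" using eq q roots(1) by (simp add: power_add power2_eq_square field_simps)
      hence "r * s / (b * c) * q ^ i = 1" using q r nz st(1)[OF s] by (simp add: field_simps)
      thus False using mult_q_neq[OF T[OF s, of "r * s / (b * c)"]] by simp
    qed
  qed
  have D3: "s / q ^ k \<noteq> s' / r / q ^ k'" if "s \<in> {t, - t}" "s' \<in> {t, - t}" for s s' k k'
  proof
    assume "s / q ^ k = s' / r / q ^ k'"
    hence "norm (s / q ^ k) = norm (s' / r / q ^ k')" by simp
    hence "norm t / norm q ^ k = norm t / norm r / norm q ^ k'" using that by (auto simp: norm_divide norm_power norm_mult)
    hence "norm r * (norm r ^ 2) ^ k' = (norm r ^ 2) ^ k" using nz r unfolding nq by (simp add: field_simps)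
    thus False using norm_power_parity[OF r1 r] by simp
  qed
  have D4: "x / q ^ k \<noteq> - x / q ^ k'" if "x \<noteq> 0" for x k k'
  proof
    assume eq: "x / q ^ k = - x / q ^ k'"
    hence "norm (x / q ^ k) = norm (- x / q ^ k')" by simp
    hence "norm q ^ k = norm q ^ k'" using that q by (simp add: norm_divide norm_power field_simps)
    hence "k = k'" using q by (simp add: power_inject_exp')
    thus False using eq that q by simp
  qed
  have inj: "p = p'" if "p \<in> B" "p' \<in> B" "p / q ^ k = p' / q ^ k'" for p p' k k'
  proof -
    have cases: "x = b * c / q \<or> (\<exists>s\<in>{t, - t}. x = s) \<or> (\<exists>s\<in>{t, - t}. x = s / r)" if "x \<in> B" for x
      using that unfolding B_def by blast
    have D5: "s = s'" if "s \<in> {t, - t}" "s' \<in> {t, - t}" "s / q ^ k = s' / q ^ k'" for s s' k k'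
      using that D4[of t k k'] D4[of t k' k] nz(1) by auto
    have D6: "s = s'" if "s \<in> {t, - t}" "s' \<in> {t, - t}" "s / r / q ^ k = s' / r / q ^ k'" for s s' k k'
    proof (rule D5[OF that(1,2)])
      have "r * (s / r / q ^ k) = r * (s' / r / q ^ k')" by (simp only: that(3))
      thus "s / q ^ k = s' / q ^ k'" using r by simp
    qed
    show ?thesis
      using cases[OF that(1)] cases[OF that(2)] that(3) that(3)[symmetric] D1 D2 D3 D5 D6 by metis
  qed
  have distinct: "b * c / q \<noteq> t" "b * c / q \<noteq> - t" "b * c / q \<noteq> t / r" "b * c / q \<noteq> - t / r" "t \<noteq> - t" "t \<noteq> t / r" "t \<noteq> - t / r"
    "- t \<noteq> t / r" "- t \<noteq> - t / r" "t / r \<noteq> - t / r"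
    using D1[of t 0 0] D1[of "- t" 0 0] D2[of t 0 0] D2[of "- t" 0 0] D4[of t 0 0] D3[of t t 0 0] D3[of t "- t" 0 0] D3[of "- t" t 0 0]
      D3[of "- t" "- t" 0 0] D4[of "t / r" 0 0] nz r by auto

  have B_gt: "\<rho> < norm p" if "p \<in> B" for p
  proof -
    have "norm t \<le> norm t / norm r" using r r1 mult_right_mono[of "norm r" 1 "norm t"] by (simp add: field_simps)
    thus ?thesis using that \<rho> by (auto simp: B_def norm_divide)
  qed
  have f_hol: "f holomorphic_on {y. l < norm y} - poles"
  proof -
    have "qpoch_inf (q * y / (b * c)) q \<noteq> 0" if "y \<notin> poles" for y
    proof
      assume "qpoch_inf (q * y / (b * c)) q = 0"
      then obtain k where "q * y / (b * c) * q ^ k = 1" using qpoch_inf_eq_0_iff[OF q(1)] by blast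
      hence "y = b * c / q / q ^ k" using q nz by (simp add: field_simps)
      thus False using that unfolding poles_def B_def by blast
    qed
    moreover have "qpoch_inf (y ^ 2 / a) q \<noteq> 0" if y: "y \<notin> poles" for y
    proof
      assume "qpoch_inf (y ^ 2 / a) q = 0"
      then obtain k where k: "y ^ 2 / a * q ^ k = 1" using qpoch_inf_eq_0_iff[OF q(1)] by blast
      have "(y * r ^ k) ^ 2 = y ^ 2 * q ^ k" by (simp add: power_mult_distrib roots(1)[symmetric] power_mult[symmetric] mult.commute)
      also have "\<dots> = t ^ 2" using k a roots(2) by (simp add: field_simps)
      finally have "y * r ^ k = t \<or> y * r ^ k = - t" by (simp add: power2_eq_iff)
      then obtain s where s: "s \<in> {t, - t}" "y = s / r ^ k" using r by (auto simp: field_simps)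
      have "y \<in> poles"
      proof (cases "even k")
        case True
        then obtain j where "k = 2 * j" by (elim evenE)
        hence "y = s / q ^ j" using s by (simp add: power_mult roots)
        thus ?thesis using s unfolding poles_def B_def by blast
      next
        case False
        then obtain j where "k = 2 * j + 1" by (elim oddE)
        hence "y = s / r / q ^ j" using s by (simp add: power_mult roots)
        moreover have "s / r \<in> B" using s by (auto simp: B_def)
        ultimately show ?thesis unfolding poles_def by blast
      qed
      thus False using y by simp
    qed
    ultimately have cof: "cofactor q a b c d holomorphic_on {y. l < norm y} - poles"
      unfolding cofactor_def[abs_def] using q fnz by (intro holomorphic_intros) auto
    have "kern q h a d holomorphic_on {y. l < norm y} - poles"
      using holomorphic_on_kern[OF q nz(4) a d] unfolding la by (rule holomorphic_on_subset) auto
    thus ?thesis unfolding f_def using cof l by (intro holomorphic_intros) auto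
  qed

  \<comment> \<open>Residues at the five base points\<close>
  have kern_nz: "qpoch_inf (a / p) q \<noteq> 0" "qpoch_inf (d / p) q \<noteq> 0" if "p \<in> B" for p
  proof -
    have p: "norm a < norm p" "norm d < norm p" using B_gt[OF that] \<rho> small by (auto simp: d_def)
    hence "p \<noteq> 0" by auto
    thus "qpoch_inf (a / p) q \<noteq> 0" "qpoch_inf (d / p) q \<noteq> 0" using p by (auto intro!: Pnz simp: norm_divide)
  qed
  define rX where "rX = - (kern q h a d (b * c / q) * (qpoch_inf c q * qpoch_inf b q * qpoch_inf (d * (b * c / q) / a) q
      / (qpoch_inf q q * qpoch_inf ((b * c / q) ^ 2 / a) q)))"
  define rT where "rT = (\<lambda>e p. - (1 / 2) * (kern q h a d p * (qpoch_inf (q * p / b) q * qpoch_inf (q * p / c) q * qpoch_inf (d * p / a) q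
      / (qpoch_inf (q * p / (b * c)) q * (e * qpoch_inf q q)))))"
  have sqbc: "(b * c / q) ^ 2 / a = b ^ 2 * c ^ 2 / (q ^ 2 * a)" by (simp add: power_mult_distrib power_divide)
  have limX: "((\<lambda>y. (y - b * c / q) * f y) \<longlongrightarrow> rX) (at (b * c / q))"
    unfolding f_def rX_def by (rule residue_bc[OF q fnz nz(4) refl]) (use kern_nz[of "b * c / q"] xnz sqbc in \<open>auto simp: B_def\<close>)
  have rr: "q / r = r" using roots(1) r by (simp add: power2_eq_square[symmetric] field_simps)
  have limE: "((\<lambda>y. (y - s) * f y) \<longlongrightarrow> rT 1 s) (at s)" if s: "s \<in> {t, - t}" for s
  proof -
    have "s \<in> B" using s by (auto simp: B_def)
    thus ?thesis unfolding f_def rT_def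
      by (intro residue_sqrt[OF q fnz nz(4) st(2)[OF s], of s r]) (use kern_nz[of s] T[OF s, of "q * s / (b * c)"] roots D3[OF s s, of 0 0] in auto)
  qed
  have limO: "((\<lambda>y. (y - s / r) * f y) \<longlongrightarrow> rT (1 - 1 / q) (s / r)) (at (s / r))" if s: "s \<in> {t, - t}" for s
  proof -
    have "s / r \<in> B" using s by (auto simp: B_def)
    moreover have "s \<noteq> s / r" using D3[OF s s, of 0 0] by simp
    moreover have "q * (s / r) / (b * c) = r * s / (b * c)" using rr by (metis times_divide_eq_left times_divide_eq_right mult.commute)
    ultimately show ?thesis unfolding f_def rT_def
      by (intro residue_sqrt[OF q fnz nz(4) st(2)[OF s], of "s / r" r]) (use kern_nz[of "s / r"] T[OF s, of "r * s / (b * c)"] roots in auto)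
  qed
  \<comment> \<open>Taking the residues as limits gives a single function on \<open>B\<close>
    without a definition by cases over the base points.\<close>
  define cc where "cc = (\<lambda>p. Lim (at p) (\<lambda>y. (y - p) * f y))"
  have ccX: "cc (b * c / q) = rX" unfolding cc_def by (rule tendsto_Lim[OF _ limX]) simp
  have ccE: "cc s = rT 1 s" if "s \<in> {t, - t}" for s unfolding cc_def by (rule tendsto_Lim[OF _ limE[OF that]]) simp
  have ccO: "cc (s / r) = rT (1 - 1 / q) (s / r)" if "s \<in> {t, - t}" for s unfolding cc_def by (rule tendsto_Lim[OF _ limO[OF that]]) simp
  have cc_lim: "((\<lambda>y. (y - p) * f y) \<longlongrightarrow> cc p) (at p)" if "p \<in> B" for p
    using that limX limE[of t] limE[of "- t"] limO[of t] limO[of "- t"] ccX ccE[of t] ccE[of "- t"] ccO[of t] ccO[of "- t"]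
    unfolding B_def by (elim insertE emptyE) simp_all

  \<comment> \<open>Term ratios of the five series\<close>
  define asX where "asX = [q / b, q / c, q * a / (b * c), z, q ^ 3 * a / (b ^ 2 * c ^ 2 * z)]"
  define bsX where "bsX = [q * r * t / (b * c), - (q * r * t / (b * c)), q ^ 2 * t / (b * c), - (q ^ 2 * t / (b * c))]"
  define asE where "asE = (\<lambda>s. [s, b / s, c / s, b * c * z / (q * s), q ^ 2 * s / (b * c * z)])"
  define bsE where "bsE = (\<lambda>s. [- q, r, - r, b * c / s])"
  define asO where "asO = (\<lambda>s. [r * s, r * b / s, r * c / s, b * c * z / (r * s), r ^ 5 * s / (b * c * z)])"
  define bsO where "bsO = (\<lambda>s. [- q, r ^ 3, - (r ^ 3), r * b * c / s])"
  \<comment> \<open>Splits each quadratic factor of the ratio into a pair of opposite lower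
    parameters.\<close>
  have sq_factor: "(1 - x * y) * (1 - (- x) * y) = 1 - x ^ 2 * y ^ 2" for x y :: complex by (simp add: algebra_simps power2_eq_square)

  have smX: "summable (\<lambda>k. qpochs asX q k / qpochs (q # bsX) q k * q ^ k)"
    by (rule summable_norm_cancel, rule summable_qphi[OF q(1) _ q(1)]) (use lowX in \<open>auto simp: bsX_def\<close>)
  have asX: "qpochs asX q (Suc k) = qpochs asX q k * ((1 - a / (b * c / q) * q ^ k) * (1 - b / (b * c / q) * q ^ k)
     * (1 - c / (b * c / q) * q ^ k) * (1 - d / (b * c / q) * q ^ k) * (1 - q * a / (d * (b * c / q)) * q ^ k))" for k
  proof -
    have e: "a / (b * c / q) = q * a / (b * c)" "b / (b * c / q) = q / c" "c / (b * c / q) = q / b" "d / (b * c / q) = z"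
      "q * a / (d * (b * c / q)) = q ^ 3 * a / (b ^ 2 * c ^ 2 * z)"
      using q nz z by (simp_all add: d_def field_simps power2_eq_square power3_eq_cube)
    show ?thesis unfolding e asX_def by (simp add: qpoch_Suc mult_ac)
  qed
  have bsX: "qpochs (q # bsX) q (Suc k) = qpochs (q # bsX) q k * ((1 - b * c / (b * c / q) * q ^ k)
     * (1 - q ^ 2 * a / (b * c / q) ^ 2 * (q ^ k) ^ 2) * (1 - q * a / (b * c / q) ^ 2 * (q ^ k) ^ 2))" for k
  proof -
    have e: "b * c / (b * c / q) = q" "q ^ 2 * a / (b * c / q) ^ 2 = (q ^ 2 * t / (b * c)) ^ 2" "q * a / (b * c / q) ^ 2 = (q * r * t / (b * c)) ^ 2"
      using q nz by (simp_all add: roots[symmetric] power_divide power_mult_distrib field_simps)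
    show ?thesis unfolding e sq_factor[symmetric] bsX_def by (simp add: qpoch_Suc mult_ac)
  qed
  have sumX: "(\<Sum>k. cc (b * c / q) * (\<Prod>i<k. \<psi> (b * c / q / q ^ i))) = rX * qphi asX bsX q q"
    unfolding ccX \<psi>_def qphi_def by (rule prod_integrand_ratio[OF q fnz nz(4) _ asX bsX _ _ smX]) (use q nz in \<open>auto simp: asX_def bsX_def\<close>)

  have smE: "summable (\<lambda>k. qpochs (asE s) q k / qpochs (q # bsE s) q k * q ^ k)" if s: "s \<in> {t, - t}" for s
    by (rule summable_norm_cancel, rule summable_qphi[OF q(1) _ q(1)]) (use lowT T[OF s, of "b * c / s"] in \<open>auto simp: bsE_def\<close>)
  have asE: "qpochs (asE s) q (Suc k) = qpochs (asE s) q k * ((1 - a / s * q ^ k) * (1 - b / s * q ^ k)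
     * (1 - c / s * q ^ k) * (1 - d / s * q ^ k) * (1 - q * a / (d * s) * q ^ k))" if s: "s \<in> {t, - t}" for s k
  proof -
    have e: "a / s = s" "d / s = b * c * z / (q * s)" "q * a / (d * s) = q ^ 2 * s / (b * c * z)"
      using st[OF s] q nz z by (auto simp: d_def power2_eq_square field_simps)
    show ?thesis unfolding e asE_def by (simp add: qpoch_Suc mult_ac)
  qed
  have bsE: "qpochs (q # bsE s) q (Suc k) = qpochs (q # bsE s) q k * ((1 - b * c / s * q ^ k)
     * (1 - q ^ 2 * a / s ^ 2 * (q ^ k) ^ 2) * (1 - q * a / s ^ 2 * (q ^ k) ^ 2))" if s: "s \<in> {t, - t}" for s k
  proof -
    have e: "q ^ 2 * a / s ^ 2 = q ^ 2" "q * a / s ^ 2 = r ^ 2"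
      using st[OF s] a roots by simp_all
    show ?thesis unfolding e sq_factor[symmetric] bsE_def by (simp add: qpoch_Suc mult_ac)
  qed
  have sumE: "(\<Sum>k. cc s * (\<Prod>i<k. \<psi> (s / q ^ i))) = rT 1 s * qphi (asE s) (bsE s) q q" if s: "s \<in> {t, - t}" for s
    unfolding ccE[OF s] \<psi>_def qphi_def
    by (rule prod_integrand_ratio[OF q fnz nz(4) st(1)[OF s] asE[OF s] bsE[OF s] _ _ smE[OF s]]) (auto simp: asE_def bsE_def)

  have smO: "summable (\<lambda>k. qpochs (asO s) q k / qpochs (q # bsO s) q k * q ^ k)" if s: "s \<in> {t, - t}" for s
    by (rule summable_norm_cancel, rule summable_qphi[OF q(1) _ q(1)]) (use lowT T[OF s, of "r * b * c / s"] in \<open>auto simp: bsO_def\<close>)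
  have asO: "qpochs (asO s) q (Suc k) = qpochs (asO s) q k * ((1 - a / (s / r) * q ^ k) * (1 - b / (s / r) * q ^ k)
     * (1 - c / (s / r) * q ^ k) * (1 - d / (s / r) * q ^ k) * (1 - q * a / (d * (s / r)) * q ^ k))" if s: "s \<in> {t, - t}" for s k
  proof -
    have e: "a / (s / r) = r * s" "b / (s / r) = r * b / s" "c / (s / r) = r * c / s" "d / (s / r) = b * c * z / (r * s)"
      "q * a / (d * (s / r)) = r ^ 5 * s / (b * c * z)"
      using st(1)[OF s] nz z r unfolding d_def st(2)[OF s, symmetric] roots(1)[symmetric]
      by (simp_all add: field_simps eval_nat_numeral)
    show ?thesis unfolding e asO_def by (simp add: qpoch_Suc mult_ac)
  qed
  have bsO: "qpochs (q # bsO s) q (Suc k) = qpochs (q # bsO s) q k * ((1 - b * c / (s / r) * q ^ k)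
     * (1 - q ^ 2 * a / (s / r) ^ 2 * (q ^ k) ^ 2) * (1 - q * a / (s / r) ^ 2 * (q ^ k) ^ 2))" if s: "s \<in> {t, - t}" for s k
  proof -
    have e: "b * c / (s / r) = r * b * c / s" "q ^ 2 * a / (s / r) ^ 2 = (r ^ 3) ^ 2" "q * a / (s / r) ^ 2 = q ^ 2"
      using st(1)[OF s] r unfolding st(2)[OF s, symmetric] roots(1)[symmetric] by (simp_all add: field_simps eval_nat_numeral)
    show ?thesis unfolding e sq_factor[symmetric] bsO_def by (simp add: qpoch_Suc mult_ac)
  qed
  have sumO: "(\<Sum>k. cc (s / r) * (\<Prod>i<k. \<psi> (s / r / q ^ i))) = rT (1 - 1 / q) (s / r) * qphi (asO s) (bsO s) q q" if s: "s \<in> {t, - t}" for s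
    unfolding ccO[OF s] \<psi>_def qphi_def
    by (rule prod_integrand_ratio[OF q fnz nz(4) _ asO[OF s] bsO[OF s] _ _ smO[OF s]]) (use st[OF s] r in \<open>auto simp: asO_def bsO_def\<close>)

  have low_nz: "qpochs (q # bs) q k \<noteq> 0" if "\<And>x. x \<in> set bs \<Longrightarrow> qpoch_inf x q \<noteq> 0" for bs k
    using that qpoch_nonzero_if_inf[OF q(1)] qpoch_q_nonzero[OF q(1)] unfolding qpochs_eq_0_iff by auto
  \<comment> \<open>At the poles, the denominator factors of \<open>\<psi>\<close> are factors of
    the lower factorials of the corresponding series, hence nonzero.\<close>
  have \<psi>_cont: "isCont \<psi> y" if yp: "y \<in> poles" for y
  proof -
    obtain p k where pk: "p \<in> B" "y = p / q ^ k" using yp by (auto simp: poles_def)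
    have "(1 - b * c / p * q ^ k) * (1 - q ^ 2 * a / p ^ 2 * (q ^ k) ^ 2) * (1 - q * a / p ^ 2 * (q ^ k) ^ 2) \<noteq> 0"
    proof -
      have X: "p = b * c / q \<Longrightarrow> ?thesis" using bsX[of k] low_nz[of bsX "Suc k"] lowX by (auto simp: bsX_def)
      have E: "p = s \<Longrightarrow> ?thesis" if s: "s \<in> {t, - t}" for s
        using bsE[OF s, of k] low_nz[of "bsE s" "Suc k"] lowT T[OF s, of "b * c / s"] by (auto simp: bsE_def)
      have O: "p = s / r \<Longrightarrow> ?thesis" if s: "s \<in> {t, - t}" for s
        using bsO[OF s, of k] low_nz[of "bsO s" "Suc k"] lowT T[OF s, of "r * b * c / s"] by (auto simp: bsO_def)
      show ?thesis using pk(1) X E[of t] E[of "- t"] O[of t] O[of "- t"] unfolding B_def by blast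
    qed
    moreover have "p \<noteq> 0" using order.strict_trans[OF \<rho>(1) B_gt[OF pk(1)]] by auto
    ultimately show ?thesis unfolding \<psi>_def pk(2) by (intro isCont_integrand_ratio[OF q fnz nz(4)])
  qed

  \<comment> \<open>The integral as a sum of residues\<close>
  have outer: "contour_integral (circlepath 0 \<rho>) f = - (2 * pi * \<i> * (\<Sum>p\<in>B. \<Sum>k. cc p * (\<Prod>i<k. \<psi> (p / q ^ i))))"
  proof (rule outer_residues[OF q l])
    show "l < \<rho>" using \<rho> by (simp add: l_def)
    show "f holomorphic_on {y. l < norm y} - {p / q ^ k |p k. p \<in> B}" using f_hol by (simp add: poles_def)
    show "f (y / q) = q * \<psi> y * f y" if "l < norm y" for y
      unfolding f_def \<psi>_def by (rule integrand_divide_q[OF q fnz nz(4)]) (use that la l in auto)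
    show "(\<psi> \<longlongrightarrow> q) at_infinity" unfolding \<psi>_def by (rule integrand_ratio_at_infinity[OF q fnz nz(4)])
    show "finite B" by (simp add: B_def)
    show "isCont \<psi> y" if "y \<in> {p / q ^ k |p k. p \<in> B}" for y by (rule \<psi>_cont) (use that in \<open>simp add: poles_def\<close>)
  qed (fact B_gt inj cc_lim)+

  define S where "S = (\<lambda>s. rT 1 s * qphi (asE s) (bsE s) q q + rT (1 - 1 / q) (s / r) * qphi (asO s) (bsO s) q q)"
  have total: "\<mu> * (C * \<phi>) = - (rX * qphi asX bsX q q + S t + S (- t))"
  proof -
    have "(\<Sum>p\<in>B. \<Sum>k. cc p * (\<Prod>i<k. \<psi> (p / q ^ i))) = rX * qphi asX bsX q q + S t + S (- t)"
    proof -
      have five: "sum g {x1, x2, x3, x4, x5} = g x1 + (g x2 + g x4) + (g x3 + g x5)"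
        if "x1 \<noteq> x2" "x1 \<noteq> x3" "x1 \<noteq> x4" "x1 \<noteq> x5" "x2 \<noteq> x3" "x2 \<noteq> x4" "x2 \<noteq> x5" "x3 \<noteq> x4" "x3 \<noteq> x5" "x4 \<noteq> x5"
        for x1 x2 x3 x4 x5 and g :: "complex \<Rightarrow> complex" using that by (simp add: add_ac)
      have "t \<in> {t, - t}" "- t \<in> {t, - t}" by simp_all
      thus ?thesis unfolding B_def S_def five[OF distinct] sumX by (simp only: sumE sumO)
    qed
    note sum_eq = this
    have "2 * pi * \<i> * (\<mu> * (C * \<phi>)) = contour_integral (circlepath 0 \<rho>) f" by (rule inner[symmetric])
    also have "\<dots> = - (2 * pi * \<i> * (rX * qphi asX bsX q q + S t + S (- t)))" by (subst outer) (simp only: sum_eq)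
    finally have *: "2 * pi * \<i> * (\<mu> * (C * \<phi>)) = - (2 * pi * \<i> * (rX * qphi asX bsX q q + S t + S (- t)))" .
    have "x = - y" if "k * x = - (k * y)" "k \<noteq> 0" for k x y :: complex
      using that by (metis minus_mult_right mult_left_cancel)
    from this[OF *] show ?thesis by simp
  qed

  \<comment> \<open>Comparison of the residues with the stated terms\<close>
  have \<mu>C: "\<mu> * C \<noteq> 0" using theta \<beta> C_nz Pnz[OF q(1)] by (simp add: \<mu>_def C_def d_def mult_ac)
  have X_eq: "X_term q r z a t b c h = - (rX * qphi asX bsX q q) / (\<mu> * C)"
  proof -
    have k: "kern q h a d (b * c / q) = qtheta (h / z) q * qtheta (h * (q * a / (b * c))) q / (qpoch_inf (q * a / (b * c)) q * qpoch_inf z q)"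
    proof -
      have "h * (b * c / q) / d = h / z" "h * a / (b * c / q) = h * (q * a / (b * c))" "a / (b * c / q) = q * a / (b * c)" "d / (b * c / q) = z"
        using q nz z by (simp_all add: d_def)
      thus ?thesis by (simp only: kern_def)
    qed
    have e: "d * (b * c / q) / a = b ^ 2 * c ^ 2 * z / (q ^ 2 * a)" "h * a / d = h * (q * a / (b * c * z))"
      using q by (simp_all add: d_def power2_eq_square)
    \<comment> \<open>The infinite products and series are replaced by variables, so that only a
      rational identity remains.\<close>
    have alg: "t1 * (t2 * 1) * (Pa * (Pb * (Pc * (Pw * 1)))) / (th1 * (th2 * 1) * (Pbe * (Pga * (Pv * (Pz * 1))))) * \<Phi>
       = - (- (t1 * t2 / (Pe * Pz) * (Pc * Pb * Pw / (Pq * Pv))) * \<Phi>) / (th1 * th2 / Pq * (Pbe * Pga / (Pe * Pa)))"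
      if "Pq \<noteq> 0" "Pe \<noteq> 0" for t1 t2 Pa Pb Pc Pw th1 th2 Pbe Pga Pv Pz Pq Pe \<Phi> :: complex
      using that by (simp add: divide_simps)
    show ?thesis
      unfolding X_term_def rX_def k \<mu>_def C_def sqbc e asX_def bsX_def qthetas_Cons qthetas_Nil qpochs_inf_Cons qpochs_inf_Nil
      by (rule alg[OF Pnz[OF q(1)] C_nz(1)])
  qed
  have T_eq: "qpochs_inf [a, q * a / (b * c)] q
      / (2 * qthetas [h, h * (q * a / (b * c * z))] q * qpochs_inf [q * a / b, q * a / c] q) * T_term q r z b c h s
      = - S s / (\<mu> * C)" if s: "s \<in> {t, - t}" for s
  proof -
    have q1: "q \<noteq> 1" using q by auto
    have kE: "kern q h a d s = qtheta (h * s) q * qtheta (h * (q * s / (b * c * z))) q / (qpoch_inf s q * qpoch_inf (b * c * z / (q * s)) q)"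
    proof -
      have "h * s / d = h * (q * s / (b * c * z))" "h * a / s = h * s" "a / s = s" "d / s = b * c * z / (q * s)"
        using st[OF s] by (auto simp: d_def power2_eq_square)
      thus ?thesis by (simp only: kern_def mult.commute)
    qed
    have kO: "kern q h a d (s / r) = qtheta (h * r * s) q * qtheta (h * (r * s / (b * c * z))) q / (qpoch_inf (r * s) q * qpoch_inf (b * c * z / (r * s)) q)"
    proof -
      have "h * (s / r) / d = h * (r * s / (b * c * z))" "h * a / (s / r) = h * r * s" "a / (s / r) = r * s" "d / (s / r) = b * c * z / (r * s)"
        using st(1)[OF s] r unfolding st(2)[OF s, symmetric] d_def roots(1)[symmetric] by (auto simp: power2_eq_square field_simps)
      thus ?thesis by (simp only: kern_def mult.commute)
    qed
    have eE: "d * s / a = b * c * z / (q * s)" using st[OF s] by (auto simp: d_def power2_eq_square)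
    have eO: "q * (s / r) / b = r * s / b" "q * (s / r) / c = r * s / c" "q * (s / r) / (b * c) = r * s / (b * c)" "d * (s / r) / a = b * c * z / (r ^ 3 * s)"
      using st(1)[OF s] r unfolding st(2)[OF s, symmetric] d_def roots(1)[symmetric] by (auto simp: power2_eq_square power3_eq_cube field_simps)
    have e: "h * a / d = h * (q * a / (b * c * z))" by (simp add: d_def)
    have alg: "Pa * (Pe * 1) / (2 * (th1 * (th2 * 1)) * (Pbe * (Pga * 1)))
        * (t1 * (t2 * 1) * (P1 * (P2 * (P3 * 1))) / (P4 * (P5 * (P6 * 1))) * \<Phi>1
           - q / (1 - q) * (t3 * (t4 * 1) * (Q1 * (Q2 * (Q3 * 1))) / (Q4 * (Q5 * (Q6 * 1))) * \<Phi>2))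
      = - (- (1 / 2) * (t1 * t2 / (P4 * P6) * (P1 * P2 * P3 / (P5 * (1 * Pq)))) * \<Phi>1
           + - (1 / 2) * (t3 * t4 / (Q4 * Q6) * (Q1 * Q2 * Q3 / (Q5 * ((1 - 1 / q) * Pq)))) * \<Phi>2) / (th1 * th2 / Pq * (Pbe * Pga / (Pe * Pa)))"
      if nz0: "Pq \<noteq> 0" "Pe \<noteq> 0" "Pa \<noteq> 0" "th1 \<noteq> 0" "th2 \<noteq> 0" "Pbe \<noteq> 0" "Pga \<noteq> 0"
      for Pa Pe th1 th2 Pbe Pga t1 t2 P1 P2 P3 P4 P5 P6 \<Phi>1 t3 t4 Q1 Q2 Q3 Q4 Q5 Q6 \<Phi>2 Pq :: complex
    proof -
      \<comment> \<open>Here the value \<open>e = 1 - 1 / q\<close> from the residues at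
        \<open>s / r\<close> becomes the factor \<open>q / (1 - q)\<close> of
        \<open>T_term\<close>.\<close>
      have q2: "1 / (1 - 1 / q) = - (q / (1 - q))" using q q1 by (simp add: field_simps)
      have "- (1 / 2) * (t3 * t4 / (Q4 * Q6) * (Q1 * Q2 * Q3 / (Q5 * ((1 - 1 / q) * Pq)))) * \<Phi>2
        = (1 / 2) * (t3 * t4 / (Q4 * Q6) * (Q1 * Q2 * Q3 / (Q5 * Pq))) * \<Phi>2 * (- (1 / (1 - 1 / q)))"
        by simp
      also have "\<dots> = (1 / 2) * (t3 * t4 / (Q4 * Q6) * (Q1 * Q2 * Q3 / (Q5 * Pq))) * \<Phi>2 * (q / (1 - q))"
        unfolding q2 by simp
      finally have odd: "- (1 / 2) * (t3 * t4 / (Q4 * Q6) * (Q1 * Q2 * Q3 / (Q5 * ((1 - 1 / q) * Pq)))) * \<Phi>2 = \<dots>" .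
      define g where "g = q / (1 - q)"
      define u where "u = t1 * t2 * P1 * P2 * P3 / (P4 * P5 * P6) * \<Phi>1"
      define v where "v = t3 * t4 * Q1 * Q2 * Q3 / (Q4 * Q5 * Q6) * \<Phi>2"
      have "Pa * Pe / (2 * th1 * th2 * Pbe * Pga) * (u - g * v)
        = - (- (1 / 2) * (u / Pq) + (1 / 2) * (v / Pq) * g) / (th1 * th2 / Pq * (Pbe * Pga / (Pe * Pa)))"
        using nz0 by (simp add: field_simps)
      thus ?thesis unfolding odd unfolding g_def u_def v_def by (simp add: mult_ac)
    qed
    show ?thesis
      unfolding T_term_def S_def rT_def kE kO eE eO \<mu>_def C_def e asE_def bsE_def asO_def bsO_def qthetas_Cons qthetas_Nil qpochs_inf_Cons qpochs_inf_Nil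
      by (rule alg) (use theta \<beta> C_nz Pnz[OF q(1)] in auto)
  qed
  have "\<phi> = - (rX * qphi asX bsX q q + S t + S (- t)) / (\<mu> * C)"
    using total \<mu>C by (simp add: field_simps)
  also have "\<dots> = - (rX * qphi asX bsX q q) / (\<mu> * C) + (- S t / (\<mu> * C) + - S (- t) / (\<mu> * C))"
    by (simp add: add_divide_distrib diff_divide_distrib)
  also have "- S t / (\<mu> * C) = qpochs_inf [a, q * a / (b * c)] q
      / (2 * qthetas [h, h * (q * a / (b * c * z))] q * qpochs_inf [q * a / b, q * a / c] q) * T_term q r z b c h t"
    by (rule T_eq[symmetric]) simp
  also have "- S (- t) / (\<mu> * C) = qpochs_inf [a, q * a / (b * c)] q
      / (2 * qthetas [h, h * (q * a / (b * c * z))] q * qpochs_inf [q * a / b, q * a / c] q) * T_term q r z b c h (- t)"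
    by (rule T_eq[symmetric]) simp
  finally show ?thesis
    unfolding \<phi>_def X_eq distrib_left .
qed

section \<open>Analytic continuation in the parameters\<close>

theorem theorem4p3:
  fixes q r z a t b c h :: complex
  assumes nonzero: "q \<noteq> 0" "z \<noteq> 0" "a \<noteq> 0" "b \<noteq> 0" "c \<noteq> 0" "h \<noteq> 0"
    and norms: "norm q < 1" "norm z < 1"
    and roots: "r ^ 2 = q" "t ^ 2 = a"
    and lower_3phi2: "admissible_lower [q * a / b, q * a / c] q"
    and theta_nz: "qthetas [h, h * (q * a / (b * c * z))] q \<noteq> 0"
    and qpochs_nz:
      "qpochs_inf [q * a / b, q * a / c, b ^ 2 * c ^ 2 / (q ^ 2 * a), z] q \<noteq> 0"
    and lower_X: "admissible_lower
      [q * r * t / (b * c), - (q * r * t / (b * c)),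
       q ^ 2 * t / (b * c), - (q ^ 2 * t / (b * c))] q"
    and qpochs_T_nz:
      "\<And>s. s \<in> {t, - t} \<Longrightarrow>
         qpochs_inf [s, q * s / (b * c), b * c * z / (q * s)] q \<noteq> 0"
      "\<And>s. s \<in> {t, - t} \<Longrightarrow>
         qpochs_inf [r * s, r * s / (b * c), b * c * z / (r * s)] q \<noteq> 0"
    and lower_T:
      "\<And>s. s \<in> {t, - t} \<Longrightarrow> admissible_lower [- q, r, - r, b * c / s] q"
      "\<And>s. s \<in> {t, - t} \<Longrightarrow>
         admissible_lower [- q, r ^ 3, - (r ^ 3), r * b * c / s] q"
  shows "qphi [a, b, c] [q * a / b, q * a / c] q z =
    X_term q r z a t b c h
    + qpochs_inf [a, q * a / (b * c)] q
      / (2 * qthetas [h, h * (q * a / (b * c * z))] q * qpochs_inf [q * a / b, q * a / c] q)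
      * (T_term q r z b c h t + T_term q r z b c h (- t))"
proof -
  have q: "norm q < 1" "q \<noteq> 0" by fact+
  have t: "t \<noteq> 0" and r: "r \<noteq> 0" using nonzero roots by auto
  \<comment> \<open>A cube root of \<open>x\<close> is the radius of the domain: it exceeds 1, so
    the target \<open>u = 1\<close> lies inside, while \<open>norm (Z u) < 1\<close> still holds
    throughout.\<close>
  obtain x where x: "1 < x" "x < 1 / norm z"
    using dense[of 1 "1 / norm z"] norms nonzero by (auto simp: field_simps)
  \<comment> \<open>The origin is removed because the deformed parameters are divided by
    \<open>Z u\<close>, \<open>A u\<close> and \<open>\<T> u\<close>.\<close>
  define \<Omega> where "\<Omega> = ball (0 :: complex) (root 3 x) - {0}"
  have root3: "1 < root 3 x" using x by simp
  \<comment> \<open>With \<open>b\<close>, \<open>c\<close> and \<open>h\<close> fixed,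
    \<open>b * c * Z u / q\<close>, \<open>A u\<close> and \<open>\<T> u\<close> are of order 3, 2
    and 1 in \<open>u\<close>, so the inequalities of \<open>transformation_small\<close> hold near
    0.\<close>
  define Z where "Z = (\<lambda>u :: complex. z * u ^ 3)"
  define \<T> where "\<T> = (\<lambda>u :: complex. t * u)"
  define A where "A = (\<lambda>u :: complex. a * u ^ 2)"
  have \<Omega>: "open \<Omega>" "1 \<in> \<Omega>" "connected \<Omega>"
  proof -
    show "open \<Omega>" by (auto simp: \<Omega>_def)
    show "1 \<in> \<Omega>" using root3 by (simp add: \<Omega>_def)
    show "connected \<Omega>" unfolding \<Omega>_def by (rule connected_open_delete) auto
  qed
  have u0: "u \<noteq> 0" if "u \<in> \<Omega>" for u using that by (simp add: \<Omega>_def)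
  have Z1: "norm (Z u) < 1" if "u \<in> \<Omega>" for u
  proof -
    have "norm u < root 3 x" using that by (simp add: \<Omega>_def)
    hence "norm u ^ 3 < root 3 x ^ 3" by (intro power_strict_mono) auto
    also have "root 3 x ^ 3 = x" by (rule real_root_pow_pos2) (use x in auto)
    finally have "norm z * norm u ^ 3 < norm z * x" using nonzero by simp
    also have "\<dots> < norm z * (1 / norm z)" using x nonzero by (intro mult_strict_left_mono) auto
    finally show ?thesis using nonzero by (simp add: Z_def norm_mult norm_power)
  qed
  have Znz: "Z u \<noteq> 0" "\<T> u \<noteq> 0" "A u \<noteq> 0" if "u \<in> \<Omega>" for u using u0[OF that] nonzero t by (auto simp: Z_def \<T>_def A_def)
  have hol: "Z holomorphic_on \<Omega>" "\<T> holomorphic_on \<Omega>" "A holomorphic_on \<Omega>"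
    unfolding Z_def \<T>_def A_def by (intro holomorphic_intros)+
  \<comment> \<open>All arguments whose infinite products must stay nonzero, with separate entries
    for the two square roots. The lower parameters built from \<open>q\<close> and \<open>r\<close>
    alone do not move with \<open>u\<close> and are covered by \<open>lowT\<close>.\<close>
  define params :: "(complex \<Rightarrow> complex) list" where "params = [\<lambda>u. h, \<lambda>u. q / h, \<lambda>u. h * (q * A u / (b * c * Z u)), \<lambda>u. q / (h * (q * A u / (b * c * Z u))),
     \<lambda>u. q * A u / b, \<lambda>u. q * A u / c, \<lambda>u. b ^ 2 * c ^ 2 / (q ^ 2 * A u), \<lambda>u. Z u,
     \<lambda>u. q * r * \<T> u / (b * c), \<lambda>u. - (q * r * \<T> u / (b * c)), \<lambda>u. q ^ 2 * \<T> u / (b * c), \<lambda>u. - (q ^ 2 * \<T> u / (b * c)),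
     \<lambda>u. \<T> u, \<lambda>u. q * \<T> u / (b * c), \<lambda>u. b * c * Z u / (q * \<T> u), \<lambda>u. r * \<T> u, \<lambda>u. r * \<T> u / (b * c), \<lambda>u. b * c * Z u / (r * \<T> u),
     \<lambda>u. b * c / \<T> u, \<lambda>u. r * b * c / \<T> u,
     \<lambda>u. - \<T> u, \<lambda>u. q * - \<T> u / (b * c), \<lambda>u. b * c * Z u / (q * - \<T> u), \<lambda>u. r * - \<T> u, \<lambda>u. r * - \<T> u / (b * c), \<lambda>u. b * c * Z u / (r * - \<T> u),
     \<lambda>u. b * c / - \<T> u, \<lambda>u. r * b * c / - \<T> u]"
  define D where "D = (\<lambda>u. \<Prod>g\<leftarrow>params. qpoch_inf (g u) q)"
  have D_eq_0: "D u = 0 \<longleftrightarrow> (\<exists>g\<in>set params. qpoch_inf (g u) q = 0)" for u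
    unfolding D_def by (auto simp: prod_list_zero_iff)
  have hol_params: "\<forall>g\<in>set params. g holomorphic_on \<Omega>"
    unfolding params_def list.set ball_simps using hol Znz nonzero q r by (intro conjI TrueI) (auto intro!: holomorphic_intros)
  have prod_hol: "(\<lambda>u. \<Prod>g\<leftarrow>gs. qpoch_inf (g u) q) holomorphic_on \<Omega>" if "\<forall>g\<in>set gs. g holomorphic_on \<Omega>" for gs
    using that by (induction gs) (auto intro!: holomorphic_intros q)
  have D_hol: "D holomorphic_on \<Omega>" unfolding D_def by (rule prod_hol[OF hol_params])
  have at_1: "Z 1 = z" "\<T> 1 = t" "A 1 = a" by (simp_all add: Z_def \<T>_def A_def)
  have adm: "admissible_lower (x # xs) q \<longleftrightarrow> qpoch_inf x q \<noteq> 0 \<and> admissible_lower xs q" for x xs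
    by (rule admissible_lower_Cons[OF q(2,1)])
  have D1: "D 1 \<noteq> 0"
    unfolding D_eq_0 using theta_nz qpochs_nz lower_X qpochs_T_nz[of t] qpochs_T_nz[of "- t"] lower_T[of t] lower_T[of "- t"]
    by (simp add: params_def at_1 adm qtheta_eq q)
  define S where "S = \<Omega> - {u\<in>\<Omega>. D u = 0}"
  have lowT: "qpoch_inf x q \<noteq> 0" if "x \<in> {- q, r, - r, r ^ 3, - (r ^ 3)}" for x
    using that lower_T[of t] by (auto simp: adm)
  have S_iff: "u \<in> S \<longleftrightarrow> u \<in> \<Omega> \<and> (\<forall>g\<in>set params. qpoch_inf (g u) q \<noteq> 0)" for u
    unfolding S_def using D_eq_0 by blast
  have S1: "1 \<in> S" using D1 \<Omega> by (simp add: S_def)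
  \<comment> \<open>\<open>D\<close> is holomorphic and nonzero at 1, so it vanishes on a countable
    set only. Removing such a set from a connected open subset of the plane keeps it
    connected.\<close>
  have countable_zeros: "countable {u\<in>\<Omega>. D u = 0}"
  proof (cases "D constant_on \<Omega>")
    case True
    hence "{u\<in>\<Omega>. D u = 0} = {}" using D1 \<Omega>(2) unfolding constant_on_def by fastforce
    thus ?thesis by (simp only: countable_empty)
  next
    case False
    obtain K :: "nat \<Rightarrow> complex set" where "\<And>n. compact (K n)" "(\<Union>n. K n) = \<Omega>"
      by (rule open_Union_compact_subsets[OF \<Omega>(1)]) blast
    hence "fsigma \<Omega>" using fsigma.intros[of K] compact_imp_closed by blast
    thus ?thesis by (rule holomorphic_countable_zeros[OF D_hol \<Omega>(1,3) _ False])
  qed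
  have S_conn: "connected S"
    unfolding S_def by (rule connected_open_diff_countable[OF _ \<Omega>(1,3) countable_zeros]) simp
  have S_open: "open S"
  proof -
    have "open (D -` (- {0}) \<inter> \<Omega>)"
      by (rule continuous_open_preimage[OF holomorphic_on_imp_continuous_on[OF D_hol] \<Omega>(1), of "- {0}", unfolded Int_commute[of \<Omega>]]) (auto intro!: open_Compl)
    moreover have "S = D -` (- {0}) \<inter> \<Omega>" by (auto simp: S_def)
    ultimately show ?thesis by simp
  qed

  \<comment> \<open>Holomorphy of both sides on the deformed parameters\<close>
  define lhs where "lhs = (\<lambda>u. qphi [A u, b, c] [q * A u / b, q * A u / c] q (Z u))"
  define rhs where "rhs = (\<lambda>u. X_term q r (Z u) (A u) (\<T> u) b c h
    + qpochs_inf [A u, q * A u / (b * c)] q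
      / (2 * qthetas [h, h * (q * A u / (b * c * Z u))] q * qpochs_inf [q * A u / b, q * A u / c] q)
      * (T_term q r (Z u) b c h (\<T> u) + T_term q r (Z u) b c h (- \<T> u)))"
  have S_sub: "S \<subseteq> \<Omega>" by (auto simp: S_def)
  have holS: "Z holomorphic_on S" "\<T> holomorphic_on S" "A holomorphic_on S"
    using hol S_sub holomorphic_on_subset by blast+
  have nzS: "Z u \<noteq> 0" "\<T> u \<noteq> 0" "A u \<noteq> 0" "norm (Z u) < 1" if "u \<in> S" for u using Znz Z1 S_sub that by auto
  have "list_all (\<lambda>g. qpoch_inf (g u) q \<noteq> 0) params" if "u \<in> S" for u using that S_iff by (simp add: list_all_iff)
  note params_nz = this[unfolded params_def list.pred_inject]
  have lhs_hol: "lhs holomorphic_on S"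
  proof -
    have "(\<lambda>u. qphi (map (\<lambda>f. f u) [A, \<lambda>_. b, \<lambda>_. c]) (map (\<lambda>g. g u) [\<lambda>u. q * A u / b, \<lambda>u. q * A u / c]) q (Z u)) holomorphic_on S"
      by (rule holomorphic_on_qphi[OF q(1) S_open])
         (use holS nzS nonzero params_nz in \<open>auto intro!: holomorphic_intros\<close>)
    thus ?thesis by (simp add: lhs_def)
  qed
  have X_hol: "(\<lambda>u. X_term q r (Z u) (A u) (\<T> u) b c h) holomorphic_on S"
  proof -
    have "(\<lambda>u. qphi (map (\<lambda>f. f u) [\<lambda>_. q / b, \<lambda>_. q / c, \<lambda>u. q * A u / (b * c), Z, \<lambda>u. q ^ 3 * A u / (b ^ 2 * c ^ 2 * Z u)])
        (map (\<lambda>g. g u) [\<lambda>u. q * r * \<T> u / (b * c), \<lambda>u. - (q * r * \<T> u / (b * c)), \<lambda>u. q ^ 2 * \<T> u / (b * c), \<lambda>u. - (q ^ 2 * \<T> u / (b * c))]) q q)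
        holomorphic_on S"
      by (rule holomorphic_on_qphi[OF q(1) S_open])
         (use holS nzS nonzero params_nz q in \<open>auto intro!: holomorphic_intros\<close>)
    hence phi: "(\<lambda>u. qphi [q / b, q / c, q * A u / (b * c), Z u, q ^ 3 * A u / (b ^ 2 * c ^ 2 * Z u)]
        [q * r * \<T> u / (b * c), - (q * r * \<T> u / (b * c)), q ^ 2 * \<T> u / (b * c), - (q ^ 2 * \<T> u / (b * c))] q q) holomorphic_on S"
      by simp
    have den: "qtheta h q * (qtheta (h * (q * A u / (b * c * Z u))) q * 1) * (qpoch_inf (q * A u / b) q * (qpoch_inf (q * A u / c) q *
        (qpoch_inf (b ^ 2 * c ^ 2 / (q ^ 2 * A u)) q * (qpoch_inf (Z u) q * 1)))) \<noteq> 0" if "u \<in> S" for u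
      unfolding qtheta_eq mult_eq_0_iff de_Morgan_disj using params_nz[OF that] by simp
    show ?thesis
      unfolding X_term_def qthetas_Cons qthetas_Nil qpochs_inf_Cons qpochs_inf_Nil
      by (intro holomorphic_on_mult[OF _ phi] holomorphic_on_divide holomorphic_on_mult holomorphic_on_qtheta holomorphic_on_qpoch_inf
            holomorphic_on_const holomorphic_on_power holS q den)
         (use nzS nonzero q in auto)
  qed
  have T_hol: "(\<lambda>u. T_term q r (Z u) b c h (s u)) holomorphic_on S"
    if s: "s holomorphic_on S" "\<And>u. u \<in> S \<Longrightarrow> s u \<noteq> 0"
      and s_nz: "\<And>u x. u \<in> S \<Longrightarrow> x \<in> {s u, q * s u / (b * c), b * c * Z u / (q * s u), r * s u, r * s u / (b * c), b * c * Z u / (r * s u),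
        b * c / s u, r * b * c / s u} \<Longrightarrow> qpoch_inf x q \<noteq> 0" for s
  proof -
    have "(\<lambda>u. qphi (map (\<lambda>f. f u) [s, \<lambda>u. b / s u, \<lambda>u. c / s u, \<lambda>u. b * c * Z u / (q * s u), \<lambda>u. q ^ 2 * s u / (b * c * Z u)])
        (map (\<lambda>g. g u) [\<lambda>_. - q, \<lambda>_. r, \<lambda>_. - r, \<lambda>u. b * c / s u]) q q) holomorphic_on S"
      by (rule holomorphic_on_qphi[OF q(1) S_open])
         (use holS s s_nz nzS nonzero lowT q in \<open>auto intro!: holomorphic_intros\<close>)
    hence phiE: "(\<lambda>u. qphi [s u, b / s u, c / s u, b * c * Z u / (q * s u), q ^ 2 * s u / (b * c * Z u)] [- q, r, - r, b * c / s u] q q) holomorphic_on S"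
      by simp
    have "(\<lambda>u. qphi (map (\<lambda>f. f u) [\<lambda>u. r * s u, \<lambda>u. r * b / s u, \<lambda>u. r * c / s u, \<lambda>u. b * c * Z u / (r * s u), \<lambda>u. r ^ 5 * s u / (b * c * Z u)])
        (map (\<lambda>g. g u) [\<lambda>_. - q, \<lambda>_. r ^ 3, \<lambda>_. - (r ^ 3), \<lambda>u. r * b * c / s u]) q q) holomorphic_on S"
      by (rule holomorphic_on_qphi[OF q(1) S_open])
         (use holS s s_nz nzS nonzero lowT q r in \<open>auto intro!: holomorphic_intros\<close>)
    hence phiO: "(\<lambda>u. qphi [r * s u, r * b / s u, r * c / s u, b * c * Z u / (r * s u), r ^ 5 * s u / (b * c * Z u)] [- q, r ^ 3, - (r ^ 3), r * b * c / s u] q q) holomorphic_on S"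
      by simp
    have den: "qpoch_inf (s u) q * (qpoch_inf (q * s u / (b * c)) q * (qpoch_inf (b * c * Z u / (q * s u)) q * 1)) \<noteq> 0"
      "qpoch_inf (r * s u) q * (qpoch_inf (r * s u / (b * c)) q * (qpoch_inf (b * c * Z u / (r * s u)) q * 1)) \<noteq> 0" if "u \<in> S" for u
      unfolding mult_eq_0_iff de_Morgan_disj using s_nz[OF that] by simp_all
    show ?thesis
      unfolding T_term_def qthetas_Cons qthetas_Nil qpochs_inf_Cons qpochs_inf_Nil
      by (intro holomorphic_on_diff holomorphic_on_mult[OF _ phiE] holomorphic_on_mult[OF _ phiO] holomorphic_on_divide holomorphic_on_mult
            holomorphic_on_qtheta holomorphic_on_qpoch_inf holomorphic_on_const holomorphic_on_power holS s(1) q den)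
         (use nzS s nonzero q r in auto)
  qed
  have rhs_hol: "rhs holomorphic_on S"
  proof -
    have T1: "(\<lambda>u. T_term q r (Z u) b c h (\<T> u)) holomorphic_on S"
      by (rule T_hol) (use holS nzS params_nz in auto)
    have T2: "(\<lambda>u. T_term q r (Z u) b c h (- \<T> u)) holomorphic_on S"
      by (rule T_hol) (use holS nzS params_nz in \<open>auto intro!: holomorphic_intros\<close>)
    have den: "2 * (qtheta h q * (qtheta (h * (q * A u / (b * c * Z u))) q * 1)) * (qpoch_inf (q * A u / b) q * (qpoch_inf (q * A u / c) q * 1)) \<noteq> 0"
      if "u \<in> S" for u
      unfolding qtheta_eq mult_eq_0_iff de_Morgan_disj using params_nz[OF that] by simp
    show ?thesis
      unfolding rhs_def qthetas_Cons qthetas_Nil qpochs_inf_Cons qpochs_inf_Nil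
      by (intro holomorphic_on_add[OF X_hol] holomorphic_on_mult[OF _ holomorphic_on_add[OF T1 T2]] holomorphic_on_divide holomorphic_on_mult
            holomorphic_on_qtheta holomorphic_on_qpoch_inf holomorphic_on_const holS q den)
         (use nzS nonzero q in auto)
  qed
  \<comment> \<open>Each quotient is the bound on \<open>norm u\<close> that gives one inequality of
    \<open>transformation_small\<close> after cancelling powers of \<open>norm u\<close>. The entry
    1 allows \<open>norm u ^ 2 \<le> norm u\<close> in the last one.\<close>
  define \<delta> where "\<delta> = Min {1, norm a / norm (b * c * z / q), norm t / norm a, norm (b * c / q) / norm a}"
  have \<delta>: "\<delta> > 0" "\<delta> \<le> 1" "\<delta> \<le> norm a / norm (b * c * z / q)" "\<delta> \<le> norm t / norm a" "\<delta> \<le> norm (b * c / q) / norm a"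
    unfolding \<delta>_def using nonzero t by auto
  have agree: "lhs u = rhs u" if u: "u \<in> S \<inter> ball 0 \<delta>" for u
  proof -
    have uS: "u \<in> S" and u\<delta>: "norm u < \<delta>" and un: "norm u > 0" using u S_sub u0 by auto
    have u1: "norm u < 1" using u\<delta> \<delta> by linarith
    have "norm u ^ 2 \<le> norm u" using u1 by (simp add: power2_eq_square mult_left_le)
    hence u2: "norm u ^ 2 < norm (b * c / q) / norm a" using u\<delta> \<delta> by linarith
    note nzp = params_nz[OF uS]
    show ?thesis
      unfolding lhs_def rhs_def
    proof (rule transformation_small[OF q _ _ _ nonzero(4,5,6) roots(1)])
      show "norm (Z u) < 1" "Z u \<noteq> 0" "\<T> u \<noteq> 0" using nzS[OF uS] by auto
      show "\<T> u ^ 2 = A u" by (simp add: \<T>_def A_def power_mult_distrib roots)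
      show "norm (b * c * Z u / q) < norm (A u)"
      proof -
        have "norm u < norm a / norm (b * c * z / q)" using u\<delta> \<delta> by linarith
        hence "norm (b * c * z / q) * norm u < norm a" using nonzero by (simp add: pos_less_divide_eq mult.commute)
        hence "norm (b * c * z / q) * norm u * norm u ^ 2 < norm a * norm u ^ 2" using un by (intro mult_strict_right_mono) auto
        thus ?thesis by (simp add: Z_def A_def norm_mult norm_divide norm_power power2_eq_square power3_eq_cube mult_ac)
      qed
      show "norm (A u) < norm (\<T> u)"
      proof -
        have "norm u < norm t / norm a" using u\<delta> \<delta> by linarith
        hence "norm a * norm u < norm t" using nonzero by (simp add: pos_less_divide_eq mult.commute)
        hence "norm a * norm u * norm u < norm t * norm u" using un by (intro mult_strict_right_mono) auto
        thus ?thesis by (simp add: \<T>_def A_def norm_mult norm_power power2_eq_square mult_ac)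
      qed
      show "norm (A u) < norm (b * c / q)"
        using u2 nonzero by (simp add: A_def norm_mult norm_power pos_less_divide_eq mult.commute)
      show "qpoch_inf (q * A u / b) q \<noteq> 0" "qpoch_inf (q * A u / c) q \<noteq> 0" "qpoch_inf (b ^ 2 * c ^ 2 / (q ^ 2 * A u)) q \<noteq> 0"
        using nzp by simp_all
      show "qtheta h q \<noteq> 0" "qtheta (h * (q * A u / (b * c * Z u))) q \<noteq> 0"
        unfolding qtheta_eq mult_eq_0_iff de_Morgan_disj using nzp by simp_all
      show "qpoch_inf x q \<noteq> 0" if "x \<in> {q * r * \<T> u / (b * c), - (q * r * \<T> u / (b * c)), q ^ 2 * \<T> u / (b * c), - (q ^ 2 * \<T> u / (b * c))}" for x
        using that nzp by auto
      show "qpoch_inf x q \<noteq> 0" if "s \<in> {\<T> u, - \<T> u}" "x \<in> {s, q * s / (b * c), b * c * Z u / (q * s), r * s, r * s / (b * c), b * c * Z u / (r * s), b * c / s, r * b * c / s}" for s x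
        using that nzp by auto
      show "qpoch_inf x q \<noteq> 0" if "x \<in> {- q, r, - r, r ^ 3, - (r ^ 3)}" for x by (rule lowT[OF that])
    qed
  qed
  \<comment> \<open>The zeros of \<open>D\<close> may accumulate at 0, which lies outside the
    domain, so nonemptiness is obtained by cardinality: a punctured disc is uncountable.\<close>
  have ne: "S \<inter> ball 0 \<delta> \<noteq> {}"
  proof
    assume "S \<inter> ball 0 \<delta> = {}"
    hence "\<Omega> \<inter> ball 0 \<delta> \<subseteq> {u\<in>\<Omega>. D u = 0}" by (auto simp: S_def)
    hence "countable (\<Omega> \<inter> ball 0 \<delta>)" using countable_zeros countable_subset by blast
    moreover have "\<Omega> \<inter> ball 0 \<delta> = ball 0 \<delta> - {0}" using order.trans[OF \<delta>(2) less_imp_le[OF root3]] by (auto simp: \<Omega>_def)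
    ultimately have "countable (insert 0 (ball 0 \<delta> - {0 :: complex}))" by simp
    moreover have "insert 0 (ball 0 \<delta> - {0 :: complex}) = ball 0 \<delta>" using \<delta>(1) by auto
    ultimately show False using uncountable_ball[OF \<delta>(1)] by metis
  qed
  have "lhs 1 = rhs 1"
    by (rule analytic_continuation_open[of "S \<inter> ball 0 \<delta>" S lhs rhs]) (use S_open ne S_conn lhs_hol rhs_hol agree S1 in auto)
  thus ?thesis by (simp only: lhs_def rhs_def at_1)
qed

end
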